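(* Let $l$ be an odd positive integer. Then there exist holomorphic modular forms $f_j$ ($j=0,2,4,\ldots,l-1$) on $\operatorname{SL}_2(\mathbb{Z})$, with $f_j$ of weight $j$, such that $$\sum_{k=0}^{(l-1)/2} f_{l-2k-1}\, \mathcal{H}^k A_l = (l-1)!\, f_0\, \eta^l\, \mathcal{C}^l ,$$ as an identity of functions of $(z,\tau)$, meromorphic in $z\in\mathbb{C}$, with $\tau$ in the complex upper half plane $\mathbb{H}$. Here $A_l$ is the level $l$ Appell function, $\mathcal{C}$ is the modified crank generating function, $\eta$ is the Dedekind eta function, and $\mathcal{H}^k$ are the differential operators (depending on $l$) defined in the context.
   Context: Notation: $z\in\mathbb{C}$, $\tau\in\mathbb{H}$ (the complex upper half plane), $w=\exp(2\pi i z)$, $q=\exp(2\pi i\tau)$; fractional powers mean $w^{a}=\exp(2\pi i a z)$ and $q^{a}=\exp(2\pi i a\tau)$. Put $(q)_\infty=\prod_{n=1}^\infty(1-q^n)$ and $\eta(\tau)=q^{1/24}(q)_\infty$. The level $l$ Appell function, for a positive integer $l$, is $$A_l(z;\tau):=w^{l/2}\sum_{n\in\mathbb{Z}}\frac{(-1)^{ln}q^{\frac{l}{2}n(n+1)}}{1-wq^n}.$$ The crank generating function is $$C(w;q)=\prod_{n=1}^\infty\frac{1-q^n}{(1-wq^n)(1-w^{-1}q^n)},$$ and the modified crank generating function is $$\mathcal{C}(z;\tau):=\frac{w^{1/2}q^{-1/24}}{1-w}\,C(w;q).$$ Both $A_l$ and $\mathcal{C}$ are meromorphic in $z$ with poles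 only in $\mathbb{Z}\tau+\mathbb{Z}$. The weight 2 Eisenstein series is $E_2(\tau)=1-24\sum_{n=1}^\infty\bigl(\sum_{d\mid n}d\bigr)q^n$. For the given $l$, the differential operators are $$\mathcal{H}_k:=\frac{l}{\pi i}\frac{\partial}{\partial\tau}+\frac{1}{(2\pi i)^2}\frac{\partial^2}{\partial z^2}-\frac{l(2k-1)}{12}E_2,$$ $$\mathcal{H}^k:=\mathcal{H}_{2k-1}\mathcal{H}_{2k-3}\cdots\mathcal{H}_3\mathcal{H}_1$$ (a composition of $k$ operators, with $\mathcal{H}_1$ applied first; $\mathcal{H}^0$ is the identity). Here $E_2$ acts by multiplication, and the modular forms $f_j=f_j(\tau)$ multiply as functions of $\tau$. Holomorphic modular forms are holomorphic on $\mathbb{H}$ and at the cusp infinity. *)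

theory Defs
  imports "HOL-Analysis.Analysis"
begin

definition upper_half_plane :: "complex set" where
  "upper_half_plane = {\<tau>. Im \<tau> > 0}"

text \<open>
  With \<open>w = e2pi z\<close> and \<open>q = e2pi \<tau>\<close>, the fractional powers \<open>w\<^sup>a\<close> and \<open>q\<^sup>a\<close>
  are \<open>e2pi (a * z)\<close> and \<open>e2pi (a * \<tau>)\<close>.
\<close>

definition e2pi :: "complex \<Rightarrow> complex" where
  "e2pi x = exp (2 * of_real pi * \<i> * x)"

definition period_lattice :: "complex \<Rightarrow> complex set" where
  "period_lattice \<tau> = {of_int m * \<tau> + of_int n | m n. True}"

definition q_inf :: "complex \<Rightarrow> complex" where
  "q_inf q = (\<Prod>n. 1 - q ^ Suc n)"

definition dedekind_eta :: "complex \<Rightarrow> complex" where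
  "dedekind_eta \<tau> = e2pi (\<tau> / 24) * q_inf (e2pi \<tau>)"

text \<open>
  At its poles, which lie in \<open>period_lattice \<tau>\<close>, the value of \<open>appell l z \<tau>\<close> or
  \<open>modified_crank z \<tau>\<close> is meaningless, because \<open>x / 0 = 0\<close>.
\<close>

definition appell :: "nat \<Rightarrow> complex \<Rightarrow> complex \<Rightarrow> complex" where
  "appell l z \<tau> = e2pi (of_nat l / 2 * z) *
     (\<Sum>\<^sub>\<infinity>n\<in>(UNIV :: int set).
        (- 1) powi (int l * n) * e2pi (of_nat l / 2 * of_int (n * (n + 1)) * \<tau>) /
        (1 - e2pi z * e2pi \<tau> powi n))"

definition crank_gf :: "complex \<Rightarrow> complex \<Rightarrow> complex" where
  "crank_gf w q =
     (\<Prod>n. (1 - q ^ Suc n) / ((1 - w * q ^ Suc n) * (1 - inverse w * q ^ Suc n)))"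

definition modified_crank :: "complex \<Rightarrow> complex \<Rightarrow> complex" where
  "modified_crank z \<tau> =
     e2pi (z / 2) * e2pi (- \<tau> / 24) / (1 - e2pi z) * crank_gf (e2pi z) (e2pi \<tau>)"

definition eisenstein_E2 :: "complex \<Rightarrow> complex" where
  "eisenstein_E2 \<tau> =
     1 - 24 * (\<Sum>n. of_nat (\<Sum>d | d dvd Suc n. d) * e2pi \<tau> ^ Suc n)"

text \<open>
  Functions of \<open>(z, \<tau>)\<close> are curried, with \<open>z\<close> first.
\<close>

definition heat_op ::
  "nat \<Rightarrow> nat \<Rightarrow> (complex \<Rightarrow> complex \<Rightarrow> complex) \<Rightarrow> complex \<Rightarrow> complex \<Rightarrow> complex" where
  "heat_op l k F = (\<lambda>z \<tau>.
     of_nat l / (of_real pi * \<i>) * deriv (\<lambda>t. F z t) \<tau>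
     + 1 / (2 * of_real pi * \<i>)\<^sup>2 * (deriv ^^ 2) (\<lambda>s. F s \<tau>) z
     - of_nat l * (2 * of_nat k - 1) / 12 * eisenstein_E2 \<tau> * F z \<tau>)"

text \<open>
  The index of the outermost factor of the \<open>Suc k\<close>-fold composition is \<open>2 * Suc k - 1\<close>.
\<close>

primrec heat_op_iter ::
  "nat \<Rightarrow> nat \<Rightarrow> (complex \<Rightarrow> complex \<Rightarrow> complex) \<Rightarrow> complex \<Rightarrow> complex \<Rightarrow> complex" where
  "heat_op_iter l 0 F = F"
| "heat_op_iter l (Suc k) F = heat_op l (2 * k + 1) (heat_op_iter l k F)"

text \<open>
  Holomorphy at the cusp: \<open>f\<close> is a holomorphic function of \<open>q\<close>, extending over \<open>q = 0\<close>.
\<close>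

definition modular_form :: "int \<Rightarrow> (complex \<Rightarrow> complex) \<Rightarrow> bool" where
  "modular_form k f \<longleftrightarrow>
     f holomorphic_on upper_half_plane \<and>
     (\<forall>a b c d :: int. a * d - b * c = 1 \<longrightarrow>
        (\<forall>\<tau>\<in>upper_half_plane.
           f ((of_int a * \<tau> + of_int b) / (of_int c * \<tau> + of_int d)) =
           (of_int c * \<tau> + of_int d) powi k * f \<tau>)) \<and>
     (\<exists>g. g holomorphic_on ball 0 1 \<and> (\<forall>\<tau>\<in>upper_half_plane. f \<tau> = g (e2pi \<tau>)))"

end

theory Submission
  imports Defs "HOL-Complex_Analysis.Complex_Analysis" "HOL-Real_Asymp.Real_Asymp"
begin

text \<open>
  Write \<open>w = e2pi z\<close>, \<open>q = e2pi \<tau>\<close>, \<open>u = 2 \<pi> \<i> z\<close> and \<open>l = 2 m + 1\<close>. The product of \<open>\<eta>\<close> and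
  the modified crank is the reciprocal of a theta function \<open>\<Theta>\<close>, which is entire in \<open>z\<close> and vanishes
  to first order at the lattice points and nowhere else (\<open>eta_times_crank\<close>). So the right-hand side
  is a constant times \<open>\<Theta>\<close> to the power \<open>- l\<close>: it changes sign under \<open>z \<mapsto> z + 1\<close>, is multiplied by
  \<open>- w\<^sup>l q\<^bsup>l/2\<^esup>\<close> under \<open>z \<mapsto> z + \<tau>\<close>, and has poles of order \<open>l\<close> at the lattice points.

  The functions \<open>\<H>\<^sup>k A\<^sub>l\<close> have the same behaviour up to an error: under \<open>z \<mapsto> z + \<tau>\<close> a linear
  combination of the monomials \<open>w\<^sup>r\<close> with \<open>l / 2 \<le> r < 3 l / 2\<close> appears in addition
  (\<open>appell_sum_add_tau\<close>). Such an error is harmless. An entire function that obeys an inhomogeneous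
  law of this shape is bounded after division by \<open>w\<^bsup>l/2\<^esup>\<close>, because the range of exponents is exactly
  the one in which the factor \<open>w\<^sup>l\<close> wins for \<open>Im z \<rightarrow> - \<infinity>\<close> and loses for \<open>Im z \<rightarrow> \<infinity>\<close>; by
  Liouville's theorem it is zero (\<open>inhomogeneous_elliptic_eq_0\<close>). Hence a linear combination of the
  \<open>\<H>\<^sup>k A\<^sub>l\<close> whose principal part at \<open>z = 0\<close> agrees with that of the right-hand side is equal to it.

  Only odd powers of \<open>1 / u\<close> occur in the principal parts, and \<open>\<H>\<^sup>k A\<^sub>l\<close> has a pole of order
  \<open>2 k + 1\<close> with a nonzero constant as leading coefficient. So the coefficients \<open>f\<^sub>j\<close> are the unique
  solution of a triangular system (\<open>pde_coeff\<close>), and the point is that they are modular forms.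
  The principal part of \<open>\<Theta>\<close> to the power \<open>- l\<close> is read off from the Taylor coefficients \<open>\<chi>\<^sub>j\<close> of the
  function \<open>\<chi>\<close> with \<open>\<Theta> = - u exp (- \<chi>)\<close>. For every matrix in \<open>SL\<^sub>2(\<int>)\<close>, the transformed theta
  function has the zeros and the elliptic law of \<open>\<Theta>\<close>, so it is \<open>\<Theta>\<close> (\<open>crank_theta_moebius\<close>). Comparing
  Taylor coefficients shows that \<open>\<chi>\<^sub>j\<close> is a modular form of weight \<open>j\<close> for \<open>j \<noteq> 2\<close>, while
  \<open>\<chi>\<^sub>2 = - E\<^sub>2 / 24\<close>, which also gives the transformation law of \<open>E\<^sub>2\<close>.

  All quasimodular terms therefore sit in the factor \<open>exp (- l E\<^sub>2 u\<^sup>2 / 24)\<close>. The same factor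
  removes them from the heat operators: conjugation with it turns \<open>\<H>\<^sub>k\<close> into an operator built from
  Serre derivatives, \<open>\<partial>\<^sup>2 / \<partial>u\<^sup>2\<close> and a modular form of weight 4 (\<open>heat_coeff_eq\<close>,
  \<open>crank_nth_eq\<close>). After the exponential has been cancelled, the triangular system has modular
  coefficients, and so has its solution (\<open>modular_form_pde_coeff\<close>).
\<close>

section \<open>The exponential function, the period lattice and unordered sums\<close>

lemma e2pi_0 [simp]: "e2pi 0 = 1"
  by (simp add: e2pi_def)

lemma e2pi_nonzero [simp]: "e2pi x \<noteq> 0"
  by (simp add: e2pi_def)

lemma e2pi_add: "e2pi (x + y) = e2pi x * e2pi y"
  by (simp add: e2pi_def ring_distribs exp_add)

lemma e2pi_minus: "e2pi (- x) = inverse (e2pi x)"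
  by (simp add: e2pi_def exp_minus)

lemma e2pi_diff: "e2pi (x - y) = e2pi x / e2pi y"
  by (simp add: e2pi_def ring_distribs exp_diff)

lemma norm_e2pi: "norm (e2pi x) = exp (- (2 * pi * Im x))"
  by (simp add: e2pi_def)

lemma e2pi_eq_1_iff: "e2pi x = 1 \<longleftrightarrow> x \<in> \<int>"
proof -
  have "e2pi x = 1 \<longleftrightarrow> (\<exists>n::int. 2 * of_real pi * \<i> * x = of_int (2 * n) * pi * \<i>)"
    unfolding e2pi_def exp_eq_1
    by (simp add: complex_eq_iff)
  also have "\<dots> \<longleftrightarrow> (\<exists>n::int. x = of_int n)"
    by (intro ex_cong1) (auto simp: field_simps)
  finally show ?thesis by (simp only: Ints_def image_iff) blast
qed

lemma e2pi_of_int [simp]: "e2pi (of_int n) = 1"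
  by (simp add: e2pi_eq_1_iff)

lemma e2pi_1 [simp]: "e2pi 1 = 1"
  by (simp add: e2pi_eq_1_iff)

lemma e2pi_of_nat_mult: "e2pi (of_nat n * x) = e2pi x ^ n"
  by (induction n) (simp_all add: ring_distribs e2pi_add)

lemma e2pi_of_int_mult: "e2pi (of_int n * x) = e2pi x powi n"
  by (cases n) (simp_all add: e2pi_of_nat_mult power_int_minus e2pi_minus algebra_simps
     del: of_nat_Suc power_Suc flip: e2pi_minus e2pi_of_nat_mult)

lemma e2pi_half [simp]: "e2pi (1 / 2) = -1"
  by (simp add: e2pi_def)

lemma e2pi_half_of_int: "e2pi (of_int n / 2) = (-1) powi n"
  using e2pi_of_int_mult[of n "1/2"] by simp

lemma has_field_derivative_e2pi [derivative_intros]: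
  assumes "(f has_field_derivative f') (at x within A)"
  shows "((\<lambda>x. e2pi (f x)) has_field_derivative (2 * of_real pi * \<i> * f' * e2pi (f x))) (at x within A)"
  unfolding e2pi_def by (rule derivative_eq_intros assms refl)+ (simp add: mult_ac)

lemma holomorphic_on_e2pi [holomorphic_intros]:
  "f holomorphic_on A \<Longrightarrow> (\<lambda>x. e2pi (f x)) holomorphic_on A"
  unfolding e2pi_def by (intro holomorphic_intros)

lemma continuous_on_e2pi [continuous_intros]:
  fixes f :: "'a::topological_space \<Rightarrow> complex"
  shows "continuous_on A f \<Longrightarrow> continuous_on A (\<lambda>x. e2pi (f x))"
  unfolding e2pi_def by (intro continuous_intros)

lemma tendsto_e2pi [tendsto_intros]:
  "(f \<longlongrightarrow> a) F \<Longrightarrow> ((\<lambda>x. e2pi (f x)) \<longlongrightarrow> e2pi a) F"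
  unfolding e2pi_def by (intro tendsto_intros)

lemma open_upper_half_plane: "open upper_half_plane"
  unfolding upper_half_plane_def by (rule open_halfspace_Im_gt)

lemma norm_e2pi_less_1: "\<tau> \<in> upper_half_plane \<Longrightarrow> norm (e2pi \<tau>) < 1"
  by (simp add: norm_e2pi upper_half_plane_def)

lemma period_lattice_iff: "z \<in> period_lattice \<tau> \<longleftrightarrow> (\<exists>n::int. e2pi (z + of_int n * \<tau>) = 1)"
proof
  assume "z \<in> period_lattice \<tau>"
  then obtain m n where "z = of_int m * \<tau> + of_int n" by (auto simp: period_lattice_def)
  hence "z + of_int (-m) * \<tau> = of_int n" by simp
  thus "\<exists>n::int. e2pi (z + of_int n * \<tau>) = 1" by (metis e2pi_of_int)
next
  assume "\<exists>n::int. e2pi (z + of_int n * \<tau>) = 1"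
  then obtain n k :: int where "z + of_int n * \<tau> = of_int k"
    by (auto simp: e2pi_eq_1_iff Ints_def)
  hence "z = of_int (-n) * \<tau> + of_int k" by (simp add: algebra_simps)
  thus "z \<in> period_lattice \<tau>" unfolding period_lattice_def by blast
qed


lemma period_lattice_shift [simp]:
  "z + (of_int m * \<tau> + of_int n) \<in> period_lattice \<tau> \<longleftrightarrow> z \<in> period_lattice \<tau>"
proof -
  have "e2pi (z + (of_int m * \<tau> + of_int n) + of_int k * \<tau>) = e2pi (z + of_int (k + m) * \<tau>)" for k
    by (simp add: algebra_simps e2pi_add)
  thus ?thesis unfolding period_lattice_iff
    by (metis add_diff_cancel diff_add_cancel)
qed

lemma period_lattice_shift_1 [simp]: "z + 1 \<in> period_lattice \<tau> \<longleftrightarrow> z \<in> period_lattice \<tau>"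
  and period_lattice_shift_tau [simp]: "z + \<tau> \<in> period_lattice \<tau> \<longleftrightarrow> z \<in> period_lattice \<tau>"
  using period_lattice_shift[of z 0 \<tau> 1] period_lattice_shift[of z 1 \<tau> 0] by simp_all

text \<open>
  The Weierstrass test gives uniform convergence along the finite subsets of the index set; limits
  along a filter preserve holomorphy and commute with derivatives. All interchanges of derivatives
  with the sums over \<open>n\<close> that define \<open>A\<^sub>l\<close> and over pairs \<open>(n, m)\<close> that expand \<open>log \<Theta>\<close> rest on
  this.
\<close>

lemma
  fixes f :: "'i \<Rightarrow> complex \<Rightarrow> complex"
  assumes "open U" and hol: "\<And>n. n \<in> A \<Longrightarrow> f n holomorphic_on U"
    and le: "\<And>n z. n \<in> A \<Longrightarrow> z \<in> U \<Longrightarrow> norm (f n z) \<le> M n" and M: "M summable_on A"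
  shows holomorphic_infsum: "(\<lambda>z. \<Sum>\<^sub>\<infinity>n\<in>A. f n z) holomorphic_on U"
    and higher_deriv_infsum: "z \<in> U \<Longrightarrow>
      ((\<lambda>n. (deriv ^^ k) (f n) z) has_sum (deriv ^^ k) (\<lambda>z. \<Sum>\<^sub>\<infinity>n\<in>A. f n z) z) A"
proof -
  let ?F = "finite_subsets_at_top A"
  have ul: "uniform_limit U (\<lambda>X y. \<Sum>x\<in>X. f x y) (\<lambda>y. \<Sum>\<^sub>\<infinity>x\<in>A. f x y) ?F"
    using le M by (rule Weierstrass_m_test_general)
  have fin: "\<forall>\<^sub>F X in ?F. finite X \<and> X \<subseteq> A"
    by (auto simp: eventually_finite_subsets_at_top)
  have hs: "\<forall>\<^sub>F X in ?F. (\<lambda>z. \<Sum>x\<in>X. f x z) holomorphic_on U"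
    using fin by eventually_elim (auto intro!: holomorphic_intros hol)
  show "(\<lambda>z. \<Sum>\<^sub>\<infinity>n\<in>A. f n z) holomorphic_on U"
    unfolding holomorphic_on_def
  proof
    fix z assume "z \<in> U"
    then obtain r where r: "r > 0" "cball z r \<subseteq> U" using \<open>open U\<close> open_contains_cball by blast
    have "(\<lambda>z. \<Sum>\<^sub>\<infinity>n\<in>A. f n z) holomorphic_on ball z r"
    proof (rule holomorphic_uniform_limit)
      show "\<forall>\<^sub>F n in ?F. continuous_on (cball z r) (\<lambda>z. \<Sum>x\<in>n. f x z) \<and> (\<lambda>z. \<Sum>x\<in>n. f x z) holomorphic_on ball z r"
        using hs by eventually_elim
          (use r ball_subset_cball[of z r] in \<open>blast intro: holomorphic_on_subset holomorphic_on_imp_continuous_on continuous_on_subset\<close>)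
      show "uniform_limit (cball z r) (\<lambda>n z. \<Sum>x\<in>n. f x z) (\<lambda>z. \<Sum>\<^sub>\<infinity>n\<in>A. f n z) ?F"
        using ul r(2) by (rule uniform_limit_on_subset)
    qed auto
    thus "(\<lambda>z. \<Sum>\<^sub>\<infinity>n\<in>A. f n z) field_differentiable at z within U"
      using r(1) by (meson centre_in_ball field_differentiable_at_within holomorphic_on_imp_differentiable_at open_ball)
  qed
  show "((\<lambda>n. (deriv ^^ k) (f n) z) has_sum (deriv ^^ k) (\<lambda>z. \<Sum>\<^sub>\<infinity>n\<in>A. f n z) z) A" if z: "z \<in> U"
  proof -
    have "((\<lambda>X. (deriv ^^ k) (\<lambda>z. \<Sum>x\<in>X. f x z) z) \<longlongrightarrow> (deriv ^^ k) (\<lambda>z. \<Sum>\<^sub>\<infinity>n\<in>A. f n z) z) ?F"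
      using ul hs _ \<open>open U\<close> z by (rule higher_deriv_complex_uniform_limit) simp
    also have "?this \<longleftrightarrow> ((\<lambda>X. \<Sum>x\<in>X. (deriv ^^ k) (f x) z) \<longlongrightarrow> (deriv ^^ k) (\<lambda>z. \<Sum>\<^sub>\<infinity>n\<in>A. f n z) z) ?F"
    proof (rule filterlim_cong[OF refl refl])
      show "\<forall>\<^sub>F X in ?F. (deriv ^^ k) (\<lambda>z. \<Sum>x\<in>X. f x z) z = (\<Sum>x\<in>X. (deriv ^^ k) (f x) z)"
        using fin
      proof eventually_elim
        case (elim X)
        hence "finite X" "X \<subseteq> A" by auto
        thus ?case
        proof (induction X rule: finite_induct)
          case empty
          show ?case by (cases k) (simp_all add: higher_deriv_const)
        next
          case (insert x X)
          have "(deriv ^^ k) (\<lambda>z. f x z + (\<Sum>x\<in>X. f x z)) z =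
                (deriv ^^ k) (f x) z + (deriv ^^ k) (\<lambda>z. \<Sum>x\<in>X. f x z) z"
            using insert by (intro higher_deriv_add[where S = U]) (auto intro!: holomorphic_intros hol assms z)
          thus ?case using insert by simp
        qed
      qed
    qed
    finally show ?thesis unfolding has_sum_def .
  qed
qed

lemma summable_power_times_geometric:
  fixes r :: real assumes "0 < r" "r < 1"
  shows "summable (\<lambda>n. (1 + real n) ^ p * r ^ n)"
proof (rule summable_comparison_test_bigo)
  show "summable (\<lambda>n. norm (1 / real n ^ 2))"
    using inverse_power_summable[of 2, where ?'a = real] by (simp add: field_simps)
  show "(\<lambda>n. (1 + real n) ^ p * r ^ n) \<in> O(\<lambda>n. 1 / real n ^ 2)"
    using assms by real_asymp
qed

lemma summable_on_int_abs:
  fixes g :: "nat \<Rightarrow> real"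
  assumes "summable g" "\<And>n. g n \<ge> 0"
  shows "(\<lambda>n::int. g (nat \<bar>n\<bar>)) summable_on UNIV"
proof -
  have s: "g summable_on UNIV" using assms by (rule summable_nonneg_imp_summable_on)
  have "(\<lambda>n::int. g (nat \<bar>n\<bar>)) summable_on (int ` UNIV)"
    by (subst summable_on_reindex) (use s in \<open>auto simp: o_def\<close>)
  moreover have "(\<lambda>n::int. g (nat \<bar>n\<bar>)) summable_on ((\<lambda>n. - int n) ` UNIV)"
    by (subst summable_on_reindex) (use s in \<open>auto simp: o_def inj_on_def\<close>)
  hence "(\<lambda>n::int. g (nat \<bar>n\<bar>)) summable_on {..<0}"
  proof (rule summable_on_subset_banach)
    show "{..<0} \<subseteq> range (\<lambda>n. - int n)"
    proof
      fix x :: int assume "x \<in> {..<0}"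
      hence "x = - int (nat (- x))" by simp
      thus "x \<in> range (\<lambda>n. - int n)" by blast
    qed
  qed
  ultimately have "(\<lambda>n::int. g (nat \<bar>n\<bar>)) summable_on (int ` UNIV \<union> {..<0})"
    by (rule summable_on_Un_disjoint) auto
  also have "int ` UNIV \<union> {..<0} = UNIV" by (metis UNIV_I eq_onp_def UNIV_eq_I UnI1 UnI2 lessThan_iff not_less nonneg_int_cases rangeI)
  finally show ?thesis .
qed

text \<open>
  The lattice is discrete, so a function that is holomorphic off it and has a limit at each
  lattice point is entire after the values at the lattice points have been changed.
\<close>

lemma isolated_period_lattice:
  assumes \<tau>: "\<tau> \<in> upper_half_plane"
  obtains e where "e > 0" "\<And>z w. z \<in> period_lattice \<tau> \<Longrightarrow> w \<in> period_lattice \<tau> \<Longrightarrow> dist z w < e \<Longrightarrow> z = w"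
proof
  let ?e = "min (Im \<tau>) 1"
  show "?e > 0" using \<tau> by (simp add: upper_half_plane_def)
  fix z w assume "z \<in> period_lattice \<tau>" "w \<in> period_lattice \<tau>" and d: "dist z w < ?e"
  then obtain m n m' n' where zw: "z = of_int m * \<tau> + of_int n" "w = of_int m' * \<tau> + of_int n'"
    unfolding period_lattice_def by blast
  have "\<bar>Im (z - w)\<bar> < Im \<tau>" using d abs_Im_le_cmod[of "z - w"] by (simp add: dist_norm)
  hence "\<bar>real_of_int (m - m')\<bar> * Im \<tau> < 1 * Im \<tau>"
    using \<tau> by (simp add: zw upper_half_plane_def abs_mult left_diff_distrib[symmetric])
  hence "m = m'" using \<tau> by (simp add: upper_half_plane_def)
  moreover have "\<bar>Re (z - w)\<bar> < 1" using d abs_Re_le_cmod[of "z - w"] by (simp add: dist_norm)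
  hence "n = n'" using \<open>m = m'\<close> by (simp add: zw)
  ultimately show "z = w" by (simp add: zw)
qed

lemma closed_period_lattice: "\<tau> \<in> upper_half_plane \<Longrightarrow> closed (period_lattice \<tau>)"
  by (metis isolated_period_lattice discrete_imp_closed dist_norm dist_commute)

lemma entire_extension:
  assumes \<tau>: "\<tau> \<in> upper_half_plane"
    and hol: "f holomorphic_on (- period_lattice \<tau>)"
    and lim: "\<And>z. z \<in> period_lattice \<tau> \<Longrightarrow> \<exists>c. f \<midarrow>z\<rightarrow> c"
  obtains g where "g holomorphic_on UNIV" "\<And>z. z \<notin> period_lattice \<tau> \<Longrightarrow> g z = f z"
proof
  have ana: "f analytic_on (- period_lattice \<tau>)"
    using hol closed_period_lattice[OF \<tau>] by (simp add: analytic_on_open open_Compl)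
  have "remove_sings f analytic_on {z}" for z
  proof (cases "z \<in> period_lattice \<tau>")
    case True
    obtain e where e: "e > 0" "\<And>z w. z \<in> period_lattice \<tau> \<Longrightarrow> w \<in> period_lattice \<tau> \<Longrightarrow> dist z w < e \<Longrightarrow> z = w"
      using isolated_period_lattice[OF \<tau>] by metis
    have "f analytic_on (ball z e - {z})"
      by (rule analytic_on_subset[OF ana]) (use e(2)[OF True] in force)
    hence "isolated_singularity_at f z"
      unfolding isolated_singularity_at_def using e(1) by blast
    with lim[OF True] show ?thesis using remove_sings_analytic_at by blast
  next
    case False
    thus ?thesis using ana by (intro remove_sings_analytic_on) (auto intro: analytic_on_subset)
  qed
  hence "remove_sings f analytic_on UNIV" using analytic_on_analytic_at by blast
  thus "remove_sings f holomorphic_on UNIV" by (rule analytic_imp_holomorphic)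
  fix z assume "z \<notin> period_lattice \<tau>"
  hence "f analytic_on {z}" using ana by (auto intro: analytic_on_subset)
  thus "remove_sings f z = f z" by simp
qed

lemma eventually_not_period_lattice:
  assumes "\<tau> \<in> upper_half_plane"
  shows "eventually (\<lambda>z. z \<notin> period_lattice \<tau>) (at w)"
proof -
  obtain e where e: "e > 0" "\<And>z w. z \<in> period_lattice \<tau> \<Longrightarrow> w \<in> period_lattice \<tau> \<Longrightarrow> dist z w < e \<Longrightarrow> z = w"
    using isolated_period_lattice[OF assms] by metis
  show ?thesis
  proof (cases "w \<in> period_lattice \<tau>")
    case True
    thus ?thesis unfolding eventually_at using e by blast
  next
    case False
    have "eventually (\<lambda>z. z \<in> - period_lattice \<tau>) (nhds w)"
      using False closed_period_lattice[OF assms] by (intro eventually_nhds_in_open) auto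
    thus ?thesis by (simp add: eventually_at_filter eventually_mono)
  qed
qed



lemma eq_off_period_lattice_imp_eq:
  fixes f1 f2 :: "complex \<Rightarrow> complex"
  assumes \<tau>: "\<tau> \<in> upper_half_plane" and cont: "continuous_on UNIV f1" "continuous_on UNIV f2"
    and eq: "\<And>z. z \<notin> period_lattice \<tau> \<Longrightarrow> f1 z = f2 z"
  shows "f1 w = f2 w"
proof -
  have f: "(f1 \<longlongrightarrow> f1 w) (at w)" "(f2 \<longlongrightarrow> f2 w) (at w)"
    using cont by (auto simp: continuous_on_def)
  have "\<forall>\<^sub>F z in at w. f1 z = f2 z"
    using eventually_not_period_lattice[OF \<tau>, of w] by eventually_elim (use eq in auto)
  with f(1) have "(f2 \<longlongrightarrow> f1 w) (at w)" by (rule Lim_transform_eventually)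
  with f(2) show ?thesis using tendsto_unique[OF at_neq_bot] by blast
qed

section \<open>The Euler product and the theta function\<close>

definition euler_prod :: "complex \<Rightarrow> complex \<Rightarrow> complex" where
  "euler_prod x q = (\<Prod>n. 1 - x * q ^ Suc n)"

lemma convergent_euler_prod:
  fixes x q :: complex
  assumes "norm q < 1"
  shows "convergent_prod (\<lambda>n. 1 - x * q ^ Suc n)"
proof (intro abs_convergent_prod_imp_convergent_prod summable_imp_abs_convergent_prod)
  have "summable (\<lambda>n. norm x * norm q * norm q ^ n)"
    using assms by (intro summable_mult summable_geometric) auto
  thus "summable (\<lambda>i. norm (1 - x * q ^ Suc i - 1))"
    by (simp add: norm_mult norm_power mult.assoc)
qed

lemma has_prod_euler_prod: "norm q < 1 \<Longrightarrow> (\<lambda>n. 1 - x * q ^ Suc n) has_prod euler_prod x q"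
  unfolding euler_prod_def by (intro convergent_prod_has_prod convergent_euler_prod)

lemma euler_prod_shift:
  assumes "norm q < 1"
  shows "euler_prod x q = (1 - x * q) * euler_prod (x * q) q"
proof -
  have "(\<lambda>n. 1 - x * q ^ Suc (Suc n)) has_prod euler_prod (x * q) q"
    using has_prod_euler_prod[OF assms, of "x * q"] by (simp add: mult_ac)
  hence "(\<lambda>n. 1 - x * q ^ Suc n) has_prod (euler_prod (x * q) q * (1 - x * q ^ Suc 0))"
    by (rule has_prod_Suc_imp)
  with has_prod_euler_prod[OF assms, of x] show ?thesis
    using has_prod_unique2 by (simp add: mult.commute) blast
qed

lemma euler_prod_eq_0_iff:
  "norm q < 1 \<Longrightarrow> euler_prod x q = 0 \<longleftrightarrow> (\<exists>n. x * q ^ Suc n = 1)"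
  by (subst has_prod_eq_0_iff[OF has_prod_euler_prod]) (auto simp: image_iff)

lemma euler_prod_1_nonzero: "norm q < 1 \<Longrightarrow> euler_prod 1 q \<noteq> 0"
  by (metis euler_prod_eq_0_iff mult_1 norm_one norm_power power_Suc_less_one norm_ge_zero
      order_less_irrefl power_less_one_iff zero_less_Suc)

lemma holomorphic_euler_prod:
  assumes q: "norm q < 1"
  shows "(\<lambda>x. euler_prod x q) holomorphic_on UNIV"
proof -
  have "(\<lambda>x. euler_prod x q) holomorphic_on ball 0 R" for R
  proof (rule holomorphic_uniform_limit)
    have "uniformly_convergent_on (cball 0 R) (\<lambda>N x. \<Prod>n<N. 1 - x * q ^ Suc n)"
    proof (rule uniformly_convergent_on_prod')
      show "uniformly_convergent_on (cball 0 R) (\<lambda>N x. \<Sum>n<N. norm (1 - x * q ^ Suc n - 1))"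
      proof (rule Weierstrass_m_test')
        show "summable (\<lambda>n. R * norm q * norm q ^ n)"
          using q by (intro summable_mult summable_geometric) auto
        show "norm (norm (1 - x * q ^ Suc n - 1)) \<le> R * norm q * norm q ^ n" if "x \<in> cball 0 R" for n x
          using that mult_right_mono[of "norm x" R "norm q * norm q ^ n"]
          by (simp add: norm_mult norm_power mult.assoc)
      qed
    qed (auto intro!: continuous_intros)
    hence "uniform_limit (cball 0 R) (\<lambda>N x. \<Prod>n<N. 1 - x * q ^ Suc n)
             (\<lambda>x. lim (\<lambda>N. \<Prod>n<N. 1 - x * q ^ Suc n)) sequentially"
      by (simp add: uniformly_convergent_uniform_limit_iff)
    also have "(\<lambda>x. lim (\<lambda>N. \<Prod>n<N. 1 - x * q ^ Suc n)) = (\<lambda>x. euler_prod x q)"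
      using has_prod_imp_tendsto'[OF has_prod_euler_prod[OF q]] by (auto intro!: limI)
    finally show "uniform_limit (cball 0 R) (\<lambda>N x. \<Prod>n<N. 1 - x * q ^ Suc n)
             (\<lambda>x. euler_prod x q) sequentially" .
    show "\<forall>\<^sub>F n in sequentially. continuous_on (cball 0 R) (\<lambda>x. \<Prod>n<n. 1 - x * q ^ Suc n) \<and>
            (\<lambda>x. \<Prod>n<n. 1 - x * q ^ Suc n) holomorphic_on ball 0 R"
      by (intro always_eventually allI conjI continuous_intros holomorphic_intros)
  qed auto
  hence "(\<lambda>x. euler_prod x q) holomorphic_on (\<Union>R. ball 0 R)"
    by (intro holomorphic_on_UN_open) auto
  also have "(\<Union>R. ball 0 R) = (UNIV :: complex set)"
    by (auto intro: gt_ex)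
  finally show ?thesis .
qed

text \<open>
  Up to a constant factor this is the Jacobi theta function \<open>\<vartheta>\<^sub>1\<close> divided by \<open>\<eta>\<^sup>3\<close>. It is normalised so
  that its reciprocal is \<open>\<eta>\<close> times the modified crank.
\<close>

definition crank_theta :: "complex \<Rightarrow> complex \<Rightarrow> complex" where
  "crank_theta z \<tau> = (e2pi (- z / 2) - e2pi (z / 2)) *
     euler_prod (e2pi z) (e2pi \<tau>) * euler_prod (e2pi (- z)) (e2pi \<tau>) / euler_prod 1 (e2pi \<tau>) ^ 2"

lemma eta_times_crank:
  assumes \<tau>: "\<tau> \<in> upper_half_plane"
  shows "dedekind_eta \<tau> * modified_crank z \<tau> = inverse (crank_theta z \<tau>)"
proof -
  let ?q = "e2pi \<tau>" and ?w = "e2pi z"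
  note q = norm_e2pi_less_1[OF \<tau>]
  have "(\<lambda>n. (1 - 1 * ?q ^ Suc n) / ((1 - ?w * ?q ^ Suc n) * (1 - inverse ?w * ?q ^ Suc n))) has_prod
          (euler_prod 1 ?q / (euler_prod ?w ?q * euler_prod (inverse ?w) ?q))"
    by (intro has_prod_divide has_prod_mult has_prod_euler_prod q)
  hence "crank_gf ?w ?q = euler_prod 1 ?q / (euler_prod ?w ?q * euler_prod (inverse ?w) ?q)"
    unfolding crank_gf_def mult_1 by (rule has_prod_unique[symmetric])
  moreover have "q_inf ?q = euler_prod 1 ?q" by (simp add: q_inf_def euler_prod_def)
  moreover have "e2pi (z / 2) / (1 - ?w) = 1 / (e2pi (- z / 2) - e2pi (z / 2))"
  proof -
    have "e2pi (- z / 2) - e2pi (z / 2) = (1 - ?w) / e2pi (z / 2)"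
      using e2pi_add[of "z/2" "z/2"] by (simp add: e2pi_minus field_simps)
    thus ?thesis by simp
  qed
  moreover have "e2pi (\<tau> / 24) * e2pi (- \<tau> / 24) = 1"
    using e2pi_add[of "\<tau> / 24" "- \<tau> / 24"] by simp
  moreover have "A * Q * (h * B / k * C) = (h / k) * (Q * C) * (A * B)"
    and "1 / x * (Q * (Q / (A * B))) * 1 = inverse (x * A * B / Q\<^sup>2)"
    for A Q h B k C x :: complex
    by (simp_all add: mult_ac power2_eq_square inverse_eq_divide)
  ultimately show ?thesis
    unfolding dedekind_eta_def modified_crank_def crank_theta_def e2pi_minus[of z]
    by (simp only:)
qed

lemma holomorphic_crank_theta:
  assumes \<tau>: "\<tau> \<in> upper_half_plane"
  shows "(\<lambda>z. crank_theta z \<tau>) holomorphic_on A"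
proof -
  note q = norm_e2pi_less_1[OF \<tau>]
  have h: "(\<lambda>z. euler_prod (f z) (e2pi \<tau>)) holomorphic_on A" if "f holomorphic_on A" for f
    using holomorphic_on_compose_gen[OF that holomorphic_euler_prod[OF q]] by (simp add: o_def)
  show ?thesis unfolding crank_theta_def
    by (intro holomorphic_intros h) (auto simp: euler_prod_1_nonzero q)
qed

lemma crank_theta_nonzero:
  assumes \<tau>: "\<tau> \<in> upper_half_plane" and z: "z \<notin> period_lattice \<tau>"
  shows "crank_theta z \<tau> \<noteq> 0"
proof -
  note q = norm_e2pi_less_1[OF \<tau>]
  have *: "e2pi (z + of_int n * \<tau>) \<noteq> 1" for n
    using z unfolding period_lattice_iff by blast
  have "e2pi z \<noteq> 1" using *[of 0] by simp
  hence "e2pi (- z / 2) - e2pi (z / 2) \<noteq> 0"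
    using e2pi_add[of "z/2" "z/2"] by (auto simp: e2pi_minus field_simps)
  moreover have "e2pi z * e2pi \<tau> ^ Suc n \<noteq> 1" for n
    using *[of "int (Suc n)"] by (simp add: e2pi_add e2pi_of_nat_mult del: of_nat_Suc power_Suc)
  moreover have "e2pi (- z) * e2pi \<tau> ^ Suc n \<noteq> 1" for n
  proof
    assume "e2pi (- z) * e2pi \<tau> ^ Suc n = 1"
    hence "e2pi (- (z + of_int (- int (Suc n)) * \<tau>)) = 1"
      by (simp add: e2pi_diff e2pi_minus divide_inverse mult.commute flip: e2pi_of_nat_mult del: of_nat_Suc power_Suc)
    with *[of "- int (Suc n)"] show False
      by (metis e2pi_minus inverse_1 minus_minus)
  qed
  ultimately show ?thesis
    using euler_prod_1_nonzero[OF q] euler_prod_eq_0_iff[OF q, of "e2pi z"]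
      euler_prod_eq_0_iff[OF q, of "e2pi (- z)"] by (simp add: crank_theta_def del: power_Suc)
qed

lemma crank_theta_add_1: "crank_theta (z + 1) \<tau> = - crank_theta z \<tau>"
proof -
  have "e2pi (- (z + 1) / 2) = - e2pi (- z / 2)" "e2pi ((z + 1) / 2) = - e2pi (z / 2)"
    "e2pi (z + 1) = e2pi z" "e2pi (- (z + 1)) = e2pi (- z)"
    by (simp_all add: add_divide_distrib diff_divide_distrib e2pi_add e2pi_diff)
  moreover have "(- x - - y) * A * B / C = - ((x - y) * A * B / C)" for x y A B C :: complex
    by (metis minus_diff_minus minus_divide_left mult_minus_left)
  ultimately show ?thesis unfolding crank_theta_def by presburger
qed

text \<open>
  The two Euler products are shifted in opposite directions; by \<open>euler_prod_shift\<close> each of them gains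
  or loses one factor, and these factors combine with the prefactor.
\<close>

lemma crank_theta_add_tau:
  assumes \<tau>: "\<tau> \<in> upper_half_plane"
  shows "crank_theta (z + \<tau>) \<tau> = - e2pi (- z - \<tau> / 2) * crank_theta z \<tau>"
proof -
  let ?q = "e2pi \<tau>" and ?w = "e2pi z"
  note q = norm_e2pi_less_1[OF \<tau>]
  have 1: "euler_prod ?w ?q = (1 - ?w * ?q) * euler_prod (e2pi (z + \<tau>)) ?q"
    using euler_prod_shift[OF q, of ?w] by (simp add: e2pi_add)
  have 2: "euler_prod (e2pi (- (z + \<tau>))) ?q = (1 - e2pi (- z)) * euler_prod (e2pi (- z)) ?q"
    using euler_prod_shift[OF q, of "e2pi (- (z + \<tau>))"] by (simp add: e2pi_diff)
  have 3: "e2pi (- (z + \<tau>) / 2) - e2pi ((z + \<tau>) / 2) = e2pi (- (z + \<tau>) / 2) * (1 - ?w * ?q)"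
  proof -
    have "e2pi (- (z + \<tau>) / 2) * (?w * ?q) = e2pi (- (z + \<tau>) / 2 + (z + \<tau>))"
      by (simp only: e2pi_add)
    also have "- (z + \<tau>) / 2 + (z + \<tau>) = (z + \<tau>) / 2" by (simp add: field_simps)
    finally show ?thesis by (simp add: right_diff_distrib)
  qed
  have 4: "e2pi (- (z + \<tau>) / 2) * (1 - e2pi (- z)) =
           - e2pi (- z - \<tau> / 2) * (e2pi (- z / 2) - e2pi (z / 2))"
  proof -
    have "(- z - \<tau> / 2) + (- z / 2) = (- (z + \<tau>) / 2) + (- z)"
      "(- z - \<tau> / 2) + (z / 2) = - (z + \<tau>) / 2"
      by (simp_all add: field_simps)
    hence "e2pi (- z - \<tau> / 2) * e2pi (- z / 2) = e2pi (- (z + \<tau>) / 2) * e2pi (- z)"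
      "e2pi (- z - \<tau> / 2) * e2pi (z / 2) = e2pi (- (z + \<tau>) / 2)"
      by (metis e2pi_add)+
    thus ?thesis by (simp add: right_diff_distrib)
  qed
  have "e * w * B * (o' * C) / D = - f * (e' * (w * B) * C / D)" if "e * o' = - f * e'" for e w B o' C D f e' :: complex
  proof -
    have "e * w * B * (o' * C) / D = (e * o') * (w * B * C / D)" by simp
    also have "\<dots> = - f * (e' * (w * B) * C / D)" unfolding that by simp
    finally show ?thesis .
  qed
  from this[OF 4] show ?thesis unfolding crank_theta_def 2 3 1 .
qed

text \<open>
  The sign \<open>(-1)\<close> to the power \<open>m + n\<close> is kept inside the argument of \<open>e2pi\<close>, so that composing shifts
  only means adding exponents.
\<close>

lemma crank_theta_quasiperiodic:
  assumes \<tau>: "\<tau> \<in> upper_half_plane"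
  shows "crank_theta (z + of_int m * \<tau> + of_int n) \<tau> =
           e2pi ((of_int m + of_int n) / 2 - of_int m ^ 2 * \<tau> / 2 - of_int m * z) * crank_theta z \<tau>"
proof -
  have half: "e2pi (x + 1 / 2) = - e2pi x" "e2pi (1 / 2 + x) = - e2pi x" for x
    by (simp_all add: e2pi_add)
  have comb: "e2pi x * (e2pi y * v) = e2pi t * v" if "x + y = t" for x y t v
    using that by (metis e2pi_add mult.assoc)
  have m: "crank_theta (z + of_int m * \<tau>) \<tau> =
             e2pi (of_int m / 2 - of_int m ^ 2 * \<tau> / 2 - of_int m * z) * crank_theta z \<tau>" for z
  proof (induction m arbitrary: z rule: int_induct[where k = 0])
    case base show ?case by simp
  next
    case (step1 m)
    have "crank_theta (z + of_int (m + 1) * \<tau>) \<tau> = crank_theta ((z + \<tau>) + of_int m * \<tau>) \<tau>"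
      by (simp add: algebra_simps)
    also have "\<dots> = e2pi (of_int m / 2 - of_int m ^ 2 * \<tau> / 2 - of_int m * (z + \<tau>)) *
       (e2pi (1 / 2 + (- z - \<tau> / 2)) * crank_theta z \<tau>)"
      by (simp add: step1 crank_theta_add_tau[OF \<tau>] half)
    also have "\<dots> = e2pi (of_int (m + 1) / 2 - of_int (m + 1) ^ 2 * \<tau> / 2 - of_int (m + 1) * z) * crank_theta z \<tau>"
      by (rule comb) (simp add: field_simps power2_eq_square)
    finally show ?case .
  next
    case (step2 m)
    have "crank_theta z \<tau> = e2pi (1 / 2 + (- (z - \<tau>) - \<tau> / 2)) * crank_theta (z - \<tau>) \<tau>"
      using crank_theta_add_tau[OF \<tau>, of "z - \<tau>"] by (simp add: half)
    moreover have "e2pi (1 / 2 + (- (z - \<tau>) - \<tau> / 2)) * e2pi (- 1 / 2 + (z - \<tau> / 2)) = 1"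
      by (simp flip: e2pi_add)
    moreover have "c' = Y * c" if "c = X * c'" "X * Y = 1" for c c' X Y :: complex
    proof -
      have "Y * c = (X * Y) * c'" unfolding that(1) by simp
      thus ?thesis using that(2) by simp
    qed
    ultimately have *: "crank_theta (z - \<tau>) \<tau> = e2pi (- 1 / 2 + (z - \<tau> / 2)) * crank_theta z \<tau>"
      by blast
    have "crank_theta (z + of_int (m - 1) * \<tau>) \<tau> = crank_theta ((z - \<tau>) + of_int m * \<tau>) \<tau>"
      by (simp add: algebra_simps)
    also have "\<dots> = e2pi (of_int m / 2 - of_int m ^ 2 * \<tau> / 2 - of_int m * (z - \<tau>)) *
       (e2pi (- 1 / 2 + (z - \<tau> / 2)) * crank_theta z \<tau>)"
      by (simp only: step2 *)
    also have "\<dots> = e2pi (of_int (m - 1) / 2 - of_int (m - 1) ^ 2 * \<tau> / 2 - of_int (m - 1) * z) * crank_theta z \<tau>"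
      by (rule comb) (simp add: field_simps power2_eq_square)
    finally show ?case .
  qed
  have n: "crank_theta (z + of_int n) \<tau> = e2pi (of_int n / 2) * crank_theta z \<tau>" for z
  proof (induction n arbitrary: z rule: int_induct[where k = 0])
    case base show ?case by simp
  next
    case (step1 n)
    have "crank_theta (z + of_int (n + 1)) \<tau> = crank_theta ((z + 1) + of_int n) \<tau>"
      by (simp add: algebra_simps)
    also have "\<dots> = - e2pi (of_int n / 2) * crank_theta z \<tau>"
      by (simp only: step1 crank_theta_add_1 mult_minus_left mult_minus_right)
    also have "- e2pi (of_int n / 2) = e2pi (of_int (n + 1) / 2)"
      by (simp add: add_divide_distrib e2pi_add)
    finally show ?case .
  next
    case (step2 n)
    have *: "crank_theta (z - 1) \<tau> = - crank_theta z \<tau>"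
      using crank_theta_add_1[of "z - 1" \<tau>] by simp
    have "crank_theta (z + of_int (n - 1)) \<tau> = crank_theta ((z - 1) + of_int n) \<tau>"
      by (simp add: algebra_simps)
    also have "\<dots> = - e2pi (of_int n / 2) * crank_theta z \<tau>"
      by (simp only: step2 * mult_minus_left mult_minus_right)
    also have "- e2pi (of_int n / 2) = e2pi (of_int (n - 1) / 2)"
      by (simp add: diff_divide_distrib e2pi_diff)
    finally show ?case .
  qed
  show ?thesis unfolding n m by (rule comb) (simp add: field_simps)
qed

text \<open>
  The zero of the theta function at the origin is simple, and its leading coefficient does not depend
  on \<open>\<tau>\<close>. This fixes the constant in the modular transformation law.
\<close>

lemma crank_theta_over_z:
  assumes \<tau>: "\<tau> \<in> upper_half_plane"
  shows "((\<lambda>z. crank_theta z \<tau> / z) \<longlongrightarrow> - (2 * of_real pi * \<i>)) (at 0)"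
proof -
  note q = norm_e2pi_less_1[OF \<tau>]
  have h: "(\<lambda>z. euler_prod (f z) (e2pi \<tau>)) holomorphic_on UNIV" if "f holomorphic_on UNIV" for f
    using holomorphic_on_compose_gen[OF that holomorphic_euler_prod[OF q]] by (simp add: o_def)
  define g where "g = (\<lambda>z. euler_prod (e2pi z) (e2pi \<tau>) * euler_prod (e2pi (- z)) (e2pi \<tau>) / euler_prod 1 (e2pi \<tau>) ^ 2)"
  have "g holomorphic_on UNIV" unfolding g_def
    by (intro holomorphic_intros h) (auto simp: euler_prod_1_nonzero q)
  hence "continuous_on UNIV g" by (rule holomorphic_on_imp_continuous_on)
  hence "(g \<longlongrightarrow> g 0) (at 0)" by (simp add: continuous_on_def)
  moreover have "g 0 = 1" by (simp add: g_def power2_eq_square euler_prod_1_nonzero q)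
  moreover have "((\<lambda>z. e2pi (- z / 2) - e2pi (z / 2)) has_field_derivative - (2 * of_real pi * \<i>)) (at 0)"
    by (auto intro!: derivative_eq_intros)
  hence "((\<lambda>z. (e2pi (- z / 2) - e2pi (z / 2)) / z) \<longlongrightarrow> - (2 * of_real pi * \<i>)) (at 0)"
    by (simp add: has_field_derivative_iff)
  ultimately have "((\<lambda>z. (e2pi (- z / 2) - e2pi (z / 2)) / z * g z) \<longlongrightarrow> - (2 * of_real pi * \<i>) * 1) (at 0)"
    by (intro tendsto_mult) auto
  thus ?thesis by (simp add: crank_theta_def g_def mult_ac)
qed

lemma periodic_of_int:
  fixes g :: "complex \<Rightarrow> 'a"
  assumes "\<And>z. g (z + \<omega>) = g z"
  shows "g (z + of_int n * \<omega>) = g z"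
proof (induction n arbitrary: z rule: int_induct[where k = 0])
  case (step1 n)
  have "g (z + of_int (n + 1) * \<omega>) = g ((z + \<omega>) + of_int n * \<omega>)" by (simp add: algebra_simps)
  thus ?case by (simp only: step1 assms)
next
  case (step2 n)
  have "g (z + of_int (n - 1) * \<omega>) = g ((z - \<omega>) + of_int n * \<omega>)" by (simp add: algebra_simps)
  also have "\<dots> = g z" using step2(2)[of "z - \<omega>"] assms[of "z - \<omega>"] by simp
  finally show ?case .
qed simp

lemma bounded_on_strip:
  fixes g :: "complex \<Rightarrow> complex"
  assumes g: "continuous_on UNIV g" "\<And>z. g (z + 1) = g z"
  obtains K where "\<And>z. A \<le> Im z \<Longrightarrow> Im z \<le> B \<Longrightarrow> norm (g z) \<le> K"
proof -
  have "compact (g ` cbox (Complex 0 A) (Complex 1 B))"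
    by (intro compact_continuous_image continuous_on_subset[OF g(1)]) auto
  then obtain K where K: "\<And>z. z \<in> cbox (Complex 0 A) (Complex 1 B) \<Longrightarrow> norm (g z) \<le> K"
    unfolding bounded_iff by (meson compact_imp_bounded bounded_iff imageI)
  show thesis
  proof (rule that)
    fix z assume z: "A \<le> Im z" "Im z \<le> B"
    let ?n = "- \<lfloor>Re z\<rfloor>"
    have "z + of_int ?n * 1 \<in> cbox (Complex 0 A) (Complex 1 B)"
      using z by (auto simp: in_cbox_complex_iff) linarith+
    hence "norm (g (z + of_int ?n * 1)) \<le> K" by (rule K)
    thus "norm (g z) \<le> K" using periodic_of_int[of g 1 z ?n] g(2) by simp
  qed
qed

text \<open>
  The values on the strip \<open>0 \<le> Im z \<le> Im \<tau>\<close> are all values, and periodicity in the real direction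
  makes them bounded there.
\<close>

lemma doubly_periodic_entire_constant:
  assumes \<tau>: "\<tau> \<in> upper_half_plane" and g: "g holomorphic_on UNIV"
    and per: "\<And>z. g (z + 1) = g z" "\<And>z. g (z + \<tau>) = g z"
  shows "g z = g w"
proof -
  have t: "Im \<tau> > 0" using \<tau> by (simp add: upper_half_plane_def)
  obtain K where K: "\<And>z. 0 \<le> Im z \<Longrightarrow> Im z \<le> Im \<tau> \<Longrightarrow> norm (g z) \<le> K"
    using bounded_on_strip[OF holomorphic_on_imp_continuous_on[OF g] per(1)] by metis
  have "norm (g z) \<le> K" for z
  proof -
    let ?n = "- \<lfloor>Im z / Im \<tau>\<rfloor>"
    have "of_int \<lfloor>Im z / Im \<tau>\<rfloor> \<le> Im z / Im \<tau>" "Im z / Im \<tau> \<le> of_int \<lfloor>Im z / Im \<tau>\<rfloor> + 1"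
      by linarith+
    hence "of_int \<lfloor>Im z / Im \<tau>\<rfloor> * Im \<tau> \<le> Im z" "Im z \<le> (of_int \<lfloor>Im z / Im \<tau>\<rfloor> + 1) * Im \<tau>"
      using t by (simp_all only: pos_le_divide_eq pos_divide_le_eq)
    hence "norm (g (z + of_int ?n * \<tau>)) \<le> K"
      by (intro K) (simp_all add: algebra_simps)
    thus ?thesis using periodic_of_int[of g \<tau> z ?n] per(2) by simp
  qed
  hence "bounded (range g)" by (auto simp: bounded_iff)
  with g have "g constant_on UNIV" by (rule Liouville_theorem)
  thus ?thesis by (auto simp: constant_on_def)
qed

definition moebius :: "int \<Rightarrow> int \<Rightarrow> int \<Rightarrow> int \<Rightarrow> complex \<Rightarrow> complex" where
  "moebius a b c d \<tau> = (of_int a * \<tau> + of_int b) / (of_int c * \<tau> + of_int d)"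

lemma moebius_denom_nonzero:
  assumes "a * d - b * c = (1::int)" "\<tau> \<in> upper_half_plane"
  shows "of_int c * \<tau> + of_int d \<noteq> 0"
proof
  assume *: "of_int c * \<tau> + of_int d = 0"
  hence "Im (of_int c * \<tau> + of_int d) = 0" "Re (of_int c * \<tau> + of_int d) = 0" by simp_all
  hence "c = 0" "d = 0" using assms(2) by (auto simp: upper_half_plane_def)
  with assms(1) show False by simp
qed

lemma Im_moebius:
  assumes "a * d - b * c = (1::int)"
  shows "Im (moebius a b c d \<tau>) = Im \<tau> / (norm (of_int c * \<tau> + of_int d))\<^sup>2"
proof -
  have "real_of_int (a * d - b * c) = 1" using assms by simp
  hence "Im ((of_int a * \<tau> + of_int b) * cnj (of_int c * \<tau> + of_int d)) = Im \<tau>"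
    by (simp add: algebra_simps)
  thus ?thesis unfolding moebius_def complex_div_cnj[of "of_int a * \<tau> + of_int b"]
    by (simp add: Im_divide_of_real del: complex_cnj_add complex_cnj_mult flip: of_real_power)
qed

lemma moebius_in_upper_half_plane:
  assumes "a * d - b * c = (1::int)" "\<tau> \<in> upper_half_plane"
  shows "moebius a b c d \<tau> \<in> upper_half_plane"
  using Im_moebius[OF assms(1), of \<tau>] moebius_denom_nonzero[OF assms] assms(2)
  by (simp add: upper_half_plane_def)

text \<open>
  The left-hand side \<open>H\<close> obeys the elliptic law of \<open>\<Theta>\<close>: since \<open>1 = (a - c t) J\<close> and
  \<open>\<tau> = (d t - b) J\<close> for the transformed modulus \<open>t\<close>, the shifts of \<open>z\<close> by \<open>1\<close> and \<open>\<tau>\<close> become lattice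
  shifts of \<open>z / J\<close>, and the Gaussian factor absorbs the difference of the multipliers. So \<open>H / \<Theta>\<close> is
  doubly periodic with removable singularities, hence constant, and its value at \<open>0\<close> is \<open>1\<close>.
\<close>

theorem crank_theta_moebius:
  fixes a b c d :: int
  assumes det: "a * d - b * c = 1" and \<tau>: "\<tau> \<in> upper_half_plane" and z: "z \<notin> period_lattice \<tau>"
  defines "J \<equiv> of_int c * \<tau> + of_int d"
  shows "J * e2pi (- of_int c * z\<^sup>2 / (2 * J)) * crank_theta (z / J) (moebius a b c d \<tau>) = crank_theta z \<tau>"
proof -
  define t where "t = moebius a b c d \<tau>"
  have t: "t \<in> upper_half_plane" unfolding t_def using det \<tau> by (rule moebius_in_upper_half_plane)
  have J: "J \<noteq> 0" unfolding J_def using det \<tau> by (rule moebius_denom_nonzero)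
  have tJ: "t * J = of_int a * \<tau> + of_int b" using J by (simp add: t_def moebius_def J_def)
  have det': "of_int a * of_int d - of_int b * of_int c = (1 :: complex)"
    using det by (metis of_int_1 of_int_diff of_int_mult)
  define H where "H = (\<lambda>z. J * e2pi (- of_int c * z\<^sup>2 / (2 * J)) * crank_theta (z / J) t)"
  \<comment> \<open>As \<open>a d - b c = 1\<close>, neither column of the matrix is even, which makes both signs equal to \<open>- 1\<close>.\<close>
  have odd: "e2pi ((of_int m + of_int n - of_int m * of_int n) / 2) = -1" if "odd m \<or> odd n" for m n :: int
  proof -
    have "odd (m + n - m * n)" using that by auto
    thus ?thesis using e2pi_half_of_int[of "m + n - m * n"] by simp
  qed
  have H1: "H (z + 1) = - H z" for z
  proof -
    have "(z + 1) / J = z / J + of_int (- c) * t + of_int a"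
    proof -
      have "1 = (of_int (- c) * t + of_int a) * J"
      proof -
        have "(of_int (- c) * t + of_int a) * J = of_int a * J - of_int c * (t * J)"
          by (simp add: algebra_simps)
        also have "\<dots> = 1" unfolding tJ unfolding J_def using det' by (simp add: algebra_simps)
        finally show ?thesis by simp
      qed
      thus ?thesis using J by (simp add: field_simps)
    qed
    hence "H (z + 1) = J * (e2pi (- of_int c * (z + 1)\<^sup>2 / (2 * J)) *
        e2pi ((of_int (- c) + of_int a) / 2 - of_int (- c) ^ 2 * t / 2 - of_int (- c) * (z / J))) * crank_theta (z / J) t"
      unfolding H_def by (simp add: crank_theta_quasiperiodic[OF t, of _ "- c" a, simplified])
    also have "e2pi (- of_int c * (z + 1)\<^sup>2 / (2 * J)) *
        e2pi ((of_int (- c) + of_int a) / 2 - of_int (- c) ^ 2 * t / 2 - of_int (- c) * (z / J)) =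
        e2pi (- of_int c * z\<^sup>2 / (2 * J)) * e2pi ((of_int (-c) + of_int a - of_int (-c) * of_int a) / 2 - of_int c * of_int a)"
    proof -
      have *: "of_int c * t = of_int a - 1 / J"
      proof -
        have "of_int c * (t * J) = of_int a * J - 1"
          unfolding tJ unfolding J_def using det' by (simp add: algebra_simps)
        thus ?thesis using J by (simp add: field_simps)
      qed
      have s1: "of_int (- c) ^ 2 * t / 2 = of_int c * (of_int a - 1 / J) / 2"
        unfolding *[symmetric] by (simp add: power2_eq_square)
      have s2: "- of_int c * (z + 1)\<^sup>2 / (2 * J) =
          - of_int c * z\<^sup>2 / (2 * J) - of_int c * (z / J) - of_int c * (1 / J) / 2"
        using J by (simp add: field_simps power2_eq_square)
      have "- of_int c * (z + 1)\<^sup>2 / (2 * J) +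
          ((of_int (- c) + of_int a) / 2 - of_int (- c) ^ 2 * t / 2 - of_int (- c) * (z / J)) =
          - of_int c * z\<^sup>2 / (2 * J) + ((of_int (-c) + of_int a - of_int (-c) * of_int a) / 2 - of_int c * of_int a)"
        unfolding s1 s2 by (simp add: algebra_simps add_divide_distrib diff_divide_distrib)
      thus ?thesis unfolding e2pi_add[symmetric] by simp
    qed
    also have "\<dots> = - e2pi (- of_int c * z\<^sup>2 / (2 * J))"
    proof -
      have "odd (-c) \<or> odd a"
      proof (rule ccontr)
        assume "\<not> ?thesis"
        hence "even (a * d - b * c)" by auto
        thus False using det by simp
      qed
      from odd[OF this] show ?thesis
        using e2pi_of_int[of "c * a"] by (simp add: e2pi_diff)
    qed
    finally show ?thesis by (simp add: H_def)
  qed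
  have Ht: "H (z + \<tau>) = - e2pi (- z - \<tau> / 2) * H z" for z
  proof -
    have t1: "\<tau> / J = of_int d * t - of_int b"
    proof -
      have "\<tau> = (of_int d * t - of_int b) * J"
      proof -
        have "(of_int d * t - of_int b) * J = of_int d * (t * J) - of_int b * J"
          by (simp add: algebra_simps)
        also have "\<dots> = (of_int a * of_int d - of_int b * of_int c) * \<tau>"
          unfolding tJ unfolding J_def by (simp add: algebra_simps)
        finally show ?thesis using det' by simp
      qed
      thus ?thesis using J by (simp add: field_simps)
    qed
    hence t2: "(z + \<tau>) / J = z / J + of_int d * t + of_int (- b)"
      by (simp add: add_divide_distrib)
    have "H (z + \<tau>) = J * (e2pi (- of_int c * (z + \<tau>)\<^sup>2 / (2 * J)) *
        e2pi ((of_int d + of_int (- b)) / 2 - of_int d ^ 2 * t / 2 - of_int d * (z / J))) * crank_theta (z / J) t"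
      unfolding H_def t2 crank_theta_quasiperiodic[OF t, of _ d "- b"] by (simp add: mult_ac)
    also have "e2pi (- of_int c * (z + \<tau>)\<^sup>2 / (2 * J)) *
        e2pi ((of_int d + of_int (- b)) / 2 - of_int d ^ 2 * t / 2 - of_int d * (z / J)) =
        e2pi (- of_int c * z\<^sup>2 / (2 * J)) * (e2pi (- z - \<tau> / 2) *
          e2pi ((of_int d + of_int (- b) - of_int d * of_int (- b)) / 2 - of_int b * of_int d))"
    proof -
      have e1: "- of_int c * (z + \<tau>)\<^sup>2 / (2 * J) = - of_int c * z\<^sup>2 / (2 * J) - of_int c * \<tau> * (z / J)
          - of_int c * \<tau> * (of_int d * t - of_int b) / 2"
        unfolding t1[symmetric] using J by (simp add: field_simps power2_eq_square)
      have "of_int c * \<tau> * (z / J) + of_int d * (z / J) = J * (z / J)"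
        by (simp only: J_def distrib_right)
      hence e2: "of_int d * (z / J) = z - of_int c * \<tau> * (z / J)"
        using J by (simp add: eq_diff_eq add.commute)
      have e3: "of_int c * \<tau> * (of_int d * t - of_int b) + of_int d ^ 2 * t = \<tau> + of_int b * of_int d"
      proof -
        have "of_int c * \<tau> * (of_int d * t - of_int b) + of_int d ^ 2 * t =
              of_int d * (t * J) - of_int b * of_int c * \<tau>" by (simp add: J_def algebra_simps power2_eq_square)
        also have "\<dots> = (of_int a * of_int d - of_int b * of_int c) * \<tau> + of_int b * of_int d"
          unfolding tJ by (simp add: algebra_simps)
        finally show ?thesis using det' by simp
      qed
      hence e3: "of_int d ^ 2 * t = \<tau> + of_int b * of_int d - of_int c * \<tau> * (of_int d * t - of_int b)"
        by (simp add: eq_diff_eq add.commute)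
      have "- of_int c * (z + \<tau>)\<^sup>2 / (2 * J) + ((of_int d + of_int (- b)) / 2 - of_int d ^ 2 * t / 2 - of_int d * (z / J)) =
         - of_int c * z\<^sup>2 / (2 * J) + ((- z - \<tau> / 2) + ((of_int d + of_int (- b) - of_int d * of_int (- b)) / 2 - of_int b * of_int d))"
        unfolding e1 e2 e3 by (simp add: algebra_simps add_divide_distrib diff_divide_distrib)
      thus ?thesis unfolding e2pi_add[symmetric] by simp
    qed
    also have "e2pi ((of_int d + of_int (- b) - of_int d * of_int (- b)) / 2 - of_int b * of_int d) = -1"
    proof -
      have "odd d \<or> odd (- b)"
      proof (rule ccontr)
        assume "\<not> ?thesis"
        hence "even (a * d - b * c)" by auto
        thus False using det by simp
      qed
      from odd[OF this] show ?thesis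
        using e2pi_of_int[of "b * d"] by (simp add: e2pi_diff)
    qed
    finally show ?thesis by (simp add: H_def)
  qed
  define R where "R = (\<lambda>z. H z / crank_theta z \<tau>)"
  have R1: "R (z + 1) = R z" for z by (simp add: R_def H1 crank_theta_add_1)
  have Rt: "R (z + \<tau>) = R z" for z by (simp add: R_def Ht crank_theta_add_tau[OF \<tau>])
  have R0: "(R \<longlongrightarrow> 1) (at 0)"
  proof -
    have ev: "\<forall>\<^sub>F z in at 0. z \<noteq> (0 :: complex)" by (rule eventually_neq_at_within)
    have "((\<lambda>z. crank_theta (z / J) t / (z / J)) \<longlongrightarrow> - (2 * of_real pi * \<i>)) (at 0)"
    proof (rule tendsto_compose_at[of "\<lambda>z. z / J" 0 _ "\<lambda>z. crank_theta z t / z", unfolded o_def])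
      show "((\<lambda>z. z / J) \<longlongrightarrow> 0) (at 0)" using J by (auto intro!: tendsto_eq_intros)
      show "\<forall>\<^sub>F z in at 0. z / J = 0 \<longrightarrow> crank_theta 0 t / 0 = - (2 * complex_of_real pi * \<i>)"
        by (rule eventually_mono[OF ev]) (use J in simp)
      show "((\<lambda>z. crank_theta z t / z) \<longlongrightarrow> - (2 * complex_of_real pi * \<i>)) (at 0)"
        by (rule crank_theta_over_z[OF t])
    qed
    moreover have "((\<lambda>z. e2pi (- of_int c * z\<^sup>2 / (2 * J))) \<longlongrightarrow> e2pi (- of_int c * 0\<^sup>2 / (2 * J))) (at 0)"
      using J by (intro tendsto_intros) auto
    ultimately have "((\<lambda>z. (e2pi (- of_int c * z\<^sup>2 / (2 * J)) * (crank_theta (z / J) t / (z / J))) / (crank_theta z \<tau> / z))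
        \<longlongrightarrow> (1 * (- (2 * of_real pi * \<i>))) / (- (2 * of_real pi * \<i>))) (at 0)"
      by (intro tendsto_divide tendsto_mult crank_theta_over_z \<tau>) auto
    also have "?this \<longleftrightarrow> ?thesis"
    proof (rule filterlim_cong)
      have gen: "e * (X / (z / J)) / (Y / z) = J * e * X / Y" if "z \<noteq> 0" for e X Y z :: complex
        using that by simp
      have "(e2pi (- of_int c * z\<^sup>2 / (2 * J)) * (crank_theta (z / J) t / (z / J))) / (crank_theta z \<tau> / z) = R z"
        if "z \<noteq> 0" for z unfolding R_def H_def using that by (rule gen)
      thus "\<forall>\<^sub>F z in at 0. (e2pi (- of_int c * z\<^sup>2 / (2 * J)) * (crank_theta (z / J) t / (z / J))) / (crank_theta z \<tau> / z) = R z"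
        by (rule eventually_mono[OF ev])
    qed auto
    finally show ?thesis .
  qed
  have "R holomorphic_on (- period_lattice \<tau>)"
  proof -
    have "(\<lambda>z. crank_theta (z / J) t) holomorphic_on - period_lattice \<tau>"
    proof -
      have "(\<lambda>z. z / J) holomorphic_on - period_lattice \<tau>"
        using J by (intro holomorphic_intros) auto
      from holomorphic_on_compose_gen[OF this holomorphic_crank_theta[OF t, of UNIV]]
      show ?thesis by (simp add: o_def)
    qed
    thus ?thesis unfolding R_def H_def using J crank_theta_nonzero[OF \<tau>]
      by (intro holomorphic_intros holomorphic_crank_theta \<tau>) auto
  qed
  moreover have "(R \<longlongrightarrow> 1) (at w)" if "w \<in> period_lattice \<tau>" for w
  proof -
    from that obtain m n where w: "w = of_int m * \<tau> + of_int n" by (auto simp: period_lattice_def)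
    have "R (z + w) = R z" for z
      using periodic_of_int[of R \<tau> "z + of_int n" m] periodic_of_int[of R 1 z n]
      by (simp add: R1 Rt w add_ac)
    hence "R (z - w) = R z" for z using \<open>\<And>z. R (z + w) = R z\<close>[of "z - w"] by simp
    thus ?thesis using LIM_offset[OF R0, of "- w"] by simp
  qed
  ultimately obtain g where g: "g holomorphic_on UNIV" "\<And>z. z \<notin> period_lattice \<tau> \<Longrightarrow> g z = R z"
    using entire_extension[OF \<tau>] by blast
  have gc: "continuous_on UNIV g" using g(1) by (rule holomorphic_on_imp_continuous_on)
  have gs: "continuous_on UNIV (\<lambda>w. g (w + s))" for s
    by (intro continuous_on_compose2[OF gc] continuous_intros) auto
  have "g (w + 1) = g w" for w
    by (rule eq_off_period_lattice_imp_eq[OF \<tau> gs gc]) (simp add: g(2) R1)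
  moreover have "g (w + \<tau>) = g w" for w
    by (rule eq_off_period_lattice_imp_eq[OF \<tau> gs gc]) (simp add: g(2) Rt)
  ultimately have const: "g z = g 0" by (rule doubly_periodic_entire_constant[OF \<tau> g(1)])
  have "(g \<longlongrightarrow> g 0) (at 0)" using gc by (simp add: continuous_on_def)
  moreover have "(g \<longlongrightarrow> 1) (at 0)"
    using R0 by (rule Lim_transform_eventually)
      (rule eventually_mono[OF eventually_not_period_lattice[OF \<tau>]], simp add: g(2))
  ultimately have "g 0 = 1" using tendsto_unique at_neq_bot by blast
  hence "R z = 1" using const g(2)[OF z] by simp
  thus ?thesis using crank_theta_nonzero[OF \<tau> z] by (simp add: R_def H_def t_def)
qed



section \<open>The Taylor expansion of the logarithm of the theta function\<close>

text \<open>
  The common majorant of the double series below: a factor that is polynomial in \<open>m\<close> comes from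
  derivatives in \<open>u\<close>.
\<close>

lemma summable_on_double_series:
  fixes r s :: real
  assumes "0 < r" "r < 1" "0 < s" "s < 1"
  shows "(\<lambda>(n, m). (1 + real m) ^ p * r ^ Suc m * s ^ n) summable_on UNIV"
proof -
  have r: "summable (\<lambda>m. (1 + real m) ^ p * r ^ Suc m)"
    using summable_mult[OF summable_power_times_geometric[OF assms(1,2), of p], of r]
    by (simp add: mult_ac)
  define f where "f = (\<lambda>(n, m). (1 + real m) ^ p * r ^ Suc m * s ^ n)"
  have "(\<lambda>x. norm (f x)) summable_on UNIV \<times> UNIV"
    unfolding Infinite_Sum.abs_summable_on_Sigma_iff f_def
  proof (safe, goal_cases)
    case (1 n)
    have "summable (\<lambda>m. (1 + real m) ^ p * r ^ Suc m * s ^ n)" by (intro summable_mult2 r)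
    hence "(\<lambda>m. (1 + real m) ^ p * r ^ Suc m * s ^ n) summable_on UNIV"
      by (rule summable_nonneg_imp_summable_on) (use assms in auto)
    thus ?case using assms by (simp add: abs_mult power_abs)
  next
    case 2
    have "(\<lambda>n. (\<Sum>\<^sub>\<infinity>m. (1 + real m) ^ p * r ^ Suc m) * s ^ n) summable_on UNIV"
    proof (intro summable_on_cmult_right summable_nonneg_imp_summable_on)
      show "summable (\<lambda>n. s ^ n)" using assms by (intro summable_geometric) auto
    qed (use assms in auto)
    moreover have "(\<Sum>\<^sub>\<infinity>m. norm (case (n, m) of (n, m) \<Rightarrow> (1 + real m) ^ p * r ^ Suc m * s ^ n)) =
        (\<Sum>\<^sub>\<infinity>m. (1 + real m) ^ p * r ^ Suc m) * s ^ n" for n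
      using assms by (subst infsum_cmult_left'[symmetric]) (simp add: abs_mult power_abs)
    moreover have "(\<Sum>\<^sub>\<infinity>m. (1 + real m) ^ p * r ^ Suc m) \<ge> 0"
      using assms by (intro infsum_nonneg) auto
    ultimately show ?case using assms by (simp add: abs_mult)
  qed
  hence "f summable_on UNIV \<times> UNIV" by (rule abs_summable_summable)
  thus ?thesis by (simp add: f_def)
qed

lemma norm_power_prod_le:
  fixes q :: complex
  assumes "norm q \<le> s" "s \<le> 1"
  shows "norm (q ^ (Suc n * Suc m)) \<le> s ^ Suc m * s ^ n"
proof -
  have s: "0 \<le> s" using assms(1) norm_ge_zero order_trans by blast
  have "norm (q ^ (Suc n * Suc m)) \<le> s ^ (Suc n * Suc m)"
    unfolding norm_power by (intro power_mono assms) auto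
  also have "\<dots> \<le> s ^ (Suc m + n)"
    using s assms(2) by (intro power_decreasing) auto
  finally show ?thesis by (simp only: power_add)
qed

text \<open>
  Expanding \<open>log (1 - x q\<^sup>n)\<close> is legitimate only for \<open>\<bar>x q\<bar> < 1\<close>. This suffices, as the expansion is
  used for \<open>x\<close> close to \<open>1\<close>.
\<close>

lemma euler_prod_eq_exp:
  assumes q: "norm q < 1" "q \<noteq> 0" and x: "norm x * norm q < 1"
  shows "(\<lambda>(n, m). x ^ Suc m * q ^ (Suc n * Suc m) / of_nat (Suc m)) summable_on UNIV" (is ?thesis1)
    and "euler_prod x q = exp (- (\<Sum>\<^sub>\<infinity>(n, m)\<in>UNIV. x ^ Suc m * q ^ (Suc n * Suc m) / of_nat (Suc m)))" (is ?thesis2)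
proof -
  define f where "f = (\<lambda>(n, m). x ^ Suc m * q ^ (Suc n * Suc m) / of_nat (Suc m))"
  let ?r = "max (norm x) 1 * norm q"
  have r: "0 < ?r" "?r < 1"
    by (cases "norm x \<le> 1", use q x in \<open>auto simp: max_def intro!: mult_pos_pos\<close>)
  have le: "norm (f (n, m)) \<le> ?r ^ Suc m * norm q ^ n" for n m
  proof -
    have "norm (f (n, m)) \<le> norm (x ^ Suc m) * norm (q ^ (Suc n * Suc m)) / 1"
      unfolding f_def prod.case norm_divide norm_mult by (intro divide_left_mono) (auto simp del: of_nat_Suc)
    also have "\<dots> \<le> max (norm x) 1 ^ Suc m * (norm q ^ Suc m * norm q ^ n)"
      unfolding div_by_1 by (intro mult_mono norm_power_prod_le) (use q in \<open>auto simp: norm_power intro!: power_mono simp del: power_Suc\<close>)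
    finally show ?thesis by (simp add: power_mult_distrib mult_ac)
  qed
  have sf: "f summable_on UNIV"
  proof (rule abs_summable_summable, rule Infinite_Sum.abs_summable_on_comparison_test')
    show "(\<lambda>(n, m). (1 + real m) ^ 0 * ?r ^ Suc m * norm q ^ n) summable_on UNIV"
      using r q by (intro summable_on_double_series) auto
    show "norm (f nm) \<le> (case nm of (n, m) \<Rightarrow> (1 + real m) ^ 0 * ?r ^ Suc m * norm q ^ n)" for nm
      using le[of "fst nm" "snd nm"] by (cases nm) simp
  qed
  thus ?thesis1 unfolding f_def .
  define T where "T = infsum f UNIV"
  have T: "(f has_sum T) (UNIV \<times> UNIV)" unfolding T_def using sf by simp
  have y: "norm (x * q ^ Suc n) < 1" for n
  proof -
    have "norm (x * q ^ Suc n) = (norm x * norm q) * norm q ^ n" by (simp add: norm_mult norm_power)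
    also have "\<dots> \<le> (norm x * norm q) * 1"
      using q by (intro mult_left_mono power_le_one) auto
    finally show ?thesis using x by simp
  qed
  have inner: "((\<lambda>m. f (n, m)) has_sum - ln (1 - x * q ^ Suc n)) UNIV" for n
  proof (rule norm_summable_imp_has_sum)
    let ?y = "x * q ^ Suc n"
    have "(\<lambda>k. - (?y ^ k) / of_nat k) sums ln (1 - ?y)"
      using Ln_series'[of "- ?y"] y[of n] by simp
    hence "(\<lambda>k. ?y ^ k / of_nat k) sums (- ln (1 - ?y))"
      using sums_minus by fastforce
    hence "(\<lambda>m. ?y ^ Suc m / of_nat (Suc m)) sums (- ln (1 - ?y))"
      by (subst sums_Suc_iff) simp
    also have "(\<lambda>m. ?y ^ Suc m / of_nat (Suc m)) = (\<lambda>m. f (n, m))"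
      unfolding f_def prod.case by (intro ext) (simp only: power_mult_distrib power_mult)
    finally show "(\<lambda>m. f (n, m)) sums (- ln (1 - ?y))" .
    show "summable (\<lambda>m. norm (f (n, m)))"
    proof (rule summable_comparison_test)
      show "\<exists>N. \<forall>m\<ge>N. norm (norm (f (n, m))) \<le> ?r ^ Suc m * norm q ^ n" using le by auto
      show "summable (\<lambda>m. ?r ^ Suc m * norm q ^ n)"
        using r by (intro summable_mult2 summable_ignore_initial_segment[of _ 1, simplified] summable_geometric) auto
    qed
  qed
  have "((\<lambda>n. - ln (1 - x * q ^ Suc n)) has_sum T) UNIV"
    using T inner by (rule has_sum_Sigma')
  hence "(\<lambda>n. - ln (1 - x * q ^ Suc n)) sums T" by (rule has_sum_imp_sums)
  hence "(\<lambda>N. exp (- (\<Sum>n<N. - ln (1 - x * q ^ Suc n)))) \<longlonglongrightarrow> exp (- T)"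
    unfolding sums_def by (intro tendsto_intros)
  also have "(\<lambda>N. exp (- (\<Sum>n<N. - ln (1 - x * q ^ Suc n)))) = (\<lambda>N. \<Prod>n<N. 1 - x * q ^ Suc n)"
  proof
    fix N
    have "1 - x * q ^ Suc n \<noteq> 0" for n using y[of n] by auto
    thus "exp (- (\<Sum>n<N. - ln (1 - x * q ^ Suc n))) = (\<Prod>n<N. 1 - x * q ^ Suc n)"
      by (simp add: sum_negf exp_sum del: power_Suc)
  qed
  finally have "(\<lambda>N. \<Prod>n<N. 1 - x * q ^ Suc n) \<longlonglongrightarrow> exp (- T)" .
  moreover have "(\<lambda>N. \<Prod>n<N. 1 - x * q ^ Suc n) \<longlonglongrightarrow> euler_prod x q"
    by (intro has_prod_imp_tendsto' has_prod_euler_prod q)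
  ultimately have "euler_prod x q = exp (- T)" by (rule LIMSEQ_unique[symmetric])
  thus ?thesis2 unfolding T_def f_def .
qed

text \<open>
  The term of \<open>\<Sum> (w\<^sup>m + w\<^bsup>-m\<^esup> - 2) q\<^bsup>n m\<^esup> / m\<close> at \<open>w = e\<^sup>u\<close>, which is minus the logarithm of the product
  part of the theta function. The indices are shifted by one.
\<close>

definition theta_log_term :: "nat \<times> nat \<Rightarrow> complex \<Rightarrow> complex \<Rightarrow> complex" where
  "theta_log_term = (\<lambda>(n, m) u q.
     (exp (of_nat (Suc m) * u) + exp (- of_nat (Suc m) * u) - 2) * (q ^ (Suc n * Suc m) / of_nat (Suc m)))"

definition theta_log_series :: "complex \<Rightarrow> complex \<Rightarrow> complex" where
  "theta_log_series u q = (\<Sum>\<^sub>\<infinity>nm\<in>UNIV. theta_log_term nm u q)"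

lemma norm_exp_less:
  assumes "exp (norm u) * norm q < 1"
  shows "norm (exp u) * norm q < 1" "norm (exp (- u :: complex)) * norm q < (1 :: real)"
proof -
  have *: "norm (exp v) * norm q \<le> exp (norm u) * norm q" if "norm v = norm u" for v :: complex
    using that complex_Re_le_cmod[of v] by (intro mult_right_mono) auto
  show "norm (exp u) * norm q < 1" "norm (exp (- u :: complex)) * norm q < (1 :: real)"
    using *[of u] *[of "-u"] assms by auto
qed

lemma euler_prod_eq_exp_series:
  assumes q: "norm q < 1" "q \<noteq> 0" and u: "exp (norm u) * norm q < 1"
  shows "euler_prod (exp u) q * euler_prod (exp (- u)) q / euler_prod 1 q ^ 2 = exp (- theta_log_series u q)"
proof -
  define T where "T = (\<lambda>x. \<Sum>\<^sub>\<infinity>(n, m)\<in>UNIV. x ^ Suc m * q ^ (Suc n * Suc m) / of_nat (Suc m))"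
  have 1: "norm (1 :: complex) * norm q < 1" using q by simp
  note E = euler_prod_eq_exp[OF q norm_exp_less(1)[OF u]] euler_prod_eq_exp[OF q norm_exp_less(2)[OF u]]
    euler_prod_eq_exp[OF q 1]
  have "theta_log_series u q = T (exp u) + T (exp (- u)) - 2 * T 1"
  proof -
    have "T (exp u) + T (exp (- u)) + (-2) * T 1 = infsum (\<lambda>nm. theta_log_term nm u q) UNIV"
      unfolding T_def
      apply (subst infsum_cmult_right'[symmetric])
      apply (subst infsum_add[OF E(1) E(3), symmetric])
      apply (subst infsum_add[symmetric])
      subgoal by (intro summable_on_add E)
      subgoal by (intro summable_on_cmult_right E)
      apply (intro infsum_cong)
      apply (auto simp: theta_log_term_def exp_of_nat_mult[symmetric] exp_minus field_simps simp del: of_nat_Suc power_Suc mult_Suc mult_Suc_right)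
      done
    thus ?thesis by (simp add: theta_log_series_def)
  qed
  moreover have "exp (- A) * exp (- B) / exp (- C) ^ 2 = exp (- (A + B - 2 * C))" for A B C :: complex
    by (simp add: exp_minus exp_add exp_diff exp_double[of C, symmetric] field_simps)
  ultimately show ?thesis unfolding E(2,4,6) by (simp only: T_def)
qed

text \<open>
  The \<open>j\<close>-th derivative of the series at \<open>u = 0\<close> for \<open>j > 0\<close>. It is twice the Lambert series
  \<open>\<Sum> \<sigma>\<^bsub>j-1\<^esub>(N) q\<^sup>N\<close> when \<open>j\<close> is even, and zero when \<open>j\<close> is odd.
\<close>

definition theta_log_coeff :: "nat \<Rightarrow> complex \<Rightarrow> complex" where
  "theta_log_coeff j q = (\<Sum>\<^sub>\<infinity>(n, m)\<in>UNIV. (of_nat (Suc m) ^ j + (- of_nat (Suc m)) ^ j) * (q ^ (Suc n * Suc m) / of_nat (Suc m)))"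

lemma higher_deriv_exp_pair:
  fixes k c :: complex
  shows "(deriv ^^ Suc j) (\<lambda>u. (exp (k * u) + exp (- k * u) - 2) * c) =
           (\<lambda>u. (k ^ Suc j * exp (k * u) + (- k) ^ Suc j * exp (- k * u)) * c)"
proof (induction j)
  case 0
  show ?case by (auto intro!: ext DERIV_imp_deriv derivative_eq_intros simp: algebra_simps)
next
  case (Suc j)
  have "(deriv ^^ Suc (Suc j)) (\<lambda>u. (exp (k * u) + exp (- k * u) - 2) * c) =
     deriv (\<lambda>u. (k ^ Suc j * exp (k * u) + (- k) ^ Suc j * exp (- k * u)) * c)"
    by (subst Suc[symmetric]) simp
  also have "\<dots> = (\<lambda>u. (k ^ Suc (Suc j) * exp (k * u) + (- k) ^ Suc (Suc j) * exp (- k * u)) * c)"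
    by (auto intro!: ext DERIV_imp_deriv derivative_eq_intros simp: algebra_simps)
  finally show ?case .
qed

lemma
  assumes q: "norm q < 1" "q \<noteq> 0" and \<rho>: "\<rho> > 0" "exp \<rho> * norm q < 1"
  shows holomorphic_theta_log_series: "(\<lambda>u. theta_log_series u q) holomorphic_on ball 0 \<rho>"
    and higher_deriv_theta_log_series:
      "j > 0 \<Longrightarrow> (deriv ^^ j) (\<lambda>u. theta_log_series u q) 0 = theta_log_coeff j q"
proof -
  let ?M = "\<lambda>(n, m). 4 * ((1 + real m) ^ 0 * (exp \<rho> * norm q) ^ Suc m * norm q ^ n)"
  have M: "?M summable_on UNIV"
    using summable_on_cmult_right[OF summable_on_double_series[of "exp \<rho> * norm q" "norm q" 0], of 4] q \<rho>
    by (simp add: case_prod_unfold)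
  have le: "norm (theta_log_term nm u q) \<le> ?M nm" if "u \<in> ball 0 \<rho>" for nm u
  proof (cases nm)
    case (Pair n m)
    let ?k = "Suc m"
    have e: "norm (exp (of_nat ?k * v)) \<le> exp \<rho> ^ ?k" if "norm v < \<rho>" for v :: complex
    proof -
      have "norm (exp (of_nat ?k * v)) = norm (exp v) ^ ?k"
        by (simp only: exp_of_nat_mult norm_power)
      also have "\<dots> \<le> exp \<rho> ^ ?k"
        using that complex_Re_le_cmod[of v] by (intro power_mono) auto
      finally show ?thesis .
    qed
    have "norm (a + b - 2) \<le> norm a + norm b + 2" for a b :: complex
      using norm_triangle_ineq4[of "a + b" 2] norm_triangle_ineq[of a b] by simp
    hence "norm (exp (of_nat ?k * u) + exp (- of_nat ?k * u) - 2) \<le> norm (exp (of_nat ?k * u)) + norm (exp (of_nat ?k * (- u))) + 2"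
      unfolding mult_minus_right mult_minus_left .
    also have "\<dots> \<le> exp \<rho> ^ ?k + exp \<rho> ^ ?k + 2 * exp \<rho> ^ ?k"
      using that \<rho> one_le_power[of "exp \<rho>" ?k] by (intro add_mono e) (auto simp del: power_Suc)
    finally have 1: "norm (exp (of_nat ?k * u) + exp (- of_nat ?k * u) - 2) \<le> 4 * exp \<rho> ^ ?k" by simp
    have "norm (q ^ (Suc n * ?k) / of_nat ?k) \<le> norm (q ^ (Suc n * ?k)) / 1"
      unfolding norm_divide by (intro divide_left_mono) (auto simp del: of_nat_Suc)
    also have "\<dots> \<le> norm q ^ ?k * norm q ^ n"
      unfolding div_by_1 using q by (intro norm_power_prod_le) auto
    finally have 2: "norm (q ^ (Suc n * ?k) / of_nat ?k) \<le> norm q ^ ?k * norm q ^ n" .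
    show ?thesis unfolding Pair theta_log_term_def prod.case norm_mult
      using mult_mono[OF 1 2] by (simp add: power_mult_distrib mult_ac)
  qed
  have hol: "(\<lambda>u. theta_log_term nm u q) holomorphic_on ball 0 \<rho>" for nm
    unfolding theta_log_term_def case_prod_unfold by (intro holomorphic_intros) (simp del: of_nat_Suc)
  show "(\<lambda>u. theta_log_series u q) holomorphic_on ball 0 \<rho>"
    unfolding theta_log_series_def by (rule holomorphic_infsum[OF open_ball hol le M])
  show "(deriv ^^ j) (\<lambda>u. theta_log_series u q) 0 = theta_log_coeff j q" if "j > 0"
  proof -
    obtain i where j: "j = Suc i" using \<open>j > 0\<close> gr0_conv_Suc by blast
    have "((\<lambda>nm. (deriv ^^ j) (\<lambda>u. theta_log_term nm u q) 0) has_sum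
            (deriv ^^ j) (\<lambda>u. theta_log_series u q) 0) UNIV"
      unfolding theta_log_series_def
      by (rule higher_deriv_infsum[OF open_ball hol le M]) (use \<rho> in auto)
    also have "(\<lambda>nm. (deriv ^^ j) (\<lambda>u. theta_log_term nm u q) 0) =
       (\<lambda>(n, m). (of_nat (Suc m) ^ j + (- of_nat (Suc m)) ^ j) * (q ^ (Suc n * Suc m) / of_nat (Suc m)))"
      unfolding theta_log_term_def case_prod_unfold j by (subst higher_deriv_exp_pair) simp
    finally show ?thesis unfolding theta_log_coeff_def by (rule infsumI[symmetric])
  qed
qed

lemma summable_on_theta_log_coeff_bound:
  fixes q :: complex
  assumes R: "0 < R" "R < 1"
  shows "(\<lambda>(n, m). 2 * ((1 + real m) ^ j * R ^ Suc m * R ^ n)) summable_on UNIV"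
    "norm q \<le> R \<Longrightarrow> norm ((of_nat (Suc m) ^ j + (- of_nat (Suc m)) ^ j) * (q ^ (Suc n * Suc m) / of_nat (Suc m)))
       \<le> 2 * ((1 + real m) ^ j * R ^ Suc m * R ^ n)"
proof -
  show "(\<lambda>(n, m). 2 * ((1 + real m) ^ j * R ^ Suc m * R ^ n)) summable_on UNIV"
    using summable_on_cmult_right[OF summable_on_double_series[OF R R, of j], of 2]
    by (simp add: case_prod_unfold)
  assume q: "norm q \<le> R"
  have "norm ((of_nat (Suc m) ^ j + (- of_nat (Suc m)) ^ j) :: complex) \<le>
      norm ((of_nat (Suc m) :: complex) ^ j) + norm ((- of_nat (Suc m) :: complex) ^ j)"
    by (rule norm_triangle_ineq)
  also have "\<dots> = 2 * (1 + real m) ^ j"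
    unfolding norm_power norm_minus_cancel norm_of_nat by simp
  finally have 1: "norm ((of_nat (Suc m) ^ j + (- of_nat (Suc m)) ^ j) :: complex) \<le> 2 * (1 + real m) ^ j" .
  have "norm (q ^ (Suc n * Suc m) / of_nat (Suc m)) \<le> norm (q ^ (Suc n * Suc m)) / 1"
    unfolding norm_divide by (intro divide_left_mono) (auto simp del: of_nat_Suc)
  also have "\<dots> \<le> R ^ Suc m * R ^ n"
    unfolding div_by_1 using q R by (intro norm_power_prod_le) auto
  finally have 2: "norm (q ^ (Suc n * Suc m) / of_nat (Suc m)) \<le> R ^ Suc m * R ^ n" .
  show "norm ((of_nat (Suc m) ^ j + (- of_nat (Suc m)) ^ j) * (q ^ (Suc n * Suc m) / of_nat (Suc m)))
       \<le> 2 * ((1 + real m) ^ j * R ^ Suc m * R ^ n)"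
    unfolding norm_mult using mult_mono[OF 1 2] by (simp add: mult_ac)
qed

lemma holomorphic_theta_log_coeff: "theta_log_coeff j holomorphic_on ball 0 1"
proof -
  have "theta_log_coeff j holomorphic_on ball 0 R" if R: "0 < R" "R < 1" for R
  proof -
    note B = summable_on_theta_log_coeff_bound[OF R, where j = j]
    show ?thesis unfolding theta_log_coeff_def[abs_def] case_prod_unfold
    proof (rule holomorphic_infsum[OF open_ball])
      show "(\<lambda>(n, m). 2 * ((1 + real m) ^ j * R ^ Suc m * R ^ n)) summable_on UNIV" by (rule B)
      fix nm :: "nat \<times> nat"
      show "(\<lambda>q. (of_nat (Suc (snd nm)) ^ j + (- of_nat (Suc (snd nm))) ^ j) * (q ^ (Suc (fst nm) * Suc (snd nm)) / of_nat (Suc (snd nm)))) holomorphic_on ball 0 R"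
        by (intro holomorphic_intros) (simp del: of_nat_Suc)
      fix q :: complex assume "q \<in> ball 0 R"
      thus "norm ((of_nat (Suc (snd nm)) ^ j + (- of_nat (Suc (snd nm))) ^ j) * (q ^ (Suc (fst nm) * Suc (snd nm)) / of_nat (Suc (snd nm))))
          \<le> (case nm of (n, m) \<Rightarrow> 2 * ((1 + real m) ^ j * R ^ Suc m * R ^ n))"
        using B(2)[of q "snd nm" "fst nm"] by (simp add: case_prod_unfold)
    qed
  qed
  hence "theta_log_coeff j holomorphic_on (\<Union>R\<in>{0<..<1}. ball 0 R)"
    by (intro holomorphic_on_UN_open) auto
  also have "(\<Union>R\<in>{0<..<1::real}. ball 0 R) = (ball 0 1 :: complex set)"
  proof (intro equalityI subsetI)
    fix z :: complex assume "z \<in> ball 0 1"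
    then obtain R where "norm z < R" "R < 1" using dense[of "norm z" 1] by auto
    moreover from this have "0 < R" using norm_ge_zero[of z] by linarith
    ultimately show "z \<in> (\<Union>R\<in>{0<..<1}. ball 0 R)" by auto
  qed auto
  finally show ?thesis .
qed

text \<open>
  Sorting the pairs \<open>(n, m)\<close> by their product turns the double series for \<open>j = 2\<close> into the
  divisor sums of \<open>E\<^sub>2\<close>.
\<close>

lemma bij_betw_divisor_pairs:
  "bij_betw (\<lambda>(n, m). (Suc n * Suc m - 1, Suc m)) (UNIV :: (nat \<times> nat) set) (Sigma UNIV (\<lambda>N. {d. d dvd Suc N}))"
proof (rule bij_betwI[where g = "\<lambda>(N, d). (Suc N div d - 1, d - 1)"])
  have "Suc (Suc n * Suc m - 1) = Suc n * Suc m" for n m by simp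
  thus "(\<lambda>(n, m). (Suc n * Suc m - 1, Suc m)) \<in> UNIV \<rightarrow> (SIGMA N:UNIV. {d. d dvd Suc N})"
    by (auto simp del: mult_Suc mult_Suc_right)
  show "(\<lambda>(N, d). (Suc N div d - 1, d - 1)) \<in> (SIGMA N:UNIV. {d. d dvd Suc N}) \<rightarrow> UNIV"
    by auto
  show "(case (case x of (n, m) \<Rightarrow> (Suc n * Suc m - 1, Suc m)) of (N, d) \<Rightarrow> (Suc N div d - 1, d - 1)) = x"
    for x :: "nat \<times> nat"
  proof (cases x)
    case (Pair n m)
    have "Suc (Suc n * Suc m - 1) div Suc m = Suc n"
      by (metis Suc_pred' nat_0_less_mult_iff nonzero_mult_div_cancel_right old.nat.distinct(2) zero_less_Suc)
    thus ?thesis unfolding Pair by simp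
  qed
  show "(case (case y of (N, d) \<Rightarrow> (Suc N div d - 1, d - 1)) of (n, m) \<Rightarrow> (Suc n * Suc m - 1, Suc m)) = y"
    if "y \<in> (SIGMA N:UNIV. {d. d dvd Suc N})" for y :: "nat \<times> nat"
  proof (cases y)
    case (Pair N d)
    with that obtain e where e: "Suc N = d * e" by auto
    hence "d > 0" "e > 0" by (auto intro!: Nat.gr0I)
    thus ?thesis unfolding Pair prod.case e using e
      by (simp add: mult.commute)
  qed
qed

lemma eisenstein_E2_eq:
  assumes \<tau>: "\<tau> \<in> upper_half_plane"
  shows "eisenstein_E2 \<tau> = 1 - 12 * theta_log_coeff 2 (e2pi \<tau>)"
proof -
  define q where "q = e2pi \<tau>"
  have q: "0 < norm q" "norm q < 1" using norm_e2pi_less_1[OF \<tau>] by (simp_all add: q_def)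
  note B = summable_on_theta_log_coeff_bound[OF q, where j = 2]
  define g :: "nat \<times> nat \<Rightarrow> complex" where "g = (\<lambda>(N, d). of_nat d * q ^ Suc N)"
  have t: "(of_nat (Suc m) ^ 2 + (- of_nat (Suc m)) ^ 2) * (q ^ (Suc n * Suc m) / of_nat (Suc m)) =
      2 * g (Suc n * Suc m - 1, Suc m)" for n m
    by (simp add: g_def power2_eq_square del: of_nat_Suc)
  have "(\<lambda>(n, m). (of_nat (Suc m) ^ 2 + (- of_nat (Suc m)) ^ 2) * (q ^ (Suc n * Suc m) / of_nat (Suc m))) summable_on UNIV"
    by (rule abs_summable_summable, rule Infinite_Sum.abs_summable_on_comparison_test'[OF B(1)])
       (use B(2) in \<open>auto simp del: power_Suc of_nat_Suc mult_Suc mult_Suc_right\<close>)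
  hence "(\<lambda>nm. 2 * g (case nm of (n, m) \<Rightarrow> (Suc n * Suc m - 1, Suc m))) summable_on UNIV"
    unfolding t by (simp only: case_prod_unfold prod.case)
  hence "(\<lambda>nm. g (case nm of (n, m) \<Rightarrow> (Suc n * Suc m - 1, Suc m))) summable_on UNIV"
    by (subst (asm) summable_on_cmult_right') auto
  hence sg: "g summable_on (Sigma UNIV (\<lambda>N. {d. d dvd Suc N}))"
    by (subst (asm) summable_on_reindex_bij_betw[OF bij_betw_divisor_pairs])
  have "theta_log_coeff 2 q = (\<Sum>\<^sub>\<infinity>nm\<in>UNIV. 2 * g (case nm of (n, m) \<Rightarrow> (Suc n * Suc m - 1, Suc m)))"
    unfolding theta_log_coeff_def t by (simp only: case_prod_unfold prod.case)
  also have "\<dots> = 2 * (\<Sum>\<^sub>\<infinity>nm\<in>UNIV. g (case nm of (n, m) \<Rightarrow> (Suc n * Suc m - 1, Suc m)))"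
    by (rule infsum_cmult_right')
  also have "(\<Sum>\<^sub>\<infinity>nm\<in>UNIV. g (case nm of (n, m) \<Rightarrow> (Suc n * Suc m - 1, Suc m))) =
      infsum g (Sigma UNIV (\<lambda>N. {d. d dvd Suc N}))"
    by (rule infsum_reindex_bij_betw[OF bij_betw_divisor_pairs])
  also have "\<dots> = (\<Sum>\<^sub>\<infinity>N\<in>UNIV. \<Sum>\<^sub>\<infinity>d\<in>{d. d dvd Suc N}. g (N, d))"
    by (rule infsum_Sigma_banach[OF sg, symmetric])
  also have "\<dots> = (\<Sum>\<^sub>\<infinity>N\<in>UNIV. of_nat (\<Sum>d | d dvd Suc N. d) * q ^ Suc N)"
    by (intro infsum_cong) (simp add: infsum_finite g_def sum_distrib_right)
  also have "\<dots> = (\<Sum>N. of_nat (\<Sum>d | d dvd Suc N. d) * q ^ Suc N)"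
  proof -
    have "(\<lambda>N. \<Sum>\<^sub>\<infinity>d\<in>{d. d dvd Suc N}. g (N, d)) summable_on UNIV"
    proof (rule summable_on_Sigma_banach)
      show "(\<lambda>(N, d). g (N, d)) summable_on (Sigma UNIV (\<lambda>N. {d. d dvd Suc N}))"
        using sg by (simp add: case_prod_unfold)
    qed
    hence "(\<lambda>N. of_nat (\<Sum>d | d dvd Suc N. d) * q ^ Suc N) summable_on UNIV"
      by (simp add: infsum_finite g_def sum_distrib_right)
    hence "(\<lambda>N. of_nat (\<Sum>d | d dvd Suc N. d) * q ^ Suc N) sums
        (\<Sum>\<^sub>\<infinity>N\<in>UNIV. of_nat (\<Sum>d | d dvd Suc N. d) * q ^ Suc N)"
      by (intro has_sum_imp_sums has_sum_infsum)
    thus ?thesis by (rule sums_unique)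
  qed
  finally show ?thesis unfolding eisenstein_E2_def q_def by simp
qed

text \<open>
  The remaining factor of the theta function is \<open>- 2 sinh (u / 2)\<close>. On the unit disc
  \<open>u / (2 sinh (u / 2))\<close> has no zeros and a removable singularity, so it has a holomorphic logarithm.
\<close>

lemma sinh_log_exists:
  "\<exists>\<nu>. \<nu> holomorphic_on ball 0 1 \<and> \<nu> 0 = 0 \<and>
       (\<forall>u\<in>ball 0 1. exp (\<nu> u) * (exp (u / 2) - exp (- u / 2)) = (u :: complex))"
proof -
  define s where "s = (\<lambda>u::complex. exp (u / 2) - exp (- u / 2))"
  define M where "M = (\<lambda>u. if u = 0 then 1 else s u / u)"
  have s: "s holomorphic_on UNIV" unfolding s_def by (intro holomorphic_intros) auto
  have "(s has_field_derivative 1) (at 0)" unfolding s_def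
    by (auto intro!: derivative_eq_intros)
  hence lim: "((\<lambda>u. s u / u) \<longlongrightarrow> 1) (at 0)"
    by (simp add: has_field_derivative_iff s_def)
  have M: "M holomorphic_on ball 0 1"
  proof (rule no_isolated_singularity'[where K = "{0}"])
    have "(\<lambda>u. s u / u) holomorphic_on ball 0 1 - {0}"
      using s by (intro holomorphic_intros) (auto intro: holomorphic_on_subset)
    thus "M holomorphic_on ball 0 1 - {0}"
      by (rule holomorphic_transform) (auto simp: M_def)
    have "(M \<longlongrightarrow> 1) (at 0)" using lim
      by (rule Lim_transform_eventually) (auto simp: M_def eventually_at_filter)
    thus "(M \<longlongrightarrow> M z) (at z within ball 0 1)" if "z \<in> {0}" for z
      using that by (auto simp: M_def intro: tendsto_within_subset)
  qed auto
  have nz: "M u \<noteq> 0" if u: "u \<in> ball 0 1" for u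
  proof
    assume "M u = 0"
    hence "u \<noteq> 0" "exp (u / 2) = exp (- u / 2)" by (auto simp: M_def s_def split: if_splits)
    hence "exp (u / 2) * exp (u / 2) = exp (u / 2) * exp (- (u / 2))" by simp
    hence "exp (u / 2) * exp (u / 2) = 1" by (simp add: exp_minus)
    hence "exp u = 1" by (simp flip: exp_add)
    then obtain n :: int where "Re u = 0" "Im u = of_int (2 * n) * pi" unfolding exp_eq_1 by auto
    with \<open>u \<noteq> 0\<close> have "n \<noteq> 0" by (auto simp: complex_eq_iff)
    hence "1 \<le> \<bar>real_of_int n\<bar>" by linarith
    hence "\<bar>Im u\<bar> \<ge> 2 * pi" using \<open>Im u = _\<close> by (simp add: abs_mult)
    moreover have "\<bar>Im u\<bar> < 1" using u abs_Im_le_cmod[of u] by simp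
    ultimately show False using pi_gt3 by linarith
  qed
  obtain g where g: "g holomorphic_on ball 0 1" "\<And>x. x \<in> ball 0 1 \<Longrightarrow> exp (g x) = M x"
    by (rule holomorphic_logarithm_exists[OF convex_ball open_ball M nz, of 0]) auto
  define \<nu> where "\<nu> = (\<lambda>u. g 0 - g u)"
  have "\<nu> holomorphic_on ball 0 1" unfolding \<nu>_def using g(1) by (intro holomorphic_intros)
  moreover have "exp (\<nu> u) * s u = u" if "u \<in> ball 0 1" for u
  proof -
    have "exp (\<nu> u) = 1 / M u" using g(2)[of 0] g(2)[OF that] by (simp add: \<nu>_def exp_diff M_def)
    thus ?thesis using nz[OF that] by (cases "u = 0") (auto simp: M_def s_def)
  qed
  ultimately show ?thesis by (intro exI[of _ \<nu>]) (auto simp: \<nu>_def s_def)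
qed

definition sinh_log :: "complex \<Rightarrow> complex" where
  "sinh_log = (SOME \<nu>. \<nu> holomorphic_on ball 0 1 \<and> \<nu> 0 = 0 \<and>
     (\<forall>u\<in>ball 0 1. exp (\<nu> u) * (exp (u / 2) - exp (- u / 2)) = u))"

lemma holomorphic_sinh_log: "sinh_log holomorphic_on ball 0 1"
  and sinh_log_0: "sinh_log 0 = 0"
  and exp_sinh_log: "u \<in> ball 0 1 \<Longrightarrow> exp (sinh_log u) * (exp (u / 2) - exp (- u / 2)) = u"
  using someI_ex[OF sinh_log_exists] unfolding sinh_log_def by blast+

text \<open>
  This is the constant term of \<open>\<chi>\<^sub>2 = - E\<^sub>2 / 24\<close>. It comes from the coefficients of \<open>u\<^sup>2\<close> and \<open>u\<^sup>3\<close> in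
  \<open>exp (sinh_log u) * 2 sinh (u / 2) = u\<close>.
\<close>

lemma second_deriv_sinh_log: "(deriv ^^ 2) sinh_log 0 / 2 = - 1 / 24"
proof -
  define F where "F = fps_expansion sinh_log 0"
  have F: "sinh_log has_fps_expansion F" unfolding F_def
    by (rule has_fps_expansion_fps_expansion[OF _ _ holomorphic_sinh_log]) auto
  have F0: "fps_nth F 0 = 0" using fps_nth_fps_expansion[OF F, of 0] by (simp add: sinh_log_0)
  define G where "G = fps_compose (fps_exp 1) F"
  have G: "(\<lambda>u. exp (sinh_log u)) has_fps_expansion G"
    using has_fps_expansion_compose[OF has_fps_expansion_exp1 F F0] by (simp add: G_def o_def)
  define E where "E = fps_exp (1 / 2) - fps_exp (- 1 / 2 :: complex)"
  have "(\<lambda>u. exp (1 / 2 * u) - exp (- 1 / 2 * u)) has_fps_expansion E"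
    unfolding E_def by (intro fps_expansion_intros)
  hence "(\<lambda>u. exp (sinh_log u) * (exp (1 / 2 * u) - exp (- 1 / 2 * u))) has_fps_expansion G * E"
    by (intro fps_expansion_intros G)
  also have "?this \<longleftrightarrow> (\<lambda>u. u) has_fps_expansion G * E"
  proof (rule has_fps_expansion_cong)
    show "\<forall>\<^sub>F u in nhds 0. exp (sinh_log u) * (exp (1 / 2 * u) - exp (- 1 / 2 * u)) = u"
      using eventually_nhds_in_open[of "ball 0 1" "0 :: complex"]
      by (auto elim!: eventually_mono simp: exp_sinh_log[simplified])
  qed auto
  finally have GE: "G * E = fps_X"
    using fps_expansion_unique_complex has_fps_expansion_fps_X by blast
  have E: "fps_nth E 0 = 0" "fps_nth E 1 = 1" "fps_nth E 2 = 0" "fps_nth E 3 = 1 / 24"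
    by (simp_all add: E_def power2_eq_square power3_eq_cube fact_numeral)
  have G0: "fps_nth G 0 = 1" by (simp add: G_def)
  have "fps_nth (G * E) 2 = 0" "fps_nth (G * E) 3 = 0" by (simp_all add: GE)
  hence G1: "fps_nth G 1 = 0" and "fps_nth E 3 + fps_nth G 2 = 0"
    using E G0 by (simp_all add: fps_mult_nth numeral_2_eq_2 numeral_3_eq_3)
  hence "fps_nth G 2 = - 1 / 24"
    unfolding E(4) by (simp add: eq_neg_iff_add_eq_0 add.commute)
  note G12 = G1 this
  have "fps_deriv G = G * fps_deriv F"
    unfolding G_def by (subst fps_compose_deriv) (simp_all add: F0)
  hence "fps_nth (fps_deriv G) 1 = fps_nth (G * fps_deriv F) 1" by simp
  hence "2 * fps_nth G 2 = 2 * fps_nth F 2"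
    using G0 G12 by (simp add: fps_mult_nth numeral_2_eq_2)
  hence "fps_nth G 2 = fps_nth F 2" by simp
  hence "fps_nth F 2 = - 1 / 24" using G12(2) by (rule trans[OF sym])
  thus ?thesis using fps_nth_fps_expansion[OF F, of 2] by (simp add: numeral_2_eq_2)
qed

text \<open>
  The function \<open>\<chi>\<close> with \<open>\<Theta> = - u exp (- \<chi>)\<close> near \<open>u = 0\<close>.
\<close>

definition theta_log :: "complex \<Rightarrow> complex \<Rightarrow> complex" where
  "theta_log u \<tau> = sinh_log u + theta_log_series u (e2pi \<tau>)"

definition theta_log_nth :: "nat \<Rightarrow> complex \<Rightarrow> complex" where
  "theta_log_nth j \<tau> = (if j = 0 then 0
     else ((deriv ^^ j) sinh_log 0 + theta_log_coeff j (e2pi \<tau>)) / fact j)"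

definition theta_log_fps :: "complex \<Rightarrow> complex fps" where
  "theta_log_fps \<tau> = Abs_fps (\<lambda>j. theta_log_nth j \<tau>)"

text \<open>
  The double series converges for \<open>\<bar>u\<bar> < 2 \<pi> Im \<tau>\<close>, with uniform bounds on smaller discs; the bound
  \<open>1\<close> keeps the disc inside the domain of \<open>sinh_log\<close>.
\<close>

definition theta_log_radius :: "complex \<Rightarrow> real" where
  "theta_log_radius \<tau> = min 1 (pi * Im \<tau>)"

lemma theta_log_radius:
  assumes "\<tau> \<in> upper_half_plane"
  shows "theta_log_radius \<tau> > 0" "theta_log_radius \<tau> \<le> 1"
    "exp (theta_log_radius \<tau>) * norm (e2pi \<tau>) < 1"
proof -
  have t: "0 < pi * Im \<tau>" using assms by (simp add: upper_half_plane_def)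
  thus "theta_log_radius \<tau> > 0" "theta_log_radius \<tau> \<le> 1" by (auto simp: theta_log_radius_def)
  have "exp (theta_log_radius \<tau>) * norm (e2pi \<tau>) = exp (theta_log_radius \<tau> - 2 * pi * Im \<tau>)"
    by (simp add: norm_e2pi exp_diff exp_minus divide_inverse)
  also have "\<dots> < 1" using t by (auto simp: theta_log_radius_def)
  finally show "exp (theta_log_radius \<tau>) * norm (e2pi \<tau>) < 1" .
qed

lemma holomorphic_theta_log:
  assumes \<tau>: "\<tau> \<in> upper_half_plane"
  shows "(\<lambda>u. theta_log u \<tau>) holomorphic_on ball 0 (theta_log_radius \<tau>)"
  unfolding theta_log_def
  using theta_log_radius[OF \<tau>] norm_e2pi_less_1[OF \<tau>]
  by (intro holomorphic_intros holomorphic_theta_log_series holomorphic_on_subset[OF holomorphic_sinh_log]) auto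

lemma theta_log_0 [simp]: "theta_log 0 \<tau> = 0"
  by (simp add: theta_log_def sinh_log_0 theta_log_series_def theta_log_term_def case_prod_unfold)

lemma has_fps_expansion_theta_log:
  assumes \<tau>: "\<tau> \<in> upper_half_plane"
  shows "(\<lambda>u. theta_log u \<tau>) has_fps_expansion theta_log_fps \<tau>"
proof -
  let ?B = "ball 0 (theta_log_radius \<tau>) :: complex set"
  note r = theta_log_radius[OF \<tau>] and q = norm_e2pi_less_1[OF \<tau>]
  have hS: "(\<lambda>u. theta_log_series u (e2pi \<tau>)) holomorphic_on ?B"
    using r q by (intro holomorphic_theta_log_series) auto
  have hN: "sinh_log holomorphic_on ?B"
    using r by (intro holomorphic_on_subset[OF holomorphic_sinh_log]) auto
  have "(\<lambda>u. theta_log u \<tau>) has_fps_expansion fps_expansion (\<lambda>u. theta_log u \<tau>) 0"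
    by (rule has_fps_expansion_fps_expansion[OF _ _ holomorphic_theta_log[OF \<tau>]]) (use r in auto)
  also have "fps_expansion (\<lambda>u. theta_log u \<tau>) 0 = theta_log_fps \<tau>"
  proof (rule fps_ext)
    fix j
    show "fps_nth (fps_expansion (\<lambda>u. theta_log u \<tau>) 0) j = fps_nth (theta_log_fps \<tau>) j"
    proof (cases "j = 0")
      case False
      have "(deriv ^^ j) (\<lambda>u. theta_log u \<tau>) 0 =
         (deriv ^^ j) sinh_log 0 + (deriv ^^ j) (\<lambda>u. theta_log_series u (e2pi \<tau>)) 0"
        unfolding theta_log_def using r by (intro higher_deriv_add[OF hN hS]) auto
      also have "(deriv ^^ j) (\<lambda>u. theta_log_series u (e2pi \<tau>)) 0 = theta_log_coeff j (e2pi \<tau>)"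
        using False r q by (intro higher_deriv_theta_log_series) auto
      finally show ?thesis using False by (simp add: fps_expansion_def theta_log_fps_def theta_log_nth_def)
    qed (simp add: fps_expansion_def theta_log_fps_def theta_log_nth_def)
  qed
  finally show ?thesis .
qed

lemma e2pi_over: "e2pi (u / (2 * of_real pi * \<i>)) = exp u"
  by (simp add: e2pi_def)

lemma crank_theta_eq_exp:
  assumes \<tau>: "\<tau> \<in> upper_half_plane" and u: "u \<in> ball 0 (theta_log_radius \<tau>)"
  shows "crank_theta (u / (2 * of_real pi * \<i>)) \<tau> = - u * exp (- theta_log u \<tau>)"
proof -
  note r = theta_log_radius[OF \<tau>] and q = norm_e2pi_less_1[OF \<tau>]
  have "exp (norm u) * norm (e2pi \<tau>) \<le> exp (theta_log_radius \<tau>) * norm (e2pi \<tau>)"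
    using u by (intro mult_right_mono) auto
  hence "exp (norm u) * norm (e2pi \<tau>) < 1" using r(3) by (rule order.strict_trans1)
  note E = euler_prod_eq_exp_series[OF q e2pi_nonzero this]
  have h: "e2pi (u / (2 * of_real pi * \<i>) / 2) = exp (u / 2)" "e2pi (- (u / (2 * of_real pi * \<i>)) / 2) = exp (- u / 2)"
    "e2pi (- (u / (2 * of_real pi * \<i>))) = exp (- u)"
    using e2pi_over[of "u / 2"] e2pi_over[of "- u / 2"] e2pi_over[of "- u"] by (simp_all add: mult_ac)
  have "crank_theta (u / (2 * of_real pi * \<i>)) \<tau> =
      (exp (- u / 2) - exp (u / 2)) * (euler_prod (exp u) (e2pi \<tau>) * euler_prod (exp (- u)) (e2pi \<tau>) / euler_prod 1 (e2pi \<tau>) ^ 2)"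
    unfolding crank_theta_def h e2pi_over by simp
  also have "\<dots> = - (exp (u / 2) - exp (- u / 2)) * exp (- theta_log_series u (e2pi \<tau>))"
    unfolding E by simp
  also have "exp (u / 2) - exp (- u / 2) = u * exp (- sinh_log u)"
    using exp_sinh_log[of u] u r by (simp add: exp_minus field_simps)
  finally show ?thesis by (simp add: theta_log_def exp_diff exp_minus field_simps)
qed

text \<open>
  By \<open>crank_theta_moebius\<close> the exponentials of both sides agree for small \<open>u \<noteq> 0\<close>. The difference \<open>D\<close>
  of the two sides is thus a multiple of \<open>2 \<pi> \<i>\<close>, and it is small because both logarithms vanish at
  \<open>0\<close>.
\<close>

lemma theta_log_moebius:
  fixes a b c d :: int
  assumes det: "a * d - b * c = 1" and \<tau>: "\<tau> \<in> upper_half_plane"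
  defines "J \<equiv> of_int c * \<tau> + of_int d"
  shows "\<forall>\<^sub>F u in nhds 0. theta_log (u / J) (moebius a b c d \<tau>) = theta_log u \<tau> - of_int c * u\<^sup>2 / (4 * of_real pi * \<i> * J)"
proof -
  define t where "t = moebius a b c d \<tau>"
  have t: "t \<in> upper_half_plane" unfolding t_def using det \<tau> by (rule moebius_in_upper_half_plane)
  have J: "J \<noteq> 0" unfolding J_def using det \<tau> by (rule moebius_denom_nonzero)
  define D where "D = (\<lambda>u. theta_log (u / J) t - (theta_log u \<tau> - of_int c * u\<^sup>2 / (4 * of_real pi * \<i> * J)))"
  have lim0: "((\<lambda>u. u / J) \<longlongrightarrow> 0) (nhds 0)"
    using J by (auto intro!: tendsto_eq_intros filterlim_ident)
  have l: "((\<lambda>u. theta_log u \<tau>) \<longlongrightarrow> 0) (nhds 0)" if "\<tau> \<in> upper_half_plane" for \<tau>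
  proof -
    have "continuous_on (ball 0 (theta_log_radius \<tau>)) (\<lambda>u. theta_log u \<tau>)"
      by (intro holomorphic_on_imp_continuous_on holomorphic_theta_log that)
    hence "isCont (\<lambda>u. theta_log u \<tau>) 0"
      using theta_log_radius[OF that] by (auto simp: continuous_on_eq_continuous_at)
    thus ?thesis by (simp add: continuous_at_imp_continuous_within isCont_def tendsto_nhds_iff)
  qed
  have "(D \<longlongrightarrow> 0 - (0 - of_int c * 0\<^sup>2 / (4 * of_real pi * \<i> * J))) (nhds 0)"
    unfolding D_def
    by (intro tendsto_intros l[OF \<tau>] filterlim_compose[OF l[OF t] lim0] filterlim_ident) (use J in auto)
  hence "(D \<longlongrightarrow> 0) (nhds 0)" by simp
  hence small: "\<forall>\<^sub>F u in nhds 0. norm (D u) < 1"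
    using tendstoD[of D 0 "nhds 0" 1] by simp
  have ev: "\<forall>\<^sub>F u in nhds 0. u \<in> ball 0 (theta_log_radius \<tau>)" "\<forall>\<^sub>F u in nhds 0. u / J \<in> ball 0 (theta_log_radius t)"
    "\<forall>\<^sub>F u in nhds 0. u / (2 * of_real pi * \<i>) \<notin> period_lattice \<tau> \<or> u = 0"
  proof -
    show "\<forall>\<^sub>F u in nhds 0. u \<in> ball 0 (theta_log_radius \<tau>)"
      using theta_log_radius[OF \<tau>] by (intro eventually_nhds_in_open) auto
    have "\<forall>\<^sub>F u in nhds 0. u \<in> ball 0 (theta_log_radius t)"
      using theta_log_radius[OF t] by (intro eventually_nhds_in_open) auto
    thus "\<forall>\<^sub>F u in nhds 0. u / J \<in> ball 0 (theta_log_radius t)"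
      using lim0 unfolding filterlim_iff by blast
    have "\<forall>\<^sub>F z in nhds 0. z \<notin> period_lattice \<tau> \<or> z = 0"
      using eventually_not_period_lattice[OF \<tau>, of 0] by (auto simp: eventually_at_filter elim!: eventually_mono)
    moreover have "((\<lambda>u::complex. u / (2 * of_real pi * \<i>)) \<longlongrightarrow> 0) (nhds 0)"
      by (auto intro!: tendsto_eq_intros filterlim_ident)
    ultimately have "\<forall>\<^sub>F u in nhds 0. u / (2 * of_real pi * \<i>) \<notin> period_lattice \<tau> \<or> u / (2 * of_real pi * \<i>) = 0"
      unfolding filterlim_iff by blast
    thus "\<forall>\<^sub>F u in nhds 0. u / (2 * of_real pi * \<i>) \<notin> period_lattice \<tau> \<or> u = 0" by simp
  qed
  show ?thesis
    using small ev
  proof eventually_elim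
    case (elim u)
    show ?case
    proof (cases "u = 0")
      case False
      let ?z = "u / (2 * of_real pi * \<i>)"
      have z: "?z \<notin> period_lattice \<tau>" using elim False by auto
      have "J * e2pi (- of_int c * ?z\<^sup>2 / (2 * J)) * crank_theta (?z / J) t = crank_theta ?z \<tau>"
        using crank_theta_moebius[OF det \<tau> z] by (simp add: J_def t_def)
      also have "?z / J = (u / J) / (2 * of_real pi * \<i>)" by simp
      also have "crank_theta ((u / J) / (2 * of_real pi * \<i>)) t = - (u / J) * exp (- theta_log (u / J) t)"
        by (rule crank_theta_eq_exp[OF t elim(3)])
      also have "crank_theta ?z \<tau> = - u * exp (- theta_log u \<tau>)"
        by (rule crank_theta_eq_exp[OF \<tau> elim(2)])
      also have "e2pi (- of_int c * ?z\<^sup>2 / (2 * J)) = exp (- (of_int c * u\<^sup>2 / (4 * of_real pi * \<i> * J)))"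
        unfolding e2pi_def by (rule arg_cong[of _ _ exp]) (use J in \<open>simp add: field_simps power2_eq_square\<close>)
      finally have "exp (- (of_int c * u\<^sup>2 / (4 * of_real pi * \<i> * J))) * exp (- theta_log (u / J) t) = exp (- theta_log u \<tau>)"
        using J False by simp
      hence "exp (- (of_int c * u\<^sup>2 / (4 * of_real pi * \<i> * J)) + - theta_log (u / J) t - - theta_log u \<tau>) = 1"
        by (simp only: exp_add exp_diff) simp
      also have "- (of_int c * u\<^sup>2 / (4 * of_real pi * \<i> * J)) + - theta_log (u / J) t - - theta_log u \<tau> = - D u"
        by (simp add: D_def)
      finally have "exp (- D u) = 1" .
      then obtain n :: int where n: "Re (- D u) = 0" "Im (- D u) = of_int (2 * n) * pi"
        unfolding exp_eq_1 by blast
      have "\<bar>Im (- D u)\<bar> < 1" using elim(1) abs_Im_le_cmod[of "- D u"] by simp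
      have "n = 0"
      proof (rule ccontr)
        assume "n \<noteq> 0"
        hence "1 \<le> \<bar>real_of_int n\<bar>" by linarith
        hence "\<bar>Im (- D u)\<bar> \<ge> 2 * pi" unfolding n(2) by (simp add: abs_mult)
        with \<open>\<bar>Im (- D u)\<bar> < 1\<close> show False using pi_gt3 by linarith
      qed
      with n have "D u = 0" by (simp add: complex_eq_iff)
      thus ?thesis by (simp add: D_def t_def)
    qed simp
  qed
qed

text \<open>
  Comparison of Taylor coefficients: the quadratic term of \<open>theta_log_moebius\<close> affects \<open>j = 2\<close> only,
  so all other coefficients are modular.
\<close>

lemma theta_log_nth_moebius:
  fixes a b c d :: int
  assumes det: "a * d - b * c = 1" and \<tau>: "\<tau> \<in> upper_half_plane"
  defines "J \<equiv> of_int c * \<tau> + of_int d"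
  shows "theta_log_nth j (moebius a b c d \<tau>) =
    J ^ j * (theta_log_nth j \<tau> - (if j = 2 then of_int c / (4 * of_real pi * \<i> * J) else 0))"
proof -
  define t where "t = moebius a b c d \<tau>"
  have t: "t \<in> upper_half_plane" unfolding t_def using det \<tau> by (rule moebius_in_upper_half_plane)
  have J: "J \<noteq> 0" unfolding J_def using det \<tau> by (rule moebius_denom_nonzero)
  define k where "k = of_int c / (4 * of_real pi * \<i> * J)"
  have "(\<lambda>u. (1 / J) * u) has_fps_expansion fps_const (1 / J) * fps_X"
    by (intro fps_expansion_intros)
  hence "(\<lambda>u. theta_log (u / J) t) has_fps_expansion fps_compose (theta_log_fps t) (fps_const (1 / J) * fps_X)"
    using has_fps_expansion_compose[OF has_fps_expansion_theta_log[OF t]] by (simp add: o_def)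
  also have "(\<lambda>u. theta_log (u / J) t) has_fps_expansion fps_compose (theta_log_fps t) (fps_const (1 / J) * fps_X) \<longleftrightarrow>
     (\<lambda>u. theta_log u \<tau> - k * u ^ 2) has_fps_expansion fps_compose (theta_log_fps t) (fps_const (1 / J) * fps_X)"
    by (rule has_fps_expansion_cong)
       (use theta_log_moebius[OF det \<tau>] in \<open>auto simp: t_def J_def k_def\<close>)
  finally have "fps_compose (theta_log_fps t) (fps_const (1 / J) * fps_X) = theta_log_fps \<tau> - fps_const k * fps_X ^ 2"
    by (rule fps_expansion_unique_complex) (intro fps_expansion_intros has_fps_expansion_theta_log \<tau>)
  hence "fps_nth (fps_compose (theta_log_fps t) (fps_const (1 / J) * fps_X)) j =
     fps_nth (theta_log_fps \<tau> - fps_const k * fps_X ^ 2) j" by simp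
  hence "(1 / J) ^ j * theta_log_nth j t = theta_log_nth j \<tau> - (if j = 2 then k else 0)"
    by (simp add: theta_log_fps_def fps_X_power_nth)
  hence "theta_log_nth j t = J ^ j * (theta_log_nth j \<tau> - (if j = 2 then k else 0))"
    using J by (simp add: field_simps)
  thus ?thesis by (simp add: t_def k_def)
qed

lemma theta_log_nth_2:
  "\<tau> \<in> upper_half_plane \<Longrightarrow> theta_log_nth 2 \<tau> = - eisenstein_E2 \<tau> / 24"
  using second_deriv_sinh_log by (simp add: theta_log_nth_def eisenstein_E2_eq add_divide_distrib diff_divide_distrib numeral_2_eq_2)



section \<open>Modular forms\<close>

text \<open>
  The condition at the cusp in \<open>modular_form\<close>. It implies holomorphy on the upper half plane and is
  inherited by sums, products and derivatives.
\<close>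

definition cusp_holomorphic :: "(complex \<Rightarrow> complex) \<Rightarrow> bool" where
  "cusp_holomorphic f \<longleftrightarrow> (\<exists>g. g holomorphic_on ball 0 1 \<and> (\<forall>\<tau>\<in>upper_half_plane. f \<tau> = g (e2pi \<tau>)))"

lemma cusp_holomorphicI:
  "g holomorphic_on ball 0 1 \<Longrightarrow> (\<And>\<tau>. \<tau> \<in> upper_half_plane \<Longrightarrow> f \<tau> = g (e2pi \<tau>)) \<Longrightarrow> cusp_holomorphic f"
  unfolding cusp_holomorphic_def by blast

lemma cusp_holomorphic_imp_holomorphic:
  assumes "cusp_holomorphic f"
  shows "f holomorphic_on upper_half_plane"
proof -
  obtain g where g: "g holomorphic_on ball 0 1" "\<And>\<tau>. \<tau> \<in> upper_half_plane \<Longrightarrow> f \<tau> = g (e2pi \<tau>)"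
    using assms unfolding cusp_holomorphic_def by blast
  have "(g \<circ> e2pi) holomorphic_on upper_half_plane"
    by (rule holomorphic_on_compose_gen[OF _ g(1)])
       (auto intro!: holomorphic_intros simp: norm_e2pi_less_1)
  thus ?thesis by (rule holomorphic_transform) (simp add: g)
qed

lemma cusp_holomorphic_const: "cusp_holomorphic (\<lambda>_. c)"
  by (rule cusp_holomorphicI[of "\<lambda>_. c"]) auto

lemma cusp_holomorphic_add:
  assumes "cusp_holomorphic f" "cusp_holomorphic g"
  shows "cusp_holomorphic (\<lambda>\<tau>. f \<tau> + g \<tau>)"
proof -
  obtain F G where "F holomorphic_on ball 0 1" "\<And>\<tau>. \<tau> \<in> upper_half_plane \<Longrightarrow> f \<tau> = F (e2pi \<tau>)"
    "G holomorphic_on ball 0 1" "\<And>\<tau>. \<tau> \<in> upper_half_plane \<Longrightarrow> g \<tau> = G (e2pi \<tau>)"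
    using assms unfolding cusp_holomorphic_def by blast
  thus ?thesis by (intro cusp_holomorphicI[of "\<lambda>q. F q + G q"] holomorphic_intros) auto
qed

lemma cusp_holomorphic_mult:
  assumes "cusp_holomorphic f" "cusp_holomorphic g"
  shows "cusp_holomorphic (\<lambda>\<tau>. f \<tau> * g \<tau>)"
proof -
  obtain F G where "F holomorphic_on ball 0 1" "\<And>\<tau>. \<tau> \<in> upper_half_plane \<Longrightarrow> f \<tau> = F (e2pi \<tau>)"
    "G holomorphic_on ball 0 1" "\<And>\<tau>. \<tau> \<in> upper_half_plane \<Longrightarrow> g \<tau> = G (e2pi \<tau>)"
    using assms unfolding cusp_holomorphic_def by blast
  thus ?thesis by (intro cusp_holomorphicI[of "\<lambda>q. F q * G q"] holomorphic_intros) auto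
qed

lemma cusp_holomorphic_diff:
  assumes "cusp_holomorphic f" "cusp_holomorphic g"
  shows "cusp_holomorphic (\<lambda>\<tau>. f \<tau> - g \<tau>)"
  using cusp_holomorphic_add[OF assms(1) cusp_holomorphic_mult[OF cusp_holomorphic_const[of "-1"] assms(2)]]
  by simp

text \<open>The derivation \<open>q d/dq\<close>, which preserves holomorphy at \<open>q = 0\<close>.\<close>

definition q_deriv :: "(complex \<Rightarrow> complex) \<Rightarrow> complex \<Rightarrow> complex" where
  "q_deriv f \<tau> = deriv f \<tau> / (2 * of_real pi * \<i>)"

lemma cusp_holomorphic_q_deriv:
  assumes "cusp_holomorphic f"
  shows "cusp_holomorphic (q_deriv f)"
proof -
  obtain g where g: "g holomorphic_on ball 0 1" "\<And>\<tau>. \<tau> \<in> upper_half_plane \<Longrightarrow> f \<tau> = g (e2pi \<tau>)"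
    using assms unfolding cusp_holomorphic_def by blast
  show ?thesis
  proof (rule cusp_holomorphicI[of "\<lambda>q. q * deriv g q"])
    show "(\<lambda>q. q * deriv g q) holomorphic_on ball 0 1"
      using g(1) by (intro holomorphic_intros) auto
    fix \<tau> assume \<tau>: "\<tau> \<in> upper_half_plane"
    have "deriv f \<tau> = deriv (\<lambda>\<tau>. g (e2pi \<tau>)) \<tau>"
    proof (rule deriv_cong_ev)
      show "\<forall>\<^sub>F x in nhds \<tau>. f x = g (e2pi x)"
        using eventually_nhds_in_open[OF open_upper_half_plane \<tau>] by eventually_elim (simp add: g)
    qed auto
    also have "\<dots> = deriv g (e2pi \<tau>) * (2 * of_real pi * \<i> * 1 * e2pi \<tau>)"
    proof (rule DERIV_imp_deriv, rule DERIV_chain2[of g])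
      show "(g has_field_derivative deriv g (e2pi \<tau>)) (at (e2pi \<tau>))"
        using g(1) norm_e2pi_less_1[OF \<tau>] by (intro holomorphic_derivI[of g "ball 0 1"]) auto
      show "(e2pi has_field_derivative 2 * of_real pi * \<i> * 1 * e2pi \<tau>) (at \<tau>)"
        by (rule derivative_intros)+
    qed
    also have "\<dots> = (e2pi \<tau> * deriv g (e2pi \<tau>)) * (2 * of_real pi * \<i>)" by simp
    finally show "q_deriv f \<tau> = e2pi \<tau> * deriv g (e2pi \<tau>)"
      unfolding q_deriv_def by (simp only:) simp
  qed
qed

lemma modular_form_iff:
  "modular_form k f \<longleftrightarrow> cusp_holomorphic f \<and>
     (\<forall>a b c d :: int. a * d - b * c = 1 \<longrightarrow> (\<forall>\<tau>\<in>upper_half_plane.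
        f (moebius a b c d \<tau>) = (of_int c * \<tau> + of_int d) powi k * f \<tau>))"
  using cusp_holomorphic_imp_holomorphic[of f]
  unfolding modular_form_def moebius_def cusp_holomorphic_def by blast

lemma modular_formI:
  assumes "cusp_holomorphic f"
    "\<And>a b c d :: int. \<And>\<tau>. a * d - b * c = 1 \<Longrightarrow> \<tau> \<in> upper_half_plane \<Longrightarrow>
        f (moebius a b c d \<tau>) = (of_int c * \<tau> + of_int d) ^ k * f \<tau>"
  shows "modular_form (int k) f"
  unfolding modular_form_iff using assms by simp

lemma modular_formD:
  "modular_form (int k) f \<Longrightarrow> a * d - b * c = 1 \<Longrightarrow> \<tau> \<in> upper_half_plane \<Longrightarrow>
     f (moebius a b c d \<tau>) = (of_int c * \<tau> + of_int d) ^ k * f \<tau>"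
  unfolding modular_form_iff by simp

lemma modular_form_imp_cusp_holomorphic: "modular_form k f \<Longrightarrow> cusp_holomorphic f"
  by (simp add: modular_form_iff)

lemma modular_form_const: "modular_form (int 0) (\<lambda>_. c)"
  by (rule modular_formI) (auto intro: cusp_holomorphic_const)

lemma modular_form_zero: "modular_form (int k) (\<lambda>_. 0)"
  by (rule modular_formI) (auto intro: cusp_holomorphic_const)

lemma modular_form_add:
  assumes "modular_form (int k) f" "modular_form (int k) g"
  shows "modular_form (int k) (\<lambda>\<tau>. f \<tau> + g \<tau>)"
  using modular_formD[OF assms(1)] modular_formD[OF assms(2)]
  by (intro modular_formI cusp_holomorphic_add modular_form_imp_cusp_holomorphic[OF assms(1)]
        modular_form_imp_cusp_holomorphic[OF assms(2)]) (simp add: algebra_simps)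

lemma modular_form_mult:
  assumes "modular_form (int j) f" "modular_form (int k) g" "n = j + k"
  shows "modular_form (int n) (\<lambda>\<tau>. f \<tau> * g \<tau>)"
  unfolding \<open>n = _\<close>
  using modular_formD[OF assms(1)] modular_formD[OF assms(2)]
  by (intro modular_formI cusp_holomorphic_mult modular_form_imp_cusp_holomorphic[OF assms(1)]
        modular_form_imp_cusp_holomorphic[OF assms(2)]) (simp add: power_add)

lemma modular_form_cmult:
  "modular_form (int k) f \<Longrightarrow> modular_form (int k) (\<lambda>\<tau>. c * f \<tau>)"
  by (rule modular_form_mult[OF modular_form_const]) auto

lemma modular_form_diff:
  assumes "modular_form (int k) f" "modular_form (int k) g"
  shows "modular_form (int k) (\<lambda>\<tau>. f \<tau> - g \<tau>)"
  using modular_form_add[OF assms(1) modular_form_cmult[OF assms(2), of "-1"]] by simp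

lemma modular_form_sum:
  "(\<And>x. x \<in> A \<Longrightarrow> modular_form (int k) (f x)) \<Longrightarrow> modular_form (int k) (\<lambda>\<tau>. \<Sum>x\<in>A. f x \<tau>)"
  by (induction A rule: infinite_finite_induct) (auto intro: modular_form_add modular_form_zero)

text \<open>
  The matrix \<open>- 1\<close> acts trivially on \<open>\<tau>\<close> but multiplies a form of odd weight by \<open>- 1\<close>.
\<close>

lemma modular_form_odd:
  assumes "modular_form (int k) f" "odd k" "\<tau> \<in> upper_half_plane"
  shows "f \<tau> = 0"
  using modular_formD[OF assms(1), of "-1" "-1" 0 0 \<tau>] assms by (simp add: moebius_def)

text \<open>
  The chain rule with the derivative \<open>1 / J\<^sup>2\<close> of the Moebius map. The transformation law enters as an
  arbitrary \<open>F\<close>, since the lemma is applied to modular forms and to \<open>E\<^sub>2\<close>.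
\<close>

lemma q_deriv_moebius:
  fixes a b c d :: int
  assumes det: "a * d - b * c = 1" and \<tau>: "\<tau> \<in> upper_half_plane"
    and f: "f holomorphic_on upper_half_plane"
    and F: "\<And>t. t \<in> upper_half_plane \<Longrightarrow> f (moebius a b c d t) = F t"
    and F': "(F has_field_derivative F') (at \<tau>)"
  shows "q_deriv f (moebius a b c d \<tau>) = (of_int c * \<tau> + of_int d)\<^sup>2 * F' / (2 * of_real pi * \<i>)"
proof -
  define J where "J = of_int c * \<tau> + of_int d"
  have J: "J \<noteq> 0" unfolding J_def using det \<tau> by (rule moebius_denom_nonzero)
  have "(moebius a b c d has_field_derivative (of_int a * J - (of_int a * \<tau> + of_int b) * of_int c) / (J * J)) (at \<tau>)"
    unfolding moebius_def[abs_def] J_def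
    by (rule derivative_eq_intros refl | use J in \<open>simp add: J_def\<close>)+
  also have "of_int a * J - (of_int a * \<tau> + of_int b) * of_int c = of_int (a * d - b * c)"
    by (simp add: J_def algebra_simps)
  finally have "(moebius a b c d has_field_derivative 1 / J\<^sup>2) (at \<tau>)"
    by (simp add: det power2_eq_square)
  moreover have "(f has_field_derivative deriv f (moebius a b c d \<tau>)) (at (moebius a b c d \<tau>))"
    using holomorphic_derivI[OF f open_upper_half_plane moebius_in_upper_half_plane[OF det \<tau>]] .
  ultimately have "((\<lambda>t. f (moebius a b c d t)) has_field_derivative deriv f (moebius a b c d \<tau>) * (1 / J\<^sup>2)) (at \<tau>)"
    using DERIV_chain2 by blast
  moreover have "((\<lambda>t. f (moebius a b c d t)) has_field_derivative F') (at \<tau>)"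
    using F' by (rule has_field_derivative_transform_within_open[OF _ open_upper_half_plane \<tau>]) (simp add: F)
  ultimately have "deriv f (moebius a b c d \<tau>) * (1 / J\<^sup>2) = F'" by (rule DERIV_unique)
  hence "deriv f (moebius a b c d \<tau>) = J\<^sup>2 * F'" using J by (simp add: field_simps)
  thus ?thesis by (simp add: q_deriv_def J_def)
qed

lemma cusp_holomorphic_E2: "cusp_holomorphic eisenstein_E2"
  by (rule cusp_holomorphicI[of "\<lambda>q. 1 - 12 * theta_log_coeff 2 q"])
     (auto intro!: holomorphic_intros holomorphic_theta_log_coeff simp: eisenstein_E2_eq)

lemma cusp_holomorphic_theta_log_nth: "cusp_holomorphic (theta_log_nth j)"
proof (rule cusp_holomorphicI)
  show "(\<lambda>q. if j = 0 then 0 else ((deriv ^^ j) sinh_log 0 + theta_log_coeff j q) / fact j) holomorphic_on ball 0 1"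
    by (cases "j = 0") (auto intro!: holomorphic_intros holomorphic_theta_log_coeff)
qed (simp add: theta_log_nth_def)

lemma modular_form_theta_log_nth: "j \<noteq> 2 \<Longrightarrow> modular_form (int j) (theta_log_nth j)"
  by (rule modular_formI[OF cusp_holomorphic_theta_log_nth]) (simp add: theta_log_nth_moebius)

text \<open>
  The law of the second Taylor coefficient \<open>\<chi>\<^sub>2 = - E\<^sub>2 / 24\<close>.
\<close>

lemma eisenstein_E2_moebius:
  fixes a b c d :: int
  assumes det: "a * d - b * c = 1" and \<tau>: "\<tau> \<in> upper_half_plane"
  defines "J \<equiv> of_int c * \<tau> + of_int d"
  shows "eisenstein_E2 (moebius a b c d \<tau>) = J\<^sup>2 * eisenstein_E2 \<tau> + 6 * of_int c / (of_real pi * \<i>) * J"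
proof -
  have J: "J \<noteq> 0" unfolding J_def using det \<tau> by (rule moebius_denom_nonzero)
  have E: "eisenstein_E2 t = - 24 * theta_log_nth 2 t" if "t \<in> upper_half_plane" for t
    using theta_log_nth_2[OF that] by simp
  have "J\<^sup>2 * (x - k / (4 * p * J)) * (- 24) = J\<^sup>2 * (- 24 * x) + 6 * k / p * J" if "p \<noteq> 0" for x k p :: complex
    using J that by (simp add: field_simps power2_eq_square)
  from this[of "of_real pi * \<i>" "theta_log_nth 2 \<tau>" "of_int c"] show ?thesis
    unfolding E[OF \<tau>] E[OF moebius_in_upper_half_plane[OF det \<tau>]] theta_log_nth_moebius[OF det \<tau>] J_def[symmetric]
    by (simp add: mult_ac)
qed

text \<open>
  Differentiating the weight factor produces \<open>k c J\<^bsup>k+1\<^esup> / (2 \<pi> \<i>)\<close>, which the inhomogeneous term of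
  \<open>E\<^sub>2\<close> cancels.
\<close>

lemma modular_form_serre_derivative:
  assumes f: "modular_form (int k) f"
  shows "modular_form (int (k + 2)) (\<lambda>\<tau>. q_deriv f \<tau> - of_nat k / 12 * eisenstein_E2 \<tau> * f \<tau>)"
proof (rule modular_formI)
  note fc = modular_form_imp_cusp_holomorphic[OF f]
  show "cusp_holomorphic (\<lambda>\<tau>. q_deriv f \<tau> - of_nat k / 12 * eisenstein_E2 \<tau> * f \<tau>)"
    by (intro cusp_holomorphic_diff cusp_holomorphic_mult cusp_holomorphic_const cusp_holomorphic_q_deriv
         cusp_holomorphic_E2 fc)
  fix a b c d :: int and \<tau> assume det: "a * d - b * c = 1" and \<tau>: "\<tau> \<in> upper_half_plane"
  define J where "J = of_int c * \<tau> + of_int d"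
  note fh = cusp_holomorphic_imp_holomorphic[OF fc]
  have "((\<lambda>t. (of_int c * t + of_int d) ^ k * f t) has_field_derivative
          (of_nat k * of_int c * J ^ (k - 1)) * f \<tau> + J ^ k * deriv f \<tau>) (at \<tau>)"
    unfolding J_def
    by (rule derivative_eq_intros holomorphic_derivI[OF fh open_upper_half_plane \<tau>] refl | simp)+
  from q_deriv_moebius[OF det \<tau> fh modular_formD[OF f det] this]
  have 1: "q_deriv f (moebius a b c d \<tau>) =
       J\<^sup>2 * (of_nat k * of_int c * J ^ (k - 1) * f \<tau> + J ^ k * deriv f \<tau>) / (2 * of_real pi * \<i>)"
    by (simp add: J_def)
  have 2: "J\<^sup>2 * (of_nat k * of_int c * J ^ (k - 1) * x + J ^ k * y) / (2 * p) -
     of_nat k / 12 * (J\<^sup>2 * e + 6 * of_int c / p * J) * (J ^ k * x) =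
     J ^ (k + 2) * (y / (2 * p) - of_nat k / 12 * e * x)" if "p \<noteq> 0" for x y e p :: complex
  proof (cases k)
    case (Suc j)
    show ?thesis using that unfolding Suc by (simp add: field_simps power2_eq_square)
  qed (use that in \<open>simp add: field_simps power2_eq_square\<close>)
  show "q_deriv f (moebius a b c d \<tau>) - of_nat k / 12 * eisenstein_E2 (moebius a b c d \<tau>) * f (moebius a b c d \<tau>) =
     (of_int c * \<tau> + of_int d) ^ (k + 2) * (q_deriv f \<tau> - of_nat k / 12 * eisenstein_E2 \<tau> * f \<tau>)"
    unfolding 1 eisenstein_E2_moebius[OF det \<tau>] modular_formD[OF f det \<tau>] J_def[symmetric]
    using 2[of "of_real pi * \<i>" "f \<tau>" "deriv f \<tau>" "eisenstein_E2 \<tau>"]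
    by (simp add: q_deriv_def mult.assoc)
qed

text \<open>By Ramanujan's identity this is the Eisenstein series of weight 4; its modularity follows directly
  from the transformation law of \<open>E\<^sub>2\<close>.\<close>

definition E2_defect :: "complex \<Rightarrow> complex" where
  "E2_defect \<tau> = eisenstein_E2 \<tau> ^ 2 - 12 * q_deriv eisenstein_E2 \<tau>"

lemma modular_form_E2_defect: "modular_form (int 4) E2_defect"
proof (rule modular_formI)
  show "cusp_holomorphic E2_defect" unfolding E2_defect_def[abs_def] power2_eq_square
    by (intro cusp_holomorphic_diff cusp_holomorphic_mult cusp_holomorphic_const cusp_holomorphic_q_deriv cusp_holomorphic_E2)
  fix a b c d :: int and \<tau> assume det: "a * d - b * c = 1" and \<tau>: "\<tau> \<in> upper_half_plane"
  define J where "J = of_int c * \<tau> + of_int d"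
  define k where "k = 6 * of_int c / (of_real pi * \<i>)"
  note Eh = cusp_holomorphic_imp_holomorphic[OF cusp_holomorphic_E2]
  have "((\<lambda>t. (of_int c * t + of_int d)\<^sup>2 * eisenstein_E2 t + k * (of_int c * t + of_int d)) has_field_derivative
          2 * J * of_int c * eisenstein_E2 \<tau> + J\<^sup>2 * deriv eisenstein_E2 \<tau> + k * of_int c) (at \<tau>)"
    unfolding J_def
    by (rule derivative_eq_intros holomorphic_derivI[OF Eh open_upper_half_plane \<tau>] refl | simp)+
  from q_deriv_moebius[OF det \<tau> Eh _ this]
  have 1: "q_deriv eisenstein_E2 (moebius a b c d \<tau>) =
       J\<^sup>2 * (2 * J * of_int c * eisenstein_E2 \<tau> + J\<^sup>2 * deriv eisenstein_E2 \<tau> + k * of_int c) / (2 * of_real pi * \<i>)"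
    using eisenstein_E2_moebius[OF det] by (simp add: J_def k_def)
  have 2: "(J\<^sup>2 * e + 6 * C / p * J)\<^sup>2 - 12 * (J\<^sup>2 * (2 * J * C * e + J\<^sup>2 * y + 6 * C / p * C) / (2 * p)) =
      J ^ 4 * (e\<^sup>2 - 12 * (y / (2 * p)))" if "p \<noteq> 0" for C e y p :: complex
    using that by (simp add: field_simps power2_eq_square power4_eq_xxxx)
  show "E2_defect (moebius a b c d \<tau>) = (of_int c * \<tau> + of_int d) ^ 4 * E2_defect \<tau>"
    unfolding E2_defect_def 1 eisenstein_E2_moebius[OF det \<tau>] J_def[symmetric]
    using 2[of "of_real pi * \<i>" "eisenstein_E2 \<tau>" "of_int c" "deriv eisenstein_E2 \<tau>"]
    by (simp add: q_deriv_def mult.assoc k_def)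
qed

section \<open>The Laurent coefficients of the power of the crank\<close>

text \<open>
  The logarithm \<open>l \<chi>\<close> without its only quasimodular coefficient, that of \<open>u\<^sup>2\<close>.
\<close>

definition reduced_log_fps :: "nat \<Rightarrow> complex \<Rightarrow> complex fps" where
  "reduced_log_fps l \<tau> = fps_const (of_nat l) * (theta_log_fps \<tau> - fps_const (theta_log_nth 2 \<tau>) * fps_X ^ 2)"

definition reduced_nth :: "nat \<Rightarrow> nat \<Rightarrow> complex \<Rightarrow> complex" where
  "reduced_nth l s \<tau> = fps_nth (fps_compose (fps_exp 1) (reduced_log_fps l \<tau>)) s"

lemma reduced_log_fps_nth:
  "fps_nth (reduced_log_fps l \<tau>) j = (if j = 2 then 0 else of_nat l * theta_log_nth j \<tau>)"
  by (simp add: reduced_log_fps_def theta_log_fps_def fps_X_power_nth)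

lemma theta_log_nth_0 [simp]: "theta_log_nth 0 \<tau> = 0"
  by (simp add: theta_log_nth_def)

lemma reduced_nth_0 [simp]: "reduced_nth l 0 \<tau> = 1"
  by (simp add: reduced_nth_def)

text \<open>
  The differential equation \<open>H' = H Y'\<close> of \<open>H = exp Y\<close>, read off coefficientwise.
\<close>

lemma reduced_nth_Suc:
  "reduced_nth l (Suc s) \<tau> = 1 / of_nat (Suc s) *
     (\<Sum>i=0..s. reduced_nth l i \<tau> * (of_nat (Suc (s - i)) * fps_nth (reduced_log_fps l \<tau>) (Suc (s - i))))"
proof -
  let ?Y = "reduced_log_fps l \<tau>" and ?H = "fps_compose (fps_exp 1) (reduced_log_fps l \<tau>)"
  have "fps_deriv ?H = ?H * fps_deriv ?Y"
    by (subst fps_compose_deriv) (simp_all add: reduced_log_fps_nth)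
  hence "fps_nth (fps_deriv ?H) s = fps_nth (?H * fps_deriv ?Y) s" by simp
  hence "of_nat (Suc s) * reduced_nth l (Suc s) \<tau> =
     (\<Sum>i=0..s. reduced_nth l i \<tau> * (of_nat (Suc (s - i)) * fps_nth ?Y (Suc (s - i))))"
    by (simp add: fps_mult_nth reduced_nth_def)
  thus ?thesis by (simp add: field_simps del: of_nat_Suc)
qed

text \<open>
  The recursion expresses each coefficient as a polynomial in the modular forms \<open>\<chi>\<^sub>j\<close>, isobaric of
  weight \<open>s\<close>.
\<close>

lemma modular_form_reduced_nth: "modular_form (int s) (reduced_nth l s)"
proof (induction s rule: less_induct)
  case (less s)
  show ?case
  proof (cases s)
    case 0
    have "reduced_nth l 0 = (\<lambda>_. 1)" by (rule ext) simp
    thus ?thesis using 0 modular_form_const[of 1] by simp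
  next
    case (Suc s')
    have Y: "modular_form (int j) (\<lambda>\<tau>. fps_nth (reduced_log_fps l \<tau>) j)" for j
      using modular_form_cmult[OF modular_form_theta_log_nth[of j]] modular_form_zero[of j]
      by (cases "j = 2") (simp_all add: reduced_log_fps_nth)
    have "modular_form (int s) (\<lambda>\<tau>. 1 / of_nat (Suc s') *
     (\<Sum>i=0..s'. reduced_nth l i \<tau> * (of_nat (Suc (s' - i)) * fps_nth (reduced_log_fps l \<tau>) (Suc (s' - i)))))"
      by (intro modular_form_cmult modular_form_sum modular_form_mult[OF less.IH modular_form_cmult[OF Y]]) (auto simp: Suc)
    thus ?thesis unfolding Suc reduced_nth_Suc[abs_def] .
  qed
qed

text \<open>
  The coefficient of \<open>u\<^bsup>2s\<^esup>\<close> in \<open>exp (- l E\<^sub>2 u\<^sup>2 / 24)\<close>.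
\<close>

definition E2_exp :: "nat \<Rightarrow> nat \<Rightarrow> complex \<Rightarrow> complex" where
  "E2_exp l s \<tau> = (- (of_nat l / 24) * eisenstein_E2 \<tau>) ^ s / fact s"

text \<open>
  The coefficient of \<open>u\<^sup>n\<close> in \<open>exp (l \<chi>)\<close>; then \<open>- exp (l \<chi>) / u\<^sup>l\<close> is the \<open>l\<close>-th power of \<open>\<eta>\<close> times the
  modified crank, for odd \<open>l\<close>.
\<close>

definition crank_nth :: "nat \<Rightarrow> nat \<Rightarrow> complex \<Rightarrow> complex" where
  "crank_nth l n \<tau> = fps_nth (fps_compose (fps_exp 1) (fps_const (of_nat l) * theta_log_fps \<tau>)) n"

lemma has_fps_expansion_crank:
  assumes "\<tau> \<in> upper_half_plane"
  shows "(\<lambda>u. exp (of_nat l * theta_log u \<tau>)) has_fps_expansion Abs_fps (\<lambda>n. crank_nth l n \<tau>)"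
proof -
  have "(\<lambda>u. exp (of_nat l * theta_log u \<tau>)) has_fps_expansion
      fps_compose (fps_exp 1) (fps_const (of_nat l) * theta_log_fps \<tau>)"
    using has_fps_expansion_compose[OF has_fps_expansion_exp1 has_fps_expansion_cmult_left[OF has_fps_expansion_theta_log[OF assms]]]
    by (simp add: o_def theta_log_fps_def)
  thus ?thesis by (simp add: crank_nth_def[abs_def] fps_nth_inverse)
qed

lemma exp_compose_square_nth:
  "fps_nth (fps_compose (fps_exp 1) (fps_const a * fps_X ^ 2)) n =
     (if even n then (a :: complex) ^ (n div 2) / fact (n div 2) else 0)"
proof -
  have p: "fps_nth ((fps_const a * fps_X ^ 2) ^ i) n = (if n = 2 * i then a ^ i else 0)" for i
    by (simp only: power_mult_distrib fps_const_power power_mult[symmetric] fps_mult_left_const_nth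
          fps_X_power_nth) simp
  have "fps_nth (fps_compose (fps_exp 1) (fps_const a * fps_X ^ 2)) n =
     (\<Sum>i=0..n. if n = 2 * i then a ^ i / fact i else 0)"
    unfolding fps_compose_nth p by (intro sum.cong refl) simp
  also have "\<dots> = (if even n then a ^ (n div 2) / fact (n div 2) else 0)"
  proof (cases "even n")
    case True
    then obtain j where n: "n = 2 * j" by auto
    have "(\<Sum>i=0..n. if n = 2 * i then a ^ i / fact i else 0) = (\<Sum>i=0..n. if i = j then a ^ i / fact i else 0)"
      by (intro sum.cong refl) (auto simp: n)
    thus ?thesis by (simp add: n)
  qed (auto intro!: sum.neutral)
  finally show ?thesis .
qed

text \<open>
  The factorisation of \<open>exp (l \<chi>)\<close> into \<open>exp (- l E\<^sub>2 u\<^sup>2 / 24)\<close> and a power series with modular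
  coefficients. Those of odd index have odd weight and vanish.
\<close>

lemma crank_nth_eq:
  assumes \<tau>: "\<tau> \<in> upper_half_plane"
  shows "crank_nth l (2 * r) \<tau> = (\<Sum>s\<le>r. E2_exp l s \<tau> * reduced_nth l (2 * (r - s)) \<tau>)"
    and "odd n \<Longrightarrow> crank_nth l n \<tau> = 0"
proof -
  define a where "a = of_nat l * theta_log_nth 2 \<tau>"
  have a: "a = - (of_nat l / 24) * eisenstein_E2 \<tau>" by (simp add: a_def theta_log_nth_2[OF \<tau>])
  let ?A = "fps_compose (fps_exp 1) (fps_const a * fps_X ^ 2)"
  let ?B = "fps_compose (fps_exp 1) (reduced_log_fps l \<tau>)"
  have "(\<lambda>u. a * u ^ 2) has_fps_expansion fps_const a * fps_X ^ 2"
    by (intro fps_expansion_intros)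
  hence A: "(\<lambda>u. exp (a * u ^ 2)) has_fps_expansion ?A"
    using has_fps_expansion_compose[OF has_fps_expansion_exp1] by (simp add: o_def fps_X_power_nth)
  have "(\<lambda>u. of_nat l * (theta_log u \<tau> - theta_log_nth 2 \<tau> * u ^ 2)) has_fps_expansion reduced_log_fps l \<tau>"
    unfolding reduced_log_fps_def by (intro fps_expansion_intros has_fps_expansion_theta_log \<tau>)
  hence B: "(\<lambda>u. exp (of_nat l * (theta_log u \<tau> - theta_log_nth 2 \<tau> * u ^ 2))) has_fps_expansion ?B"
    using has_fps_expansion_compose[OF has_fps_expansion_exp1] by (simp add: o_def reduced_log_fps_nth)
  have "(\<lambda>u. exp (a * u ^ 2) * exp (of_nat l * (theta_log u \<tau> - theta_log_nth 2 \<tau> * u ^ 2))) has_fps_expansion ?A * ?B"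
    by (intro has_fps_expansion_mult A B)
  also have "(\<lambda>u. exp (a * u ^ 2) * exp (of_nat l * (theta_log u \<tau> - theta_log_nth 2 \<tau> * u ^ 2))) =
      (\<lambda>u. exp (of_nat l * theta_log u \<tau>))"
    by (simp flip: exp_add) (simp add: a_def algebra_simps)
  finally have "Abs_fps (\<lambda>n. crank_nth l n \<tau>) = ?A * ?B"
    using has_fps_expansion_crank[OF \<tau>] fps_expansion_unique_complex by blast
  hence "fps_nth (Abs_fps (\<lambda>n. crank_nth l n \<tau>)) n = fps_nth (?A * ?B) n" for n by simp
  hence *: "crank_nth l n \<tau> = (\<Sum>i=0..n. (if even i then a ^ (i div 2) / fact (i div 2) else 0) * reduced_nth l (n - i) \<tau>)" for n
    by (simp add: fps_mult_nth exp_compose_square_nth reduced_nth_def)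
  show "crank_nth l n \<tau> = 0" if "odd n"
    unfolding * using that modular_form_odd[OF modular_form_reduced_nth _ \<tau>]
    by (intro sum.neutral) auto
  have "crank_nth l (2 * r) \<tau> = (\<Sum>i\<in>(\<lambda>s. 2 * s) ` {..r}. a ^ (i div 2) / fact (i div 2) * reduced_nth l (2 * r - i) \<tau>)"
    unfolding * by (rule sum.mono_neutral_cong_right) (auto elim!: evenE)
  also have "\<dots> = (\<Sum>s\<le>r. a ^ s / fact s * reduced_nth l (2 * r - 2 * s) \<tau>)"
    by (subst sum.reindex) (auto simp: inj_on_def)
  finally show "crank_nth l (2 * r) \<tau> = (\<Sum>s\<le>r. E2_exp l s \<tau> * reduced_nth l (2 * (r - s)) \<tau>)"
    by (simp add: E2_exp_def a diff_mult_distrib2)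
qed

section \<open>The coefficients of the iterated heat operator\<close>

text \<open>
  The coefficient of \<open>L\<^sup>i A\<^sub>l\<close> in \<open>\<H>\<^sup>k A\<^sub>l\<close>, where \<open>L = 2 l q \<partial>/\<partial>q + (w \<partial>/\<partial>w)\<^sup>2\<close> is the heat operator
  without its \<open>E\<^sub>2\<close> term. Since \<open>L\<^sup>i\<close> maps \<open>1 / u\<close> to \<open>(2 i)! / u\<^bsup>2i+1\<^esup>\<close>, the number
  \<open>(2 i)! * heat_coeff l k i \<tau>\<close> is, up to sign, the coefficient of \<open>u\<^bsup>-2i-1\<^esup>\<close> in \<open>\<H>\<^sup>k A\<^sub>l\<close>.
\<close>

primrec heat_coeff :: "nat \<Rightarrow> nat \<Rightarrow> nat \<Rightarrow> complex \<Rightarrow> complex" where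
  "heat_coeff l 0 = (\<lambda>i \<tau>. if i = 0 then 1 else 0)"
| "heat_coeff l (Suc k) = (\<lambda>i \<tau>. 2 * of_nat l * q_deriv (heat_coeff l k i) \<tau>
     + (if i = 0 then 0 else heat_coeff l k (i - 1) \<tau>)
     - of_nat l * (4 * of_nat k + 1) / 12 * eisenstein_E2 \<tau> * heat_coeff l k i \<tau>)"

text \<open>
  The coefficient of \<open>u\<^bsup>-2i-1\<^esup>\<close> after conjugation with \<open>exp (- l E\<^sub>2 u\<^sup>2 / 24)\<close>. The conjugated operator is
  the sum of \<open>2 l\<close> times the Serre derivative on weight \<open>2 k - 2 i\<close>, of \<open>\<partial>\<^sup>2 / \<partial>u\<^sup>2\<close>, which maps
  \<open>u\<^bsup>-2i+1\<^esup>\<close> to \<open>2 i (2 i - 1) u\<^bsup>-2i-1\<^esup>\<close>, and of multiplication by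
  \<open>l\<^sup>2 E\<^sub>4 u\<^sup>2 / 144\<close>. For \<open>i = 0\<close> the middle term is zero, whatever \<open>i - 1\<close> denotes.
\<close>

primrec modular_coeff :: "nat \<Rightarrow> nat \<Rightarrow> nat \<Rightarrow> complex \<Rightarrow> complex" where
  "modular_coeff l 0 = (\<lambda>i \<tau>. if i = 0 then 1 else 0)"
| "modular_coeff l (Suc k) = (\<lambda>i \<tau>.
       2 * of_nat l * (q_deriv (modular_coeff l k i) \<tau> - (2 * of_nat k - 2 * of_nat i) / 12 * eisenstein_E2 \<tau> * modular_coeff l k i \<tau>)
     + of_nat (2 * i) * (of_nat (2 * i) - 1) * modular_coeff l k (i - 1) \<tau>
     + of_nat l ^ 2 / 144 * E2_defect \<tau> * modular_coeff l k (i + 1) \<tau>)"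

lemma q_deriv_const [simp]: "q_deriv (\<lambda>_. c) \<tau> = 0"
  by (simp add: q_deriv_def)

lemma heat_coeff_eq_0: "i > k \<Longrightarrow> heat_coeff l k i = (\<lambda>_. 0)"
proof (induction k arbitrary: i)
  case (Suc k)
  have "heat_coeff l k i = (\<lambda>_. 0)" "heat_coeff l k (i - 1) = (\<lambda>_. 0)"
    using Suc.prems by (auto intro!: Suc.IH)
  thus ?case by (intro ext) simp
qed simp

lemma modular_coeff_eq_0: "i > k \<Longrightarrow> modular_coeff l k i = (\<lambda>_. 0)"
proof (induction k arbitrary: i)
  case (Suc k)
  have "modular_coeff l k i = (\<lambda>_. 0)" "modular_coeff l k (i - 1) = (\<lambda>_. 0)"
    "modular_coeff l k (i + 1) = (\<lambda>_. 0)"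
    using Suc.prems by (auto intro!: Suc.IH)
  thus ?case by simp
qed simp

lemma modular_coeff_diag: "modular_coeff l k k = (\<lambda>_. fact (2 * k))"
proof (induction k)
  case (Suc k)
  thus ?case by (auto simp: fun_eq_iff modular_coeff_eq_0 algebra_simps)
qed (simp add: fun_eq_iff)

lemma modular_form_modular_coeff: "i \<le> k \<Longrightarrow> modular_form (int (2 * (k - i))) (modular_coeff l k i)"
proof (induction k arbitrary: i)
  case 0
  thus ?case using modular_form_const[of 1] by simp
next
  case (Suc k)
  have 1: "modular_form (int (2 * (Suc k - i))) (\<lambda>\<tau>. q_deriv (modular_coeff l k i) \<tau> -
      (2 * of_nat k - 2 * of_nat i) / 12 * eisenstein_E2 \<tau> * modular_coeff l k i \<tau>)"
  proof (cases "i \<le> k")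
    case True
    have "2 * (Suc k - i) = 2 * (k - i) + 2" "(2 * of_nat k - 2 * of_nat i :: complex) = of_nat (2 * (k - i))"
      using True by (auto simp: of_nat_diff)
    thus ?thesis using modular_form_serre_derivative[OF Suc.IH[OF True]] by (simp only:)
  next
    case False
    thus ?thesis using modular_form_zero[of "2 * (Suc k - i)"] by (simp add: modular_coeff_eq_0)
  qed
  have 2: "modular_form (int (2 * (Suc k - i))) (\<lambda>\<tau>. of_nat (2 * i) * (of_nat (2 * i) - 1) * modular_coeff l k (i - 1) \<tau>)"
  proof (cases i)
    case 0
    thus ?thesis using modular_form_zero[of "2 * (Suc k - i)"] by simp
  next
    case (Suc j)
    have "2 * (Suc k - i) = 2 * (k - (i - 1))" using Suc by simp
    thus ?thesis using Suc \<open>i \<le> Suc k\<close> by (auto intro!: modular_form_cmult Suc.IH simp only:)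
  qed
  have 3: "modular_form (int (2 * (Suc k - i))) (\<lambda>\<tau>. of_nat l ^ 2 / 144 * E2_defect \<tau> * modular_coeff l k (i + 1) \<tau>)"
  proof (cases "i + 1 \<le> k")
    case True
    hence e: "2 * (Suc k - i) = 4 + 2 * (k - (i + 1))" by simp
    show ?thesis
      by (rule modular_form_mult[OF modular_form_cmult Suc.IH[OF True] e]) (use modular_form_E2_defect in simp)
  next
    case False
    thus ?thesis using modular_form_zero[of "2 * (Suc k - i)"] by (simp add: modular_coeff_eq_0)
  qed
  show ?case unfolding modular_coeff.simps
    by (intro modular_form_add modular_form_cmult 1 2 3)
qed

lemma holomorphic_modular_coeff: "modular_coeff l k i holomorphic_on upper_half_plane"
proof (cases "i \<le> k")
  case True
  thus ?thesis
    by (intro cusp_holomorphic_imp_holomorphic modular_form_imp_cusp_holomorphic[OF modular_form_modular_coeff])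
qed (simp add: modular_coeff_eq_0)

lemma holomorphic_eisenstein_E2: "eisenstein_E2 holomorphic_on upper_half_plane"
  by (rule cusp_holomorphic_imp_holomorphic[OF cusp_holomorphic_E2])

lemma holomorphic_E2_exp: "E2_exp l s holomorphic_on upper_half_plane"
  unfolding E2_exp_def[abs_def] by (intro holomorphic_intros holomorphic_eisenstein_E2) auto

lemma E2_exp_0 [simp]: "E2_exp l 0 \<tau> = 1"
  by (simp add: E2_exp_def)

lemma E2_exp_Suc: "E2_exp l (Suc s) \<tau> = - (of_nat l / 24) * eisenstein_E2 \<tau> * E2_exp l s \<tau> / of_nat (Suc s)"
  by (simp add: E2_exp_def)

lemma q_deriv_add:
  "f holomorphic_on upper_half_plane \<Longrightarrow> g holomorphic_on upper_half_plane \<Longrightarrow> \<tau> \<in> upper_half_plane \<Longrightarrow>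
    q_deriv (\<lambda>t. f t + g t) \<tau> = q_deriv f \<tau> + q_deriv g \<tau>"
  unfolding q_deriv_def
  by (subst deriv_add)
     (auto simp: add_divide_distrib intro!: holomorphic_on_imp_differentiable_at open_upper_half_plane)

lemma q_deriv_mult:
  "f holomorphic_on upper_half_plane \<Longrightarrow> g holomorphic_on upper_half_plane \<Longrightarrow> \<tau> \<in> upper_half_plane \<Longrightarrow>
    q_deriv (\<lambda>t. f t * g t) \<tau> = q_deriv f \<tau> * g \<tau> + f \<tau> * q_deriv g \<tau>"
  unfolding q_deriv_def
  by (subst deriv_mult)
     (auto simp: add_divide_distrib intro!: holomorphic_on_imp_differentiable_at open_upper_half_plane)

lemma q_deriv_cmult:
  "f holomorphic_on upper_half_plane \<Longrightarrow> \<tau> \<in> upper_half_plane \<Longrightarrow>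
    q_deriv (\<lambda>t. c * f t) \<tau> = c * q_deriv f \<tau>"
  using q_deriv_mult[of "\<lambda>_. c" f \<tau>] by simp

lemma q_deriv_sum:
  assumes "\<And>x. x \<in> A \<Longrightarrow> f x holomorphic_on upper_half_plane" "\<tau> \<in> upper_half_plane"
  shows "q_deriv (\<lambda>t. \<Sum>x\<in>A. f x t) \<tau> = (\<Sum>x\<in>A. q_deriv (f x) \<tau>)"
  using assms(1)
proof (induction A rule: infinite_finite_induct)
  case (insert x A)
  thus ?case using assms(2) by (simp add: q_deriv_add holomorphic_on_sum)
qed auto

lemma q_deriv_cong:
  assumes "\<And>t. t \<in> upper_half_plane \<Longrightarrow> f t = g t" "\<tau> \<in> upper_half_plane"
  shows "q_deriv f \<tau> = q_deriv g \<tau>"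
proof -
  have "deriv f \<tau> = deriv g \<tau>"
    using eventually_nhds_in_open[OF open_upper_half_plane assms(2)]
    by (intro deriv_cong_ev) (auto elim!: eventually_mono simp: assms(1))
  thus ?thesis by (simp add: q_deriv_def)
qed

lemma q_deriv_E2: "12 * q_deriv eisenstein_E2 \<tau> = eisenstein_E2 \<tau> ^ 2 - E2_defect \<tau>"
  by (simp add: E2_defect_def)

lemma q_deriv_E2_exp:
  assumes \<tau>: "\<tau> \<in> upper_half_plane"
  shows "q_deriv (E2_exp l s) \<tau> = (if s = 0 then 0 else - (of_nat l / 24) * q_deriv eisenstein_E2 \<tau> * E2_exp l (s - 1) \<tau>)"
proof (induction s)
  case 0
  have "E2_exp l 0 = (\<lambda>_. 1)" by (rule ext) simp
  thus ?case by simp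
next
  case (Suc s)
  define a where "a = - (of_nat l / 24 :: complex)"
  have E: "E2_exp l (Suc s) = (\<lambda>t. (a / of_nat (Suc s)) * (eisenstein_E2 t * E2_exp l s t))"
    by (rule ext) (simp add: E2_exp_Suc a_def del: of_nat_Suc)
  have "q_deriv (E2_exp l (Suc s)) \<tau> = (a / of_nat (Suc s)) *
     (q_deriv eisenstein_E2 \<tau> * E2_exp l s \<tau> + eisenstein_E2 \<tau> * q_deriv (E2_exp l s) \<tau>)"
    unfolding E using holomorphic_eisenstein_E2 holomorphic_E2_exp[of l s] \<tau>
    by (subst q_deriv_mult) (auto intro!: holomorphic_intros simp: q_deriv_mult)
  also have "\<dots> = a * q_deriv eisenstein_E2 \<tau> * E2_exp l s \<tau>"
  proof (cases s)
    case 0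
    moreover have "E2_exp l 0 = (\<lambda>_. 1)" by (rule ext) simp
    ultimately show ?thesis by simp
  next
    case (Suc t)
    have "eisenstein_E2 \<tau> * q_deriv (E2_exp l s) \<tau> = of_nat s * (q_deriv eisenstein_E2 \<tau> * E2_exp l s \<tau>)"
      using Suc.IH E2_exp_Suc[of l t \<tau>] unfolding Suc by (simp del: of_nat_Suc)
    hence "q_deriv eisenstein_E2 \<tau> * E2_exp l s \<tau> + eisenstein_E2 \<tau> * q_deriv (E2_exp l s) \<tau> =
        of_nat (Suc s) * (q_deriv eisenstein_E2 \<tau> * E2_exp l s \<tau>)" by (simp add: algebra_simps)
    thus ?thesis by (simp del: of_nat_Suc)
  qed
  finally show ?case by (simp add: a_def)
qed

text \<open>
  This is the conjugation by \<open>exp (a E\<^sub>2 u\<^sup>2)\<close> with \<open>a = - l / 24\<close> on the level of principal parts. The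
  value of \<open>a\<close> is forced: the coefficient of \<open>u\<^sup>2\<close> in the conjugated operator is
  \<open>4 a\<^sup>2 E\<^sub>2\<^sup>2 + 2 l a q dE\<^sub>2/dq\<close>, and \<open>12 q dE\<^sub>2/dq = E\<^sub>2\<^sup>2 - E\<^sub>4\<close>, so the quasimodular part cancels
  exactly for this \<open>a\<close>. The cutoff \<open>N\<close> is arbitrary because \<open>modular_coeff l k j\<close> is zero for \<open>j > k\<close>.
\<close>

lemma heat_coeff_eq:
  assumes "N \<ge> k" "\<tau> \<in> upper_half_plane"
  shows "fact (2 * i) * heat_coeff l k i \<tau> = (\<Sum>s\<le>N. E2_exp l s \<tau> * modular_coeff l k (i + s) \<tau>)"
  using assms
proof (induction k arbitrary: i N \<tau>)
  case 0
  have "(\<Sum>s\<le>N. E2_exp l s \<tau> * modular_coeff l 0 (i + s) \<tau>) =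
      (\<Sum>s\<le>N. if s = 0 then (if i = 0 then 1 else 0) else 0)"
    by (intro sum.cong) auto
  thus ?case by simp
next
  case (Suc k)
  define E D2 E4 where "E = eisenstein_E2 \<tau>" and "D2 = q_deriv eisenstein_E2 \<tau>" and "E4 = E2_defect \<tau>"
  define e where "e = (\<lambda>s. E2_exp l s \<tau>)"
  define e' where "e' = (\<lambda>s. if s = 0 then 0 else E2_exp l (s - 1) \<tau>)"
  define b where "b = (\<lambda>j. modular_coeff l k j \<tau>)"
  define Db where "Db = (\<lambda>j. q_deriv (modular_coeff l k j) \<tau>)"
  define L where "L = (of_nat l :: complex)"
  have N: "N \<ge> k" "N \<ge> Suc k" using Suc.prems by auto
  have b0: "b j = 0" if "j > k" for j using that by (simp add: b_def modular_coeff_eq_0)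
  have IH: "fact (2 * j) * heat_coeff l k j t = (\<Sum>s\<le>N. E2_exp l s t * modular_coeff l k (j + s) t)"
    if "t \<in> upper_half_plane" for j t using Suc.IH[OF N(1) that] .
  have 1: "fact (2 * i) * q_deriv (heat_coeff l k i) \<tau> =
     (\<Sum>s\<le>N. - (L / 24) * D2 * e' s * b (i + s) + e s * Db (i + s))"
  proof -
    have "heat_coeff l k i t = (1 / fact (2 * i)) * (\<Sum>s\<le>N. E2_exp l s t * modular_coeff l k (i + s) t)"
      if "t \<in> upper_half_plane" for t using IH[OF that, of i] by (simp add: field_simps)
    hence "q_deriv (heat_coeff l k i) \<tau> =
        q_deriv (\<lambda>t. (1 / fact (2 * i)) * (\<Sum>s\<le>N. E2_exp l s t * modular_coeff l k (i + s) t)) \<tau>"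
      by (rule q_deriv_cong) (use Suc.prems in auto)
    also have "\<dots> = 1 / fact (2 * i) * (\<Sum>s\<le>N. q_deriv (E2_exp l s) \<tau> * modular_coeff l k (i + s) \<tau> +
         E2_exp l s \<tau> * q_deriv (modular_coeff l k (i + s)) \<tau>)"
    proof -
      have h: "(\<lambda>t. E2_exp l s t * modular_coeff l k (i + s) t) holomorphic_on upper_half_plane" for s
        by (intro holomorphic_intros holomorphic_E2_exp holomorphic_modular_coeff)
      show ?thesis
        by (simp only: q_deriv_cmult[OF holomorphic_on_sum[OF h] Suc.prems(2)] q_deriv_sum[OF h Suc.prems(2)]
              q_deriv_mult[OF holomorphic_E2_exp holomorphic_modular_coeff Suc.prems(2)])
    qed
    finally have "fact (2 * i) * q_deriv (heat_coeff l k i) \<tau> = (\<Sum>s\<le>N. q_deriv (E2_exp l s) \<tau> * modular_coeff l k (i + s) \<tau> +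
         E2_exp l s \<tau> * q_deriv (modular_coeff l k (i + s)) \<tau>)" by simp
    also have "\<dots> = (\<Sum>s\<le>N. - (L / 24) * D2 * e' s * b (i + s) + e s * Db (i + s))"
      by (intro sum.cong refl) (simp add: q_deriv_E2_exp[OF Suc.prems(2)] L_def D2_def e'_def b_def e_def Db_def)
    finally show ?thesis .
  qed
  have shift: "(\<Sum>s\<le>N. e s * x s * b (i + s - 1)) = x 0 * b (i - 1) + (\<Sum>s\<le>N. e (Suc s) * x (Suc s) * b (i + s))" for x
  proof -
    have "(\<Sum>s\<le>Suc N. e s * x s * b (i + s - 1)) = x 0 * b (i - 1) + (\<Sum>s\<le>N. e (Suc s) * x (Suc s) * b (i + s))"
      by (subst sum.atMost_Suc_shift) (simp add: e_def)
    moreover have "b (i + Suc N - 1) = 0" using N by (intro b0) simp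
    ultimately show ?thesis by simp
  qed
  have 2: "fact (2 * i) * (if i = 0 then 0 else heat_coeff l k (i - 1) \<tau>) =
      of_nat (2 * i) * (of_nat (2 * i) - 1) * (b (i - 1) + (\<Sum>s\<le>N. e (Suc s) * b (i + s)))"
  proof (cases i)
    case (Suc j)
    have f: "fact (2 * i) = (of_nat (2 * i) * (of_nat (2 * i) - 1) * fact (2 * j) :: complex)"
      unfolding Suc by (simp add: algebra_simps)
    have "fact (2 * j) * heat_coeff l k j \<tau> = (\<Sum>s\<le>N. e s * 1 * b (i + s - 1))"
      using IH[OF Suc.prems(2), of j] by (simp add: e_def b_def Suc)
    also have "\<dots> = b (i - 1) + (\<Sum>s\<le>N. e (Suc s) * b (i + s))"
      using shift[of "\<lambda>_. 1"] by simp
    finally show ?thesis unfolding f using Suc by simp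
  qed simp
  have 3: "fact (2 * i) * heat_coeff l k i \<tau> = (\<Sum>s\<le>N. e s * b (i + s))"
    using IH[OF Suc.prems(2), of i] by (simp add: e_def b_def)
  have 4: "(\<Sum>s\<le>N. e s * b (i + s + 1)) = (\<Sum>s\<le>N. e' s * b (i + s))"
  proof -
    have "(\<Sum>s\<le>Suc N. e' s * b (i + s)) = (\<Sum>s\<le>N. e s * b (i + s + 1))"
      by (subst sum.atMost_Suc_shift) (simp add: e_def e'_def)
    moreover have "b (i + Suc N) = 0" using N by (intro b0) simp
    ultimately show ?thesis by simp
  qed
  define \<beta> \<kappa> W where "\<beta> = (of_nat (2 * i) * (of_nat (2 * i) - 1) :: complex)" and "\<kappa> = L ^ 2 / 144 * E4"
    and "W = L * (4 * of_nat k + 1) / 12 * E"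
  define x where "x = (\<lambda>s. of_nat (2 * (i + s)) * (of_nat (2 * (i + s)) - 1) :: complex)"
  define P V where "P = (\<lambda>s. e s * (- (L * (2 * of_nat k - 2 * of_nat (i + s)) / 6) * E))"
    and "V = (\<lambda>s. - (L / 24) * D2 * e' s)"
  \<comment> \<open>Both sides of the recursion have been brought to the form \<open>\<Sum> \<dots> * b (i + s)\<close>; it remains to
    compare the factors. They involve \<open>e\<close> at three neighbouring indices, which the ratio of
    consecutive exponential coefficients reduces to a single one, called \<open>X\<close>.\<close>
  have coef: "P s + e (Suc s) * x (Suc s) + \<kappa> * e' s = 2 * L * V s + \<beta> * e (Suc s) - W * e s" for s
  proof -
    define a where "a = - (L / 24)"
    have L: "L = - 24 * a" by (simp add: a_def)
    have "12 * D2 = E ^ 2 - E4" using q_deriv_E2[of \<tau>] by (simp only: D2_def E_def E4_def)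
    hence D2: "D2 = (E ^ 2 - E4) / 12" by (metis nonzero_mult_div_cancel_left zero_neq_numeral)
    have e_Suc: "e (Suc s) = a * E * e s / of_nat (Suc s)" for s
      by (simp add: e_def E2_exp_Suc L_def E_def a_def del: of_nat_Suc)
    show ?thesis
    proof (cases s)
      case 0
      have "e' s = 0" "e s = 1" "e (Suc s) = a * E" using e_Suc[of 0] by (simp_all add: 0 e'_def e_def)
      thus ?thesis unfolding P_def x_def V_def \<beta>_def \<kappa>_def W_def L using 0
        by (simp add: field_simps)
    next
      case (Suc r)
      define R where "R = (of_nat r :: complex)"
      have n: "1 + R \<noteq> 0" "2 + R \<noteq> 0"
        using of_nat_neq_0[of r, where ?'a = complex] of_nat_neq_0[of "Suc r", where ?'a = complex]
        by (simp_all add: R_def add_ac)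
      define X where "X = e r / ((1 + R) * (2 + R))"
      have e': "e' s = X * (1 + R) * (2 + R)" using n by (simp add: e'_def e_def Suc X_def)
      have es: "e s = a * E * X * (2 + R)"
        using e_Suc[of r] n by (simp add: X_def Suc R_def)
      have eSs: "e (Suc s) = a\<^sup>2 * E\<^sup>2 * X"
        using e_Suc[of s] n unfolding es by (simp add: Suc R_def power2_eq_square add_ac)
      have sr: "of_nat s = 1 + R" by (simp add: Suc R_def)
      show ?thesis
        unfolding P_def x_def V_def \<beta>_def \<kappa>_def W_def L D2 e' es eSs of_nat_add of_nat_mult of_nat_numeral of_nat_Suc sr
        by (simp add: field_simps power2_eq_square)
    qed
  qed
  have "(\<Sum>s\<le>N. E2_exp l s \<tau> * modular_coeff l (Suc k) (i + s) \<tau>) =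
     (\<Sum>s\<le>N. 2 * L * (e s * Db (i + s)) + P s * b (i + s) + e s * x s * b (i + s - 1) + \<kappa> * (e s * b (i + s + 1)))"
    by (intro sum.cong refl) (simp add: e_def Db_def b_def E_def L_def E4_def P_def x_def \<kappa>_def field_simps)
  also have "\<dots> = 2 * L * (\<Sum>s\<le>N. e s * Db (i + s)) + (\<Sum>s\<le>N. P s * b (i + s))
       + (x 0 * b (i - 1) + (\<Sum>s\<le>N. e (Suc s) * x (Suc s) * b (i + s))) + \<kappa> * (\<Sum>s\<le>N. e' s * b (i + s))"
    unfolding 4[symmetric] shift[symmetric] by (simp only: sum.distrib sum_distrib_left)
  also have "x 0 = \<beta>" by (simp add: x_def \<beta>_def)
  also have "2 * L * (\<Sum>s\<le>N. e s * Db (i + s)) + (\<Sum>s\<le>N. P s * b (i + s))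
       + (\<beta> * b (i - 1) + (\<Sum>s\<le>N. e (Suc s) * x (Suc s) * b (i + s))) + \<kappa> * (\<Sum>s\<le>N. e' s * b (i + s)) =
     2 * L * (\<Sum>s\<le>N. e s * Db (i + s)) + \<beta> * b (i - 1)
      + (\<Sum>s\<le>N. (P s + e (Suc s) * x (Suc s) + \<kappa> * e' s) * b (i + s))"
    by (simp add: sum.distrib sum_distrib_left distrib_right mult.assoc)
  also have "\<dots> = 2 * L * (\<Sum>s\<le>N. e s * Db (i + s)) + \<beta> * b (i - 1)
      + (\<Sum>s\<le>N. 2 * L * (V s * b (i + s)) + \<beta> * (e (Suc s) * b (i + s)) - W * (e s * b (i + s)))"
    unfolding coef by (simp add: algebra_simps)
  also have "\<dots> = 2 * L * (\<Sum>s\<le>N. V s * b (i + s) + e s * Db (i + s))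
     + \<beta> * (b (i - 1) + (\<Sum>s\<le>N. e (Suc s) * b (i + s))) - W * (\<Sum>s\<le>N. e s * b (i + s))"
    by (simp only: sum.distrib sum_subtractf sum_distrib_left[symmetric]) (simp add: algebra_simps)
  also have "\<dots> = fact (2 * i) * heat_coeff l (Suc k) i \<tau>"
  proof -
    have h: "heat_coeff l (Suc k) i \<tau> = 2 * L * q_deriv (heat_coeff l k i) \<tau>
        + (if i = 0 then 0 else heat_coeff l k (i - 1) \<tau>) - W * heat_coeff l k i \<tau>"
      by (simp only: heat_coeff.simps L_def E_def W_def)
    have "2 * L * (F * x) + F * y - W * (F * z) = F * (2 * L * x + y - W * z)" for F x y z
      by (simp add: algebra_simps)
    thus ?thesis unfolding h V_def 1[symmetric] 3[symmetric] \<beta>_def 2[symmetric] .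
  qed
  finally show ?case by simp
qed

section \<open>The triangular system for the coefficients\<close>

text \<open>
  Here \<open>pde_coeff m r\<close> is the form of weight \<open>2 r\<close>, the factor of \<open>\<H>\<^bsup>m-r\<^esup> A\<^sub>l\<close>. It is
  determined by forward substitution from the equation for the coefficient of \<open>u\<^bsup>-2(m-r)-1\<^esup>\<close>, whose
  diagonal entry is the constant \<open>(2 (m - r))!\<close> by \<open>modular_coeff_diag\<close>.
\<close>

fun pde_coeff :: "nat \<Rightarrow> nat \<Rightarrow> complex \<Rightarrow> complex" where
  "pde_coeff m r \<tau> = (fact (2 * m) * reduced_nth (2 * m + 1) (2 * r) \<tau>
     - (\<Sum>s<r. pde_coeff m s \<tau> * modular_coeff (2 * m + 1) (m - s) (m - r) \<tau>)) / fact (2 * (m - r))"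

declare pde_coeff.simps [simp del]

lemma pde_coeff_0: "pde_coeff m 0 \<tau> = 1"
  by (subst pde_coeff.simps) simp

lemma modular_form_pde_coeff: "r \<le> m \<Longrightarrow> modular_form (int (2 * r)) (pde_coeff m r)"
proof (induction r rule: less_induct)
  case (less r)
  have "modular_form (int (2 * r)) (\<lambda>\<tau>. (1 / fact (2 * (m - r))) * (fact (2 * m) * reduced_nth (2 * m + 1) (2 * r) \<tau>
     - (\<Sum>s<r. pde_coeff m s \<tau> * modular_coeff (2 * m + 1) (m - s) (m - r) \<tau>)))"
    using less.prems
    by (intro modular_form_cmult modular_form_diff modular_form_sum modular_form_reduced_nth
          modular_form_mult[OF less.IH modular_form_modular_coeff]) auto
  thus ?case by (subst pde_coeff.simps[abs_def]) simp
qed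

lemma pde_coeff_modular:
  assumes "i \<le> m"
  shows "(\<Sum>k=0..m. pde_coeff m (m - k) \<tau> * modular_coeff (2 * m + 1) k i \<tau>) =
           fact (2 * m) * reduced_nth (2 * m + 1) (2 * (m - i)) \<tau>"
proof -
  define r where "r = m - i"
  have i: "i = m - r" "r \<le> m" using assms by (simp_all add: r_def)
  let ?b = "\<lambda>s. modular_coeff (2 * m + 1) (m - s) i \<tau>"
  have "(\<Sum>k=0..m. pde_coeff m (m - k) \<tau> * modular_coeff (2 * m + 1) k i \<tau>) = (\<Sum>s=0..m. pde_coeff m s \<tau> * ?b s)"
    by (rule sum.reindex_bij_witness[of _ "\<lambda>s. m - s" "\<lambda>k. m - k"]) auto
  also have "\<dots> = (\<Sum>s\<in>insert r {..<r}. pde_coeff m s \<tau> * ?b s)"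
    by (rule sum.mono_neutral_right) (use i in \<open>auto simp: modular_coeff_eq_0\<close>)
  also have "\<dots> = pde_coeff m r \<tau> * fact (2 * (m - r)) + (\<Sum>s<r. pde_coeff m s \<tau> * ?b s)"
    by (simp add: i modular_coeff_diag)
  also have "\<dots> = fact (2 * m) * reduced_nth (2 * m + 1) (2 * r) \<tau>"
    by (subst pde_coeff.simps) (simp add: i)
  finally show ?thesis by (simp add: r_def)
qed

text \<open>
  Multiplying the modular system by \<open>exp (- l E\<^sub>2 u\<^sup>2 / 24)\<close> restores the quasimodular one, which
  describes the actual principal parts.
\<close>

lemma pde_coeff_heat_coeff:
  assumes "i \<le> m" "\<tau> \<in> upper_half_plane"
  shows "fact (2 * i) * (\<Sum>k=0..m. pde_coeff m (m - k) \<tau> * heat_coeff (2 * m + 1) k i \<tau>) =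
           fact (2 * m) * crank_nth (2 * m + 1) (2 * (m - i)) \<tau>"
proof -
  let ?l = "2 * m + 1"
  have "fact (2 * i) * (\<Sum>k=0..m. pde_coeff m (m - k) \<tau> * heat_coeff ?l k i \<tau>) =
      (\<Sum>k=0..m. pde_coeff m (m - k) \<tau> * (fact (2 * i) * heat_coeff ?l k i \<tau>))"
    by (simp add: sum_distrib_left mult_ac)
  also have "\<dots> = (\<Sum>k=0..m. pde_coeff m (m - k) \<tau> * (\<Sum>s\<le>m. E2_exp ?l s \<tau> * modular_coeff ?l k (i + s) \<tau>))"
    using assms(2) by (intro sum.cong refl) (simp add: heat_coeff_eq)
  also have "\<dots> = (\<Sum>s\<le>m. E2_exp ?l s \<tau> * (\<Sum>k=0..m. pde_coeff m (m - k) \<tau> * modular_coeff ?l k (i + s) \<tau>))"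
    unfolding sum_distrib_left by (subst sum.swap) (simp add: mult_ac)
  also have "\<dots> = (\<Sum>s\<le>m - i. E2_exp ?l s \<tau> * (\<Sum>k=0..m. pde_coeff m (m - k) \<tau> * modular_coeff ?l k (i + s) \<tau>))"
    by (rule sum.mono_neutral_right) (auto intro!: sum.neutral simp: modular_coeff_eq_0)
  also have "\<dots> = (\<Sum>s\<le>m - i. E2_exp ?l s \<tau> * (fact (2 * m) * reduced_nth ?l (2 * (m - i - s)) \<tau>))"
    using assms(1) by (intro sum.cong refl) (subst pde_coeff_modular, auto)
  also have "\<dots> = fact (2 * m) * crank_nth ?l (2 * (m - i)) \<tau>"
    unfolding crank_nth_eq(1)[OF assms(2)] by (simp add: sum_distrib_left mult_ac)
  finally show ?thesis .
qed



section \<open>The terms of the Appell function\<close>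

text \<open>
  Each term of \<open>A\<^sub>l\<close> has the form \<open>e2pi (a v) / (1 - e2pi v)\<close> at \<open>v = z + n \<tau>\<close>, times a Gaussian. The
  heat operator acts on the term through two derivatives in \<open>v\<close>, which are iterated here.
\<close>

primrec appell_kernel :: "complex \<Rightarrow> nat \<Rightarrow> complex \<Rightarrow> complex" where
  "appell_kernel a 0 = (\<lambda>v. e2pi (a * v) / (1 - e2pi v))"
| "appell_kernel a (Suc i) = (\<lambda>v. deriv (deriv (appell_kernel a i)) v / (2 * of_real pi * \<i>)\<^sup>2)"

text \<open>
  What remains of the numerator of the \<open>n\<close>-th term of \<open>A\<^sub>l\<close> after the power \<open>l / 2 + l n\<close> of
  \<open>w q\<^sup>n\<close> has been split off. The heat operator annihilates this exponential.
\<close>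

definition appell_gauss :: "nat \<Rightarrow> int \<Rightarrow> complex \<Rightarrow> complex \<Rightarrow> complex" where
  "appell_gauss l n z \<tau> = (-1) powi (int l * n) * e2pi (- (of_nat l * of_int n ^ 2 / 2) * \<tau> - of_nat l * of_int n * z)"

definition appell_term :: "nat \<Rightarrow> nat \<Rightarrow> int \<Rightarrow> complex \<Rightarrow> complex \<Rightarrow> complex" where
  "appell_term l i n z \<tau> = appell_gauss l n z \<tau> * appell_kernel (of_nat l * (1 / 2 + of_int n)) i (z + of_int n * \<tau>)"

text \<open>
  The index set \<open>UNIV\<close> describes the complement of the lattice; \<open>UNIV - {0}\<close> is used at the origin,
  where only the term with \<open>n = 0\<close> has a pole.
\<close>

definition regular :: "int set \<Rightarrow> complex \<Rightarrow> complex \<Rightarrow> bool" where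
  "regular A z \<tau> \<longleftrightarrow> Im \<tau> > 0 \<and> (\<forall>n\<in>A. e2pi (z + of_int n * \<tau>) \<noteq> 1)"

lemma regular_UNIV_iff: "regular UNIV z \<tau> \<longleftrightarrow> \<tau> \<in> upper_half_plane \<and> z \<notin> period_lattice \<tau>"
  by (simp add: regular_def period_lattice_iff upper_half_plane_def)

lemma regular_0:
  assumes "\<tau> \<in> upper_half_plane"
  shows "regular (UNIV - {0}) 0 \<tau>"
proof -
  have t: "Im \<tau> > 0" using assms by (simp add: upper_half_plane_def)
  have "of_int n * \<tau> \<notin> \<int>" if "n \<noteq> 0" for n :: int
  proof
    assume "of_int n * \<tau> \<in> \<int>"
    then obtain x where x: "of_int n * \<tau> = of_int x" by (auto simp: Ints_def)
    have "Im (of_int n * \<tau>) = 0" unfolding x by simp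
    thus False using t that by simp
  qed
  thus ?thesis using t by (simp add: regular_def e2pi_eq_1_iff)
qed

abbreviation kernel_domain :: "complex set" where
  "kernel_domain \<equiv> {v. e2pi v \<noteq> 1}"

lemma open_kernel_domain: "open kernel_domain"
  by (intro open_Collect_neq continuous_intros)

lemma holomorphic_appell_kernel: "appell_kernel a i holomorphic_on kernel_domain"
proof (induction i)
  case 0
  show ?case by (auto intro!: holomorphic_intros)
next
  case (Suc i)
  thus ?case unfolding appell_kernel.simps
    by (intro holomorphic_intros holomorphic_deriv open_kernel_domain) auto
qed

lemma deriv_gauss_z:
  assumes f: "f holomorphic_on kernel_domain" and v: "s + of_int n * \<tau> \<in> kernel_domain"
  shows "((\<lambda>s. appell_gauss l n s \<tau> * f (s + of_int n * \<tau>)) has_field_derivative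
     appell_gauss l n s \<tau> * (deriv f (s + of_int n * \<tau>) - 2 * of_real pi * \<i> * of_nat l * of_int n * f (s + of_int n * \<tau>))) (at s)"
proof -
  have 1: "((\<lambda>s. f (s + of_int n * \<tau>)) has_field_derivative deriv f (s + of_int n * \<tau>) * 1) (at s)"
    by (rule DERIV_chain2[of f]) (use holomorphic_derivI[OF f open_kernel_domain v] in \<open>auto intro!: derivative_eq_intros\<close>)
  have 2: "((\<lambda>s. appell_gauss l n s \<tau>) has_field_derivative
      appell_gauss l n s \<tau> * (- (2 * of_real pi * \<i> * of_nat l * of_int n))) (at s)"
    unfolding appell_gauss_def by (auto intro!: derivative_eq_intros)
  show ?thesis
    by (rule DERIV_cong[OF DERIV_mult[OF 2 1]]) (simp add: algebra_simps)
qed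

lemma deriv_gauss_tau:
  assumes f: "f holomorphic_on kernel_domain" and v: "z + of_int n * \<tau> \<in> kernel_domain"
  shows "((\<lambda>t. appell_gauss l n z t * f (z + of_int n * t)) has_field_derivative
     appell_gauss l n z \<tau> * (of_int n * deriv f (z + of_int n * \<tau>) - of_real pi * \<i> * of_nat l * of_int n ^ 2 * f (z + of_int n * \<tau>))) (at \<tau>)"
proof -
  have 1: "((\<lambda>t. f (z + of_int n * t)) has_field_derivative deriv f (z + of_int n * \<tau>) * of_int n) (at \<tau>)"
    by (rule DERIV_chain2[of f]) (use holomorphic_derivI[OF f open_kernel_domain v] in \<open>auto intro!: derivative_eq_intros\<close>)
  have 2: "((\<lambda>t. appell_gauss l n z t) has_field_derivative
      appell_gauss l n z \<tau> * (- (of_real pi * \<i> * of_nat l * of_int n ^ 2))) (at \<tau>)"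
    unfolding appell_gauss_def by (auto intro!: derivative_eq_intros)
  show ?thesis
    by (rule DERIV_cong[OF DERIV_mult[OF 2 1]]) (simp add: algebra_simps)
qed

lemma holomorphic_appell_term_z: "(\<lambda>s. appell_term l i n s \<tau>) holomorphic_on {s. e2pi (s + of_int n * \<tau>) \<noteq> 1}"
  unfolding appell_term_def
  by (intro holomorphic_onI) (use deriv_gauss_z[OF holomorphic_appell_kernel] field_differentiable_at_within field_differentiable_def in blast)

lemma holomorphic_appell_term_tau: "(\<lambda>t. appell_term l i n z t) holomorphic_on {t. e2pi (z + of_int n * t) \<noteq> 1}"
  unfolding appell_term_def
  by (intro holomorphic_onI) (use deriv_gauss_tau[OF holomorphic_appell_kernel] field_differentiable_at_within field_differentiable_def in blast)

text \<open>
  The terms with \<open>n\<^sup>2\<close> and those with the first derivative of the kernel, which come from the two parts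
  of the operator, cancel; only the second derivative survives.
\<close>

lemma heat_appell_term:
  assumes v: "e2pi (z + of_int n * \<tau>) \<noteq> 1"
  shows "of_nat l / (of_real pi * \<i>) * deriv (\<lambda>t. appell_term l i n z t) \<tau>
     + 1 / (2 * of_real pi * \<i>)\<^sup>2 * (deriv ^^ 2) (\<lambda>s. appell_term l i n s \<tau>) z = appell_term l (Suc i) n z \<tau>"
proof -
  define f where "f = appell_kernel (of_nat l * (1 / 2 + of_int n)) i"
  have f: "f holomorphic_on kernel_domain" unfolding f_def by (rule holomorphic_appell_kernel)
  define S where "S = {s. e2pi (s + of_int n * \<tau>) \<noteq> 1}"
  have S: "open S" "z \<in> S" unfolding S_def using v by (auto intro!: open_Collect_neq continuous_intros)
  let ?v = "z + of_int n * \<tau>"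
  define p where "p = of_real pi * \<i>"
  have p: "p \<noteq> 0" by (simp add: p_def)
  define L N where "L = (of_nat l :: complex)" and "N = (of_int n :: complex)"
  define h where "h = (\<lambda>v. deriv f v - 2 * of_real pi * \<i> * of_nat l * of_int n * f v)"
  have h: "h holomorphic_on kernel_domain" unfolding h_def
    by (intro holomorphic_intros f open_kernel_domain)
  have d1: "deriv (\<lambda>s. appell_gauss l n s \<tau> * f (s + of_int n * \<tau>)) s = appell_gauss l n s \<tau> * h (s + of_int n * \<tau>)" if "s \<in> S" for s
    unfolding h_def by (intro DERIV_imp_deriv deriv_gauss_z f) (use that in \<open>simp add: S_def\<close>)
  have "(deriv ^^ 2) (\<lambda>s. appell_gauss l n s \<tau> * f (s + of_int n * \<tau>)) z = deriv (\<lambda>s. appell_gauss l n s \<tau> * h (s + of_int n * \<tau>)) z"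
    unfolding numeral_2_eq_2 funpow.simps o_def id_def
    by (intro deriv_cong_ev refl) (use eventually_nhds_in_open[OF S] in \<open>auto elim!: eventually_mono simp: d1\<close>)
  also have "\<dots> = appell_gauss l n z \<tau> * (deriv h ?v - 2 * of_real pi * \<i> * of_nat l * of_int n * h ?v)"
    by (intro DERIV_imp_deriv deriv_gauss_z h) (use v in simp)
  also have "deriv h ?v = deriv (deriv f) ?v - 2 * of_real pi * \<i> * of_nat l * of_int n * deriv f ?v"
    unfolding h_def using v
    by (intro DERIV_imp_deriv derivative_intros DERIV_cmult holomorphic_derivI[OF holomorphic_deriv[OF f open_kernel_domain] open_kernel_domain]
       holomorphic_derivI[OF f open_kernel_domain]) auto
  finally have z2: "(deriv ^^ 2) (\<lambda>s. appell_term l i n s \<tau>) z =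
      appell_gauss l n z \<tau> * (deriv (deriv f) ?v - 2 * p * L * N * deriv f ?v - 2 * p * L * N * (deriv f ?v - 2 * p * L * N * f ?v))"
    by (simp add: appell_term_def f_def[symmetric] p_def L_def N_def h_def mult.assoc)
  have t1: "deriv (\<lambda>t. appell_term l i n z t) \<tau> = appell_gauss l n z \<tau> * (N * deriv f ?v - p * L * N ^ 2 * f ?v)"
    unfolding appell_term_def f_def[symmetric] p_def L_def N_def
    by (intro DERIV_imp_deriv deriv_gauss_tau f) (use v in simp)
  have "L / p * (g * (N * f1 - p * L * N ^ 2 * f0)) +
      1 / (2 * p)\<^sup>2 * (g * (f2 - 2 * p * L * N * f1 - 2 * p * L * N * (f1 - 2 * p * L * N * f0))) = g * (f2 / (2 * p)\<^sup>2)" for g f0 f1 f2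
    using p by (simp add: field_simps power2_eq_square)
  thus ?thesis unfolding t1 z2
    by (simp add: appell_term_def f_def[symmetric] p_def L_def mult.assoc)
qed

text \<open>The absolute value of \<open>e2pi (z + n \<tau>)\<close> is at most \<open>1 / 2\<close> or at least \<open>2\<close> for all but finitely many
  \<open>n\<close>, uniformly near the given point; the remaining \<open>n\<close> are treated by continuity.\<close>

lemma regular_locally:
  assumes reg: "regular A z0 \<tau>0"
  obtains r \<delta> y where "r > 0" "\<delta> > 0" "y > 0"
    "\<And>z \<tau>. z \<in> ball z0 r \<Longrightarrow> \<tau> \<in> ball \<tau>0 r \<Longrightarrow> Im \<tau> \<ge> y"
    "\<And>z \<tau> n. z \<in> ball z0 r \<Longrightarrow> \<tau> \<in> ball \<tau>0 r \<Longrightarrow> n \<in> A \<Longrightarrow> norm (1 - e2pi (z + of_int n * \<tau>)) \<ge> \<delta>"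
proof -
  define y where "y = Im \<tau>0 / 2"
  have y: "y > 0" using reg by (simp add: regular_def y_def)
  define N where "N = nat \<lceil>(\<bar>Im z0\<bar> + 2) / y\<rceil>"
  have N: "real n * y \<ge> \<bar>Im z0\<bar> + 2" if "n \<ge> N" for n
  proof -
    have "real n \<ge> (\<bar>Im z0\<bar> + 2) / y" using that unfolding N_def by linarith
    thus ?thesis using y by (simp add: field_simps)
  qed
  define B where "B = {n\<in>A. \<bar>n\<bar> < int N}"
  have B: "finite B" by (rule finite_subset[of _ "{- int N..int N}"]) (auto simp: B_def)
  define d where "d = (\<lambda>n. norm (1 - e2pi (z0 + of_int n * \<tau>0)) / 2)"
  have d: "d n > 0" if "n \<in> B" for n using that reg by (simp add: d_def B_def regular_def)
  define \<delta> where "\<delta> = Min (insert (1 / 2) (d ` B))"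
  have fin: "finite (insert (1 / 2) (d ` B))" using B by simp
  have \<delta>: "\<delta> > 0" "\<delta> \<le> 1 / 2" "\<And>n. n \<in> B \<Longrightarrow> \<delta> \<le> d n"
  proof -
    show "\<delta> \<le> 1 / 2" unfolding \<delta>_def using fin by (rule Min_le) simp
    show "\<delta> \<le> d n" if "n \<in> B" for n unfolding \<delta>_def using fin by (rule Min_le) (use that in simp)
    show "\<delta> > 0" unfolding \<delta>_def using Min_gr_iff[OF fin] d by simp
  qed
  have "\<forall>\<^sub>F p in nhds (z0, \<tau>0). \<forall>n\<in>B. d n < norm (1 - e2pi (fst p + of_int n * snd p))"
  proof (intro eventually_ball_finite B ballI)
    fix n assume n: "n \<in> B"
    have "isCont (\<lambda>p. norm (1 - e2pi (fst p + of_int n * snd p))) (z0, \<tau>0)"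
      by (rule continuous_on_interior[of UNIV]) (auto intro!: continuous_intros)
    hence "((\<lambda>p. norm (1 - e2pi (fst p + of_int n * snd p))) \<longlongrightarrow> 2 * d n) (nhds (z0, \<tau>0))"
      by (simp add: isCont_def tendsto_nhds_iff d_def)
    moreover have "d n < 2 * d n" using d[OF n] by simp
    ultimately show "\<forall>\<^sub>F p in nhds (z0, \<tau>0). d n < norm (1 - e2pi (fst p + of_int n * snd p))"
      by (rule order_tendstoD)
  qed
  then obtain P Q where PQ: "eventually P (nhds z0)" "eventually Q (nhds \<tau>0)"
    "\<And>z \<tau>. P z \<Longrightarrow> Q \<tau> \<Longrightarrow> \<forall>n\<in>B. d n < norm (1 - e2pi (z + of_int n * \<tau>))"
    unfolding nhds_prod eventually_prod_filter by (metis fst_conv snd_conv)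
  obtain r1 r2 where r: "r1 > 0" "\<And>z. z \<in> ball z0 r1 \<Longrightarrow> P z" "r2 > 0" "\<And>\<tau>. \<tau> \<in> ball \<tau>0 r2 \<Longrightarrow> Q \<tau>"
    using PQ(1,2) unfolding eventually_nhds_metric by (metis dist_commute mem_ball)
  define r where "r = min (min r1 r2) (min y 1)"
  have rpos: "r > 0" using r(1,3) y by (simp add: r_def)
  have Im: "Im \<tau> \<ge> y" if "\<tau> \<in> ball \<tau>0 r" for \<tau>
  proof -
    have "\<bar>Im (\<tau>0 - \<tau>)\<bar> < y" using that abs_Im_le_cmod[of "\<tau>0 - \<tau>"] by (simp add: dist_norm r_def)
    hence "Im \<tau>0 - Im \<tau> < Im \<tau>0 / 2" unfolding y_def by (simp only: minus_complex.simps abs_less_iff)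
    thus ?thesis unfolding y_def by linarith
  qed
  have "norm (1 - e2pi (z + of_int n * \<tau>)) \<ge> \<delta>" if z: "z \<in> ball z0 r" and \<tau>: "\<tau> \<in> ball \<tau>0 r" and n: "n \<in> A" for z \<tau> n
  proof (cases "n \<in> B")
    case True
    thus ?thesis using PQ(3)[of z \<tau>] r(2)[of z] r(4)[of \<tau>] z \<tau> \<delta>(3)[of n] by (force simp: r_def)
  next
    case False
    hence n: "\<bar>n\<bar> \<ge> int N" using n by (simp add: B_def)
    have "real (nat \<bar>n\<bar>) * y \<ge> \<bar>Im z0\<bar> + 2" using n by (intro N) auto
    hence "\<bar>real_of_int n\<bar> * y \<ge> \<bar>Im z0\<bar> + 2" by simp
    moreover have "\<bar>real_of_int n\<bar> * y \<le> \<bar>real_of_int n\<bar> * Im \<tau>"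
      using Im[OF \<tau>] by (intro mult_left_mono) auto
    moreover have "\<bar>Im (z0 - z)\<bar> < 1" using z abs_Im_le_cmod[of "z0 - z"] by (simp add: dist_norm r_def)
    ultimately have *: "\<bar>real_of_int n\<bar> * Im \<tau> \<ge> \<bar>Im z\<bar> + 1"
      unfolding minus_complex.simps by linarith
    define x where "x = e2pi (z + of_int n * \<tau>)"
    have nx: "norm x = exp (- (2 * pi * (Im z + of_int n * Im \<tau>)))" by (simp add: x_def norm_e2pi)
    have e2: "exp (2 * pi) \<ge> (2 :: real)"
      using exp_ge_add_one_self[of "2 * pi"] pi_gt3 by linarith
    show ?thesis
    proof (cases "n \<ge> 0")
      case True
      hence "Im z + of_int n * Im \<tau> \<ge> 1" using * by simp
      hence "2 * pi * 1 \<le> 2 * pi * (Im z + of_int n * Im \<tau>)" by (intro mult_left_mono) auto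
      hence "norm x \<le> exp (- (2 * pi))" unfolding nx by simp
      also have "\<dots> \<le> 1 / 2" using e2 by (simp add: exp_minus field_simps)
      finally have "norm x \<le> 1 / 2" .
      thus ?thesis using \<delta>(2) norm_triangle_ineq2[of 1 x] by (simp add: x_def)
    next
      case False
      hence "Im z + of_int n * Im \<tau> \<le> -1" using * by simp
      hence "2 * pi * 1 \<le> 2 * pi * (- (Im z + of_int n * Im \<tau>))" by (intro mult_left_mono) auto
      hence "norm x \<ge> exp (2 * pi)"
        unfolding nx by (simp only: exp_le_cancel_iff mult_minus_right mult_1_right)
      hence "norm x \<ge> 2" using e2 by simp
      thus ?thesis using \<delta>(2) norm_triangle_ineq2[of x 1] by (simp add: x_def norm_minus_commute)
    qed
  qed
  thus thesis using that[OF rpos \<delta>(1) y] Im by blast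
qed

text \<open>
  A bound on a neighbourhood in both variables is needed, since it is passed on to derivatives in
  \<open>z\<close> and \<open>\<tau>\<close> by Cauchy's inequality.
\<close>

definition normally_bounded :: "int set \<Rightarrow> (int \<Rightarrow> complex \<Rightarrow> complex \<Rightarrow> complex) \<Rightarrow> complex \<Rightarrow> complex \<Rightarrow> bool" where
  "normally_bounded A f z0 \<tau>0 \<longleftrightarrow> (\<exists>r>0. \<exists>M. M summable_on A \<and>
     (\<forall>z\<in>ball z0 r. \<forall>\<tau>\<in>ball \<tau>0 r. regular A z \<tau> \<and> (\<forall>n\<in>A. norm (f n z \<tau>) \<le> M n)))"

lemma appell_term_0:
  "appell_term l 0 n z \<tau> = (-1) powi (int l * n) *
     e2pi (of_nat l / 2 * z + of_nat l / 2 * of_int (n * (n + 1)) * \<tau>) / (1 - e2pi (z + of_int n * \<tau>))"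
proof -
  have "e2pi (- (of_nat l * of_int n ^ 2 / 2) * \<tau> - of_nat l * of_int n * z) *
      e2pi (of_nat l * (1 / 2 + of_int n) * (z + of_int n * \<tau>)) =
      e2pi (of_nat l / 2 * z + of_nat l / 2 * of_int (n * (n + 1)) * \<tau>)"
    unfolding e2pi_add[symmetric] by (rule arg_cong[of _ _ e2pi]) (simp add: field_simps power2_eq_square)
  thus ?thesis by (simp add: appell_term_def appell_gauss_def)
qed

lemma norm_minus_one_powi [simp]: "norm ((-1 :: complex) powi n) = 1"
  by (simp add: norm_power_int)

text \<open>
  The Gaussian decay \<open>q\<^bsup>l n (n + 1) / 2\<^esup>\<close> is weakened to geometric decay by \<open>n (n + 1) \<ge> \<bar>n\<bar> - 1\<close>.
\<close>

lemma normally_bounded_appell_term_0: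
  assumes reg: "regular A z0 \<tau>0" and l: "l > 0"
  shows "normally_bounded A (appell_term l 0) z0 \<tau>0"
proof -
  obtain r \<delta> y where R: "r > 0" "\<delta> > 0" "y > 0"
    "\<And>z \<tau>. z \<in> ball z0 r \<Longrightarrow> \<tau> \<in> ball \<tau>0 r \<Longrightarrow> Im \<tau> \<ge> y"
    "\<And>z \<tau> n. z \<in> ball z0 r \<Longrightarrow> \<tau> \<in> ball \<tau>0 r \<Longrightarrow> n \<in> A \<Longrightarrow> norm (1 - e2pi (z + of_int n * \<tau>)) \<ge> \<delta>"
    using regular_locally[OF reg] by blast
  define \<rho> where "\<rho> = exp (- (pi * real l * y))"
  have \<rho>: "0 < \<rho>" "\<rho> < 1" using R(3) l by (auto simp: \<rho>_def)
  define C where "C = exp (pi * real l * (\<bar>Im z0\<bar> + r)) / \<delta> / \<rho>"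
  define M where "M = (\<lambda>n::int. C * \<rho> ^ nat \<bar>n\<bar>)"
  have "M summable_on UNIV" unfolding M_def
    using summable_on_int_abs[of "\<lambda>n. \<rho> ^ n"] \<rho>
    by (intro summable_on_cmult_right) (auto intro: summable_geometric)
  hence M: "M summable_on A" by (rule summable_on_subset_banach) simp
  have "regular A z \<tau>" if "z \<in> ball z0 r" "\<tau> \<in> ball \<tau>0 r" for z \<tau>
    unfolding regular_def using R(4)[OF that] R(5)[OF that] R(2,3) by force
  moreover have "norm (appell_term l 0 n z \<tau>) \<le> M n" if z: "z \<in> ball z0 r" and \<tau>: "\<tau> \<in> ball \<tau>0 r" and n: "n \<in> A" for z \<tau> n
  proof -
    have nn: "real_of_int (n * (n + 1)) \<ge> real (nat \<bar>n\<bar>) - 1" "real_of_int (n * (n + 1)) \<ge> 0"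
    proof -
      have "n * (n + 1) \<ge> \<bar>n\<bar> - 1 \<and> n * (n + 1) \<ge> 0"
      proof (cases "n \<ge> 0")
        case True
        have "n * (n + 1) \<ge> n * 1" using True by (intro mult_left_mono) auto
        thus ?thesis using True by simp
      next
        case False
        have "(- n - 1) * 1 \<le> (- n - 1) * (- n)" using False by (intro mult_left_mono) auto
        thus ?thesis using False by (simp add: algebra_simps)
      qed
      hence "real_of_int (\<bar>n\<bar> - 1) \<le> real_of_int (n * (n + 1))" "0 \<le> real_of_int (n * (n + 1))"
        by (simp_all only: of_int_le_iff of_int_0_le_iff)
      thus "real_of_int (n * (n + 1)) \<ge> real (nat \<bar>n\<bar>) - 1" "real_of_int (n * (n + 1)) \<ge> 0" by simp_all
    qed
    have "\<bar>Im (z0 - z)\<bar> < r" using z abs_Im_le_cmod[of "z0 - z"] by (simp add: dist_norm)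
    hence Imz: "- Im z \<le> \<bar>Im z0\<bar> + r" by simp
    have "norm (appell_term l 0 n z \<tau>) =
        exp (- (2 * pi * (real l / 2 * Im z + real l / 2 * real_of_int (n * (n + 1)) * Im \<tau>))) / norm (1 - e2pi (z + of_int n * \<tau>))"
      unfolding appell_term_0 norm_divide norm_mult norm_minus_one_powi norm_e2pi by simp
    also have "\<dots> \<le> exp (- (2 * pi * (real l / 2 * Im z + real l / 2 * real_of_int (n * (n + 1)) * Im \<tau>))) / \<delta>"
      using R(5)[OF z \<tau> n] R(2) by (intro divide_left_mono mult_pos_pos) auto
    also have "- (2 * pi * (real l / 2 * Im z + real l / 2 * real_of_int (n * (n + 1)) * Im \<tau>)) =
       pi * real l * (- Im z) + - (pi * real l * (real_of_int (n * (n + 1)) * Im \<tau>))"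
      by (simp add: algebra_simps)
    also have "exp \<dots> / \<delta> \<le> exp (pi * real l * (\<bar>Im z0\<bar> + r) + - (pi * real l * y) * (real (nat \<bar>n\<bar>) - 1)) / \<delta>"
    proof -
      have "(real (nat \<bar>n\<bar>) - 1) * y \<le> real_of_int (n * (n + 1)) * y"
        using nn R(3) by (intro mult_right_mono) auto
      also have "\<dots> \<le> real_of_int (n * (n + 1)) * Im \<tau>"
        using nn R(4)[OF z \<tau>] by (intro mult_left_mono) auto
      finally have "pi * real l * ((real (nat \<bar>n\<bar>) - 1) * y) \<le> pi * real l * (real_of_int (n * (n + 1)) * Im \<tau>)"
        by (intro mult_left_mono) auto
      moreover have "pi * real l * (- Im z) \<le> pi * real l * (\<bar>Im z0\<bar> + r)"
        using Imz by (intro mult_left_mono) auto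
      ultimately show ?thesis using R(2)
        by (intro divide_right_mono) (simp_all only: exp_le_cancel_iff, simp_all add: algebra_simps)
    qed
    also have "\<dots> = M n"
    proof -
      have "exp (- (pi * real l * y) * (real (nat \<bar>n\<bar>) - 1)) = \<rho> ^ nat \<bar>n\<bar> / \<rho>"
      proof -
        have "- (pi * real l * y) * (real (nat \<bar>n\<bar>) - 1) = real (nat \<bar>n\<bar>) * (- (pi * real l * y)) - (- (pi * real l * y))"
          by (simp add: algebra_simps)
        thus ?thesis unfolding \<rho>_def by (simp only: exp_diff exp_of_nat_mult)
      qed
      thus ?thesis unfolding exp_add M_def C_def by simp
    qed
    finally show ?thesis .
  qed
  ultimately show ?thesis unfolding normally_bounded_def using R(1) M by blast
qed

text \<open>
  Since \<open>appell_term l (Suc i)\<close> arises from \<open>appell_term l i\<close> by the heat operator, Cauchy's inequality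
  on a smaller polydisc gives the bound without any explicit formula for the derivatives.
\<close>

lemma normally_bounded_appell_term:
  assumes reg: "regular A z0 \<tau>0" and l: "l > 0"
  shows "normally_bounded A (appell_term l i) z0 \<tau>0"
proof (induction i)
  case 0
  show ?case using reg l by (rule normally_bounded_appell_term_0)
next
  case (Suc i)
  then obtain r M where r: "r > 0" "M summable_on A"
    "\<And>z \<tau>. z \<in> ball z0 r \<Longrightarrow> \<tau> \<in> ball \<tau>0 r \<Longrightarrow> regular A z \<tau>"
    "\<And>z \<tau> n. z \<in> ball z0 r \<Longrightarrow> \<tau> \<in> ball \<tau>0 r \<Longrightarrow> n \<in> A \<Longrightarrow> norm (appell_term l i n z \<tau>) \<le> M n"
    unfolding normally_bounded_def by blast
  define \<rho> where "\<rho> = r / 3"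
  have \<rho>: "\<rho> > 0" using r(1) by (simp add: \<rho>_def)
  have ball: "w \<in> ball x0 r" if "x \<in> ball x0 \<rho>" "w \<in> cball x \<rho>" for x0 x w :: complex
  proof -
    have "dist x0 w \<le> dist x0 x + dist x w" by (rule dist_triangle)
    thus ?thesis using that \<rho> by (simp add: \<rho>_def)
  qed
  define C where "C = norm (of_nat l / (of_real pi * \<i>)) * (1 / \<rho>) + norm (1 / (2 * of_real pi * \<i>)\<^sup>2) * (2 / \<rho> ^ 2)"
  have "norm (appell_term l (Suc i) n z \<tau>) \<le> C * M n" if z: "z \<in> ball z0 \<rho>" and \<tau>: "\<tau> \<in> ball \<tau>0 \<rho>" and n: "n \<in> A" for z \<tau> n
  proof -
    have z': "z \<in> ball z0 r" and \<tau>': "\<tau> \<in> ball \<tau>0 r" using ball[OF z, of z] ball[OF \<tau>, of \<tau>] \<rho> by auto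
    have v: "e2pi (z + of_int n * \<tau>) \<noteq> 1" using r(3)[OF z' \<tau>'] n by (auto simp: regular_def)
    have hz: "(\<lambda>s. appell_term l i n s \<tau>) holomorphic_on cball z \<rho>"
      using r(3)[OF ball[OF z] \<tau>'] n
      by (intro holomorphic_on_subset[OF holomorphic_appell_term_z]) (auto simp: regular_def)
    have ht: "(\<lambda>t. appell_term l i n z t) holomorphic_on cball \<tau> \<rho>"
      using r(3)[OF z' ball[OF \<tau>]] n
      by (intro holomorphic_on_subset[OF holomorphic_appell_term_tau]) (auto simp: regular_def)
    have "norm ((deriv ^^ 2) (\<lambda>s. appell_term l i n s \<tau>) z) \<le> fact 2 * M n / \<rho> ^ 2"
      by (rule Cauchy_inequality[OF holomorphic_on_subset[OF hz] holomorphic_on_imp_continuous_on[OF hz] \<rho>])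
         (auto intro!: r(4) ball[OF z] \<tau>' n simp: dist_norm)
    hence 2: "norm ((deriv ^^ 2) (\<lambda>s. appell_term l i n s \<tau>) z) \<le> (2 / \<rho> ^ 2) * M n" by simp
    have "norm ((deriv ^^ 1) (\<lambda>t. appell_term l i n z t) \<tau>) \<le> fact 1 * M n / \<rho> ^ 1"
      by (rule Cauchy_inequality[OF holomorphic_on_subset[OF ht] holomorphic_on_imp_continuous_on[OF ht] \<rho>])
         (auto intro!: r(4) ball[OF \<tau>] z' n simp: dist_norm)
    hence 1: "norm (deriv (\<lambda>t. appell_term l i n z t) \<tau>) \<le> (1 / \<rho>) * M n" by simp
    have "norm (appell_term l (Suc i) n z \<tau>) \<le>
        norm (of_nat l / (of_real pi * \<i>)) * norm (deriv (\<lambda>t. appell_term l i n z t) \<tau>) +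
        norm (1 / (2 * of_real pi * \<i>)\<^sup>2) * norm ((deriv ^^ 2) (\<lambda>s. appell_term l i n s \<tau>) z)"
      unfolding heat_appell_term[OF v, symmetric] norm_mult[symmetric] by (rule norm_triangle_ineq)
    also have "\<dots> \<le> norm (of_nat l / (of_real pi * \<i>)) * ((1 / \<rho>) * M n) + norm (1 / (2 * of_real pi * \<i>)\<^sup>2) * ((2 / \<rho> ^ 2) * M n)"
      by (intro add_mono mult_left_mono 1 2) auto
    also have "\<dots> = C * M n" by (simp only: C_def distrib_right mult.assoc)
    finally show ?thesis .
  qed
  moreover have "(\<lambda>n. C * M n) summable_on A" using r(2) by (rule summable_on_cmult_right)
  moreover have "regular A z \<tau>" if "z \<in> ball z0 \<rho>" "\<tau> \<in> ball \<tau>0 \<rho>" for z \<tau>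
    using r(3)[of z \<tau>] that ball[OF that(1), of z] ball[OF that(2), of \<tau>] \<rho> by auto
  ultimately show ?case unfolding normally_bounded_def using \<rho>
    by (intro exI[of _ \<rho>] conjI exI[of _ "\<lambda>n. C * M n"]) auto
qed

definition appell_sum :: "int set \<Rightarrow> nat \<Rightarrow> nat \<Rightarrow> complex \<Rightarrow> complex \<Rightarrow> complex" where
  "appell_sum A l i z \<tau> = (\<Sum>\<^sub>\<infinity>n\<in>A. appell_term l i n z \<tau>)"

lemma
  assumes reg: "regular A z0 \<tau>0" and l: "l > 0"
  shows summable_on_appell_term: "(\<lambda>n. appell_term l i n z0 \<tau>0) summable_on A"
    and analytic_appell_sum_z: "(\<lambda>z. appell_sum A l i z \<tau>0) analytic_on {z0}"
    and analytic_appell_sum_tau: "(\<lambda>\<tau>. appell_sum A l i z0 \<tau>) analytic_on {\<tau>0}"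
    and eventually_regular_z: "\<forall>\<^sub>F z in nhds z0. regular A z \<tau>0"
    and eventually_regular_tau: "\<forall>\<^sub>F \<tau> in nhds \<tau>0. regular A z0 \<tau>"
    and heat_appell_sum: "of_nat l / (of_real pi * \<i>) * deriv (\<lambda>t. appell_sum A l i z0 t) \<tau>0
     + 1 / (2 * of_real pi * \<i>)\<^sup>2 * (deriv ^^ 2) (\<lambda>s. appell_sum A l i s \<tau>0) z0 = appell_sum A l (Suc i) z0 \<tau>0"
proof -
  obtain r M where r: "r > 0" "M summable_on A"
    "\<And>z \<tau>. z \<in> ball z0 r \<Longrightarrow> \<tau> \<in> ball \<tau>0 r \<Longrightarrow> regular A z \<tau>"
    "\<And>z \<tau> n. z \<in> ball z0 r \<Longrightarrow> \<tau> \<in> ball \<tau>0 r \<Longrightarrow> n \<in> A \<Longrightarrow> norm (appell_term l i n z \<tau>) \<le> M n"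
    using normally_bounded_appell_term[OF reg l, of i] unfolding normally_bounded_def by blast
  have c: "z0 \<in> ball z0 r" "\<tau>0 \<in> ball \<tau>0 r" using r(1) by auto
  show "(\<lambda>n. appell_term l i n z0 \<tau>0) summable_on A"
    by (rule abs_summable_summable, rule Infinite_Sum.abs_summable_on_comparison_test'[OF r(2)]) (use r(4) c in auto)
  have hz: "(\<lambda>s. appell_term l i n s \<tau>0) holomorphic_on ball z0 r" if "n \<in> A" for n
    using r(3)[OF _ c(2)] that
    by (intro holomorphic_on_subset[OF holomorphic_appell_term_z]) (auto simp: regular_def)
  have ht: "(\<lambda>t. appell_term l i n z0 t) holomorphic_on ball \<tau>0 r" if "n \<in> A" for n
    using r(3)[OF c(1)] that
    by (intro holomorphic_on_subset[OF holomorphic_appell_term_tau]) (auto simp: regular_def)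
  note Wz = holomorphic_infsum[OF open_ball hz r(4)[OF _ c(2)] r(2)] higher_deriv_infsum[OF open_ball hz r(4)[OF _ c(2)] r(2) c(1)]
  note Wt = holomorphic_infsum[OF open_ball ht r(4)[OF c(1)] r(2)] higher_deriv_infsum[OF open_ball ht r(4)[OF c(1)] r(2) c(2)]
  show "(\<lambda>z. appell_sum A l i z \<tau>0) analytic_on {z0}"
    unfolding appell_sum_def analytic_at using Wz(1) c by blast
  show "(\<lambda>\<tau>. appell_sum A l i z0 \<tau>) analytic_on {\<tau>0}"
    unfolding appell_sum_def analytic_at using Wt(1) c by blast
  show "\<forall>\<^sub>F z in nhds z0. regular A z \<tau>0"
    using eventually_nhds_in_open[OF open_ball c(1)] by eventually_elim (use r(3) c in auto)
  show "\<forall>\<^sub>F \<tau> in nhds \<tau>0. regular A z0 \<tau>"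
    using eventually_nhds_in_open[OF open_ball c(2)] by eventually_elim (use r(3) c in auto)
  have "((\<lambda>n. of_nat l / (of_real pi * \<i>) * (deriv ^^ 1) (\<lambda>t. appell_term l i n z0 t) \<tau>0
     + 1 / (2 * of_real pi * \<i>)\<^sup>2 * (deriv ^^ 2) (\<lambda>s. appell_term l i n s \<tau>0) z0) has_sum
     (of_nat l / (of_real pi * \<i>) * (deriv ^^ 1) (\<lambda>t. appell_sum A l i z0 t) \<tau>0
     + 1 / (2 * of_real pi * \<i>)\<^sup>2 * (deriv ^^ 2) (\<lambda>s. appell_sum A l i s \<tau>0) z0)) A"
    unfolding appell_sum_def by (intro has_sum_add has_sum_cmult_right Wz(2) Wt(2))
  moreover have "of_nat l / (of_real pi * \<i>) * (deriv ^^ 1) (\<lambda>t. appell_term l i n z0 t) \<tau>0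
     + 1 / (2 * of_real pi * \<i>)\<^sup>2 * (deriv ^^ 2) (\<lambda>s. appell_term l i n s \<tau>0) z0 = appell_term l (Suc i) n z0 \<tau>0" if "n \<in> A" for n
    using heat_appell_term[of z0 n \<tau>0 l i] reg that by (simp add: regular_def)
  ultimately have "((\<lambda>n. appell_term l (Suc i) n z0 \<tau>0) has_sum
     (of_nat l / (of_real pi * \<i>) * (deriv ^^ 1) (\<lambda>t. appell_sum A l i z0 t) \<tau>0
     + 1 / (2 * of_real pi * \<i>)\<^sup>2 * (deriv ^^ 2) (\<lambda>s. appell_sum A l i s \<tau>0) z0)) A"
    by (simp cong: has_sum_cong)
  thus "of_nat l / (of_real pi * \<i>) * deriv (\<lambda>t. appell_sum A l i z0 t) \<tau>0
     + 1 / (2 * of_real pi * \<i>)\<^sup>2 * (deriv ^^ 2) (\<lambda>s. appell_sum A l i s \<tau>0) z0 = appell_sum A l (Suc i) z0 \<tau>0"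
    unfolding appell_sum_def[of A l "Suc i"] by (simp add: infsumI)
qed

lemma appell_eq: "appell l z \<tau> = appell_sum UNIV l 0 z \<tau>"
proof -
  have "e2pi (of_nat l / 2 * z) * ((- 1) powi (int l * n) * e2pi (of_nat l / 2 * of_int (n * (n + 1)) * \<tau>) /
        (1 - e2pi z * e2pi \<tau> powi n)) = appell_term l 0 n z \<tau>" for n
    by (simp add: appell_term_0 e2pi_add e2pi_of_int_mult del: of_int_mult of_int_add)
  thus ?thesis unfolding appell_def appell_sum_def by (simp flip: infsum_cmult_right')
qed

lemma holomorphic_q_deriv: "f holomorphic_on upper_half_plane \<Longrightarrow> q_deriv f holomorphic_on upper_half_plane"
  unfolding q_deriv_def[abs_def] by (intro holomorphic_intros open_upper_half_plane) auto

lemma holomorphic_heat_coeff: "heat_coeff l k i holomorphic_on upper_half_plane"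
proof (induction k arbitrary: i)
  case (Suc k)
  have "(\<lambda>\<tau>. if i = 0 then 0 else heat_coeff l k (i - 1) \<tau>) holomorphic_on upper_half_plane"
    using Suc by (cases "i = 0") auto
  thus ?case unfolding heat_coeff.simps
    by (intro holomorphic_intros holomorphic_q_deriv Suc holomorphic_eisenstein_E2) auto
qed auto

text \<open>
  Each application of the heat operator either differentiates a coefficient in \<open>\<tau>\<close> or raises the
  index of \<open>appell_sum\<close>, because \<open>L (c B) = (2 l q dc/dq) B + c L B\<close> for a function \<open>c\<close> of \<open>\<tau>\<close> alone.
\<close>

lemma heat_op_iter_appell:
  assumes l: "l > 0" and "regular UNIV z \<tau>"
  shows "heat_op_iter l k (appell l) z \<tau> = (\<Sum>i\<le>k. heat_coeff l k i \<tau> * appell_sum UNIV l i z \<tau>)"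
  using assms(2)
proof (induction k arbitrary: z \<tau>)
  case 0
  thus ?case by (simp add: appell_eq)
next
  case (Suc k)
  note reg = Suc.prems
  have \<tau>: "\<tau> \<in> upper_half_plane" using reg by (simp add: regular_UNIV_iff)
  let ?F = "heat_op_iter l k (appell l)" and ?c = "heat_coeff l k" and ?B = "appell_sum UNIV l"
  define p where "p = of_real pi * \<i>"
  have p: "p \<noteq> 0" by (simp add: p_def)
  define L where "L = (of_nat l :: complex)"
  have Bt: "(\<lambda>t. ?B i z t) field_differentiable at \<tau>" for i
    using analytic_appell_sum_tau[OF reg l] analytic_on_imp_differentiable_at by blast
  have ct: "?c i field_differentiable at \<tau>" for i
    by (rule holomorphic_on_imp_differentiable_at[OF holomorphic_heat_coeff open_upper_half_plane \<tau>])
  have "deriv (\<lambda>t. ?F z t) \<tau> = deriv (\<lambda>t. \<Sum>i\<le>k. ?c i t * ?B i z t) \<tau>"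
    by (intro deriv_cong_ev refl eventually_mono[OF eventually_regular_tau[OF reg l]] Suc.IH)
  also have "\<dots> = (\<Sum>i\<le>k. deriv (?c i) \<tau> * ?B i z \<tau> + ?c i \<tau> * deriv (\<lambda>t. ?B i z t) \<tau>)"
    by (intro DERIV_imp_deriv DERIV_sum)
       (use DERIV_mult[OF field_differentiable_derivI[OF ct] field_differentiable_derivI[OF Bt]] in \<open>simp add: mult.commute add.commute\<close>)
  finally have t1: "deriv (\<lambda>t. ?F z t) \<tau> = (\<Sum>i\<le>k. deriv (?c i) \<tau> * ?B i z \<tau> + ?c i \<tau> * deriv (\<lambda>t. ?B i z t) \<tau>)" .
  obtain r where r: "r > 0" "\<And>i. i \<le> k \<Longrightarrow> (\<lambda>s. ?B i s \<tau>) holomorphic_on ball z r"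
  proof -
    have "\<forall>\<^sub>F s in nhds z. regular UNIV s \<tau>" by (rule eventually_regular_z[OF reg l])
    then obtain r where r: "r > 0" "\<And>s. s \<in> ball z r \<Longrightarrow> regular UNIV s \<tau>"
      unfolding eventually_nhds_metric by (metis dist_commute mem_ball)
    have "(\<lambda>s. ?B i s \<tau>) analytic_on ball z r" for i
      by (subst analytic_on_analytic_at) (intro ballI analytic_appell_sum_z r l)
    hence "(\<lambda>s. ?B i s \<tau>) holomorphic_on ball z r" for i by (rule analytic_imp_holomorphic)
    with r(1) show thesis using that by blast
  qed
  have "(deriv ^^ 2) (\<lambda>s. ?F s \<tau>) z = (deriv ^^ 2) (\<lambda>s. \<Sum>i\<le>k. ?c i \<tau> * ?B i s \<tau>) z"
    by (intro higher_deriv_cong_ev refl eventually_mono[OF eventually_regular_z[OF reg l]] Suc.IH)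
  also have "\<dots> = (\<Sum>i\<le>k. ?c i \<tau> * (deriv ^^ 2) (\<lambda>s. ?B i s \<tau>) z)"
  proof -
    have "(deriv ^^ 2) (\<lambda>s. \<Sum>i\<in>I. ?c i \<tau> * ?B i s \<tau>) z = (\<Sum>i\<in>I. ?c i \<tau> * (deriv ^^ 2) (\<lambda>s. ?B i s \<tau>) z)"
      if "I \<subseteq> {..k}" for I
      using finite_subset[OF that finite_atMost] that
    proof (induction I rule: finite_induct)
      case empty
      show ?case by (simp add: numeral_2_eq_2)
    next
      case (insert i I)
      have hi: "(\<lambda>s. ?B i s \<tau>) holomorphic_on ball z r" using insert r by auto
      have "(deriv ^^ 2) (\<lambda>s. ?c i \<tau> * ?B i s \<tau> + (\<Sum>i\<in>I. ?c i \<tau> * ?B i s \<tau>)) z =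
         (deriv ^^ 2) (\<lambda>s. ?c i \<tau> * ?B i s \<tau>) z + (deriv ^^ 2) (\<lambda>s. \<Sum>i\<in>I. ?c i \<tau> * ?B i s \<tau>) z"
        by (rule higher_deriv_add[of _ "ball z r"]) (use insert r in \<open>auto intro!: holomorphic_intros hi\<close>)
      also have "(deriv ^^ 2) (\<lambda>s. ?c i \<tau> * ?B i s \<tau>) z = ?c i \<tau> * (deriv ^^ 2) (\<lambda>s. ?B i s \<tau>) z"
        by (rule higher_deriv_cmult[OF hi]) (use r in auto)
      finally show ?case using insert by simp
    qed
    thus ?thesis by blast
  qed
  finally have z2: "(deriv ^^ 2) (\<lambda>s. ?F s \<tau>) z = (\<Sum>i\<le>k. ?c i \<tau> * (deriv ^^ 2) (\<lambda>s. ?B i s \<tau>) z)" .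
  define W where "W = L * (4 * of_nat k + 1) / 12 * eisenstein_E2 \<tau>"
  have H: "L / p * deriv (\<lambda>t. ?B i z t) \<tau> + 1 / (2 * p)\<^sup>2 * (deriv ^^ 2) (\<lambda>s. ?B i s \<tau>) z = ?B (Suc i) z \<tau>" for i
    using heat_appell_sum[OF reg l, of i] by (simp only: p_def L_def mult.assoc)
  have "heat_op_iter l (Suc k) (appell l) z \<tau> =
     L / p * deriv (\<lambda>t. ?F z t) \<tau> + 1 / (2 * p)\<^sup>2 * (deriv ^^ 2) (\<lambda>s. ?F s \<tau>) z - W * ?F z \<tau>"
    by (simp add: heat_op_def p_def L_def W_def algebra_simps)
  also have "\<dots> = (\<Sum>i\<le>k. 2 * L * q_deriv (?c i) \<tau> * ?B i z \<tau> + ?c i \<tau> * ?B (Suc i) z \<tau> - W * ?c i \<tau> * ?B i z \<tau>)"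
  proof -
    have a: "L / p * (c' * B + c * b1) + 1 / (2 * p)\<^sup>2 * (c * b2) - W * (c * B) =
        2 * L * (c' / (2 * p)) * B + c * B2 - W * c * B" if "L / p * b1 + 1 / (2 * p)\<^sup>2 * b2 = B2" for c c' B b1 b2 B2
    proof -
      have "L / p * (c' * B + c * b1) + 1 / (2 * p)\<^sup>2 * (c * b2) - W * (c * B) =
         2 * L * (c' / (2 * p)) * B + c * (L / p * b1 + 1 / (2 * p)\<^sup>2 * b2) - W * c * B"
        using p by (simp add: field_simps)
      thus ?thesis unfolding that .
    qed
    show ?thesis unfolding t1 z2 Suc.IH[OF reg] sum_distrib_left sum.distrib[symmetric] sum_subtractf[symmetric]
      by (intro sum.cong refl) (simp only: q_deriv_def mult.assoc[of 2 "of_real pi" \<i>] p_def[symmetric] a[OF H])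
  qed
  also have "\<dots> = (\<Sum>i\<le>Suc k. heat_coeff l (Suc k) i \<tau> * ?B i z \<tau>)"
  proof -
    have z: "heat_coeff l k (Suc k) = (\<lambda>_. 0)" by (rule heat_coeff_eq_0) simp
    have "(\<Sum>i\<le>Suc k. heat_coeff l (Suc k) i \<tau> * ?B i z \<tau>) =
       (\<Sum>i\<le>Suc k. (2 * L * q_deriv (?c i) \<tau> - W * ?c i \<tau>) * ?B i z \<tau>) + (\<Sum>i\<le>Suc k. (if i = 0 then 0 else ?c (i - 1) \<tau>) * ?B i z \<tau>)"
      unfolding sum.distrib[symmetric] by (intro sum.cong refl) (simp add: L_def W_def algebra_simps)
    also have "(\<Sum>i\<le>Suc k. (2 * L * q_deriv (?c i) \<tau> - W * ?c i \<tau>) * ?B i z \<tau>) = (\<Sum>i\<le>k. (2 * L * q_deriv (?c i) \<tau> - W * ?c i \<tau>) * ?B i z \<tau>)"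
      by (simp add: z)
    also have "(\<Sum>i\<le>Suc k. (if i = 0 then 0 else ?c (i - 1) \<tau>) * ?B i z \<tau>) = (\<Sum>i\<le>k. ?c i \<tau> * ?B (Suc i) z \<tau>)"
      by (subst sum.atMost_Suc_shift) simp
    finally show ?thesis unfolding sum.distrib[symmetric] by (simp add: algebra_simps)
  qed
  finally show ?case .
qed



section \<open>The elliptic transformation law\<close>

lemma deriv_kernel_shift:
  assumes f: "f holomorphic_on kernel_domain" and shift: "\<And>v. v \<in> kernel_domain \<Longrightarrow> f (v + 1) = c * f v"
    and v: "v \<in> kernel_domain"
  shows "deriv f (v + 1) = c * deriv f v"
proof -
  have v1: "v + 1 \<in> kernel_domain" using v by (simp add: e2pi_add)
  have "((\<lambda>w. f (w + 1)) has_field_derivative deriv f (v + 1) * 1) (at v)"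
    by (rule DERIV_chain2[of f]) (use holomorphic_derivI[OF f open_kernel_domain v1] in \<open>auto intro!: derivative_eq_intros\<close>)
  moreover have "((\<lambda>w. f (w + 1)) has_field_derivative c * deriv f v) (at v)"
  proof (rule has_field_derivative_transform_within_open[OF _ open_kernel_domain v])
    show "((\<lambda>w. c * f w) has_field_derivative c * deriv f v) (at v)"
      by (intro DERIV_cmult holomorphic_derivI[OF f open_kernel_domain v])
  qed (use shift in auto)
  ultimately show ?thesis using DERIV_unique by fastforce
qed

lemma appell_kernel_add_1:
  "v \<in> kernel_domain \<Longrightarrow> appell_kernel a i (v + 1) = e2pi a * appell_kernel a i v"
proof (induction i arbitrary: v)
  case 0
  show ?case by (simp add: e2pi_add distrib_left)
next
  case (Suc i)
  note h = holomorphic_appell_kernel[of a i]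
  have "deriv (deriv (appell_kernel a i)) (v + 1) = e2pi a * deriv (deriv (appell_kernel a i)) v"
    by (intro deriv_kernel_shift holomorphic_deriv h open_kernel_domain Suc)
  thus ?case by simp
qed

lemma geometric_identity:
  assumes "e2pi v \<noteq> 1"
  shows "e2pi ((a + of_nat l) * v) / (1 - e2pi v) = e2pi (a * v) / (1 - e2pi v) - (\<Sum>s<l. e2pi ((a + of_nat s) * v))"
proof -
  have e: "e2pi ((a + of_nat s) * v) = e2pi (a * v) * e2pi v ^ s" for s
    by (simp add: distrib_right e2pi_add e2pi_of_nat_mult)
  have n: "1 - e2pi v \<noteq> 0" using assms by simp
  have "(\<Sum>s<l. e2pi v ^ s) * (1 - e2pi v) = 1 - e2pi v ^ l"
    using sum_gp_strict[of "e2pi v" l] n by simp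
  hence "(e2pi (a * v) * (\<Sum>s<l. e2pi v ^ s)) * (1 - e2pi v) = e2pi (a * v) - e2pi (a * v) * e2pi v ^ l"
    by (simp only: mult.assoc) (simp only: right_diff_distrib mult_1_right)
  hence "e2pi (a * v) * (\<Sum>s<l. e2pi v ^ s) = (e2pi (a * v) - e2pi (a * v) * e2pi v ^ l) / (1 - e2pi v)"
    using n by (simp only: nonzero_eq_divide_eq[OF n])
  thus ?thesis unfolding e sum_distrib_left[symmetric] by (simp add: diff_divide_distrib)
qed

text \<open>
  From \<open>x\<^bsup>a+l\<^esup> / (1 - x) = x\<^sup>a / (1 - x) - \<Sum> x\<^bsup>a+s\<^esup>\<close> by differentiation: every pair of
  derivatives multiplies \<open>x\<^bsup>a+s\<^esup>\<close> by \<open>(a + s)\<^sup>2\<close>.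
\<close>

lemma appell_kernel_add_nat:
  assumes "v \<in> kernel_domain"
  shows "appell_kernel (a + of_nat l) i v = appell_kernel a i v - (\<Sum>s<l. (a + of_nat s) ^ (2 * i) * e2pi ((a + of_nat s) * v))"
  using assms
proof (induction i arbitrary: v)
  case 0
  thus ?case by (simp add: geometric_identity)
next
  case (Suc i)
  define p where "p = 2 * of_real pi * \<i>"
  have p: "p \<noteq> 0" by (simp add: p_def)
  define b where "b = (\<lambda>s. a + of_nat s)"
  define S where "S = (\<lambda>k v. \<Sum>s<l. b s ^ (2 * i) * (p * b s) ^ k * e2pi (b s * v))"
  have dS: "(S k has_field_derivative S (Suc k) v) (at v)" for k v
    unfolding S_def
    by (rule DERIV_cong[OF DERIV_sum], rule DERIV_cmult, rule has_field_derivative_e2pi, rule DERIV_cmult_Id)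
       (simp add: p_def mult_ac)
  let ?K = "appell_kernel a i" and ?K' = "appell_kernel (a + of_nat l) i"
  note h = holomorphic_appell_kernel[of a i]
  have 1: "deriv ?K' w = deriv ?K w - S 1 w" if w: "w \<in> kernel_domain" for w
  proof (rule DERIV_imp_deriv, rule has_field_derivative_transform_within_open[OF _ open_kernel_domain w])
    show "((\<lambda>w. ?K w - S 0 w) has_field_derivative deriv ?K w - S 1 w) (at w)"
      using dS[of 0 w] by (intro DERIV_diff holomorphic_derivI[OF h open_kernel_domain w]) simp
  qed (simp add: Suc.IH S_def b_def)
  have "deriv (deriv ?K') v = deriv (deriv ?K) v - S 2 v"
  proof (rule DERIV_imp_deriv, rule has_field_derivative_transform_within_open[OF _ open_kernel_domain Suc.prems])
    show "((\<lambda>w. deriv ?K w - S 1 w) has_field_derivative deriv (deriv ?K) v - S 2 v) (at v)"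
      using dS[of 1 v]
      by (intro DERIV_diff holomorphic_derivI[OF holomorphic_deriv[OF h open_kernel_domain] open_kernel_domain Suc.prems])
         (simp add: numeral_2_eq_2)
  qed (simp add: 1)
  moreover have "S 2 v / p\<^sup>2 = (\<Sum>s<l. b s ^ (2 * Suc i) * e2pi (b s * v))"
    unfolding S_def sum_divide_distrib using p
    by (intro sum.cong refl) (simp add: power_mult_distrib power_add power2_eq_square)
  ultimately show ?case by (simp add: p_def[symmetric] b_def diff_divide_distrib)
qed

text \<open>
  The term of the theta series that multiplies \<open>w\<^bsup>s - l/2\<^esup>\<close> in the failure of \<open>L\<^sup>i A\<^sub>l\<close> to be
  elliptic.
\<close>

definition theta_term :: "nat \<Rightarrow> nat \<Rightarrow> nat \<Rightarrow> complex \<Rightarrow> int \<Rightarrow> complex" where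
  "theta_term l i s \<tau> N = (-1) powi (int l * N) * (of_nat l * of_int N - of_nat l / 2 + of_nat s) ^ (2 * i) *
     e2pi ((of_nat l * of_int N ^ 2 / 2 + (of_nat s - of_nat l / 2) * of_int N) * \<tau>)"

lemma summable_on_theta_term:
  assumes \<tau>: "\<tau> \<in> upper_half_plane" and s: "s < l"
  shows "theta_term l i s \<tau> summable_on UNIV"
proof -
  have y: "Im \<tau> > 0" using \<tau> by (simp add: upper_half_plane_def)
  have l: "l > 0" using s by simp
  define \<rho> where "\<rho> = exp (- (pi * real l * Im \<tau>))"
  have \<rho>: "0 < \<rho>" "\<rho> < 1" using y l by (auto simp: \<rho>_def)
  define M where "M = (\<lambda>n. real l ^ (2 * i) / \<rho> * ((1 + real n) ^ (2 * i) * \<rho> ^ n))"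
  have M: "(\<lambda>N::int. M (nat \<bar>N\<bar>)) summable_on UNIV"
    by (rule summable_on_int_abs) (use \<rho> in \<open>auto simp: M_def intro!: summable_mult summable_power_times_geometric\<close>)
  have "norm (theta_term l i s \<tau> N) \<le> M (nat \<bar>N\<bar>)" for N
  proof -
    define n where "n = real (nat \<bar>N\<bar>)"
    have n: "n = \<bar>real_of_int N\<bar>" by (simp add: n_def)
    define d where "d = real s - real l / 2"
    have "real s < real l" using s by simp
    hence d: "\<bar>d\<bar> \<le> real l / 2" unfolding d_def by linarith
    have "norm (of_nat l * of_int N - of_nat l / 2 + of_nat s :: complex) = \<bar>real l * real_of_int N + d\<bar>"
    proof -
      have "of_nat l * of_int N - of_nat l / 2 + of_nat s = (of_real (real l * real_of_int N + d) :: complex)"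
        by (simp add: d_def)
      thus ?thesis by (simp only: norm_of_real)
    qed
    also have "\<dots> \<le> real l * n + \<bar>d\<bar>"
      unfolding n by (rule order_trans[OF abs_triangle_ineq]) (simp add: abs_mult)
    also have "\<dots> \<le> real l * (1 + n)" using d by (simp add: algebra_simps)
    finally have 1: "norm (of_nat l * of_int N - of_nat l / 2 + of_nat s :: complex) ^ (2 * i) \<le> (real l * (1 + n)) ^ (2 * i)"
      by (intro power_mono) auto
    have "\<bar>d * real_of_int N\<bar> = \<bar>d\<bar> * n" by (simp add: n abs_mult)
    hence "- (\<bar>d\<bar> * n) \<le> d * real_of_int N" by linarith
    moreover have "real l / 2 * n \<ge> \<bar>d\<bar> * n" using d by (intro mult_right_mono) (auto simp: n)
    moreover have "n ^ 2 = real_of_int N ^ 2" by (simp add: n)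
    moreover have "real l / 2 * (n - 1) ^ 2 \<ge> 0" by simp
    ultimately have "real l / 2 * (n - 1) \<le> real l * real_of_int N ^ 2 / 2 + d * real_of_int N"
      by (simp add: power2_diff algebra_simps)
    hence "2 * pi * (real l / 2 * (n - 1) * Im \<tau>) \<le> 2 * pi * ((real l * real_of_int N ^ 2 / 2 + d * real_of_int N) * Im \<tau>)"
      using y by (intro mult_left_mono mult_right_mono) auto
    hence "exp (- (2 * pi * ((real l * real_of_int N ^ 2 / 2 + d * real_of_int N) * Im \<tau>))) \<le> exp (- (2 * pi * (real l / 2 * (n - 1) * Im \<tau>)))"
      by (simp only: exp_le_cancel_iff neg_le_iff_le)
    also have "- (2 * pi * (real l / 2 * (n - 1) * Im \<tau>)) = n * (- (pi * real l * Im \<tau>)) - (- (pi * real l * Im \<tau>))"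
      by (simp add: field_simps)
    also have "exp \<dots> = \<rho> ^ nat \<bar>N\<bar> / \<rho>"
      unfolding \<rho>_def n_def by (simp only: exp_diff exp_of_nat_mult)
    finally have "exp (- (2 * pi * ((real l * real_of_int N ^ 2 / 2 + d * real_of_int N) * Im \<tau>))) \<le> \<rho> ^ nat \<bar>N\<bar> / \<rho>" .
    moreover have "Im ((of_nat l * of_int N ^ 2 / 2 + (of_nat s - of_nat l / 2) * of_int N) * \<tau>) =
        (real l * real_of_int N ^ 2 / 2 + d * real_of_int N) * Im \<tau>"
    proof -
      have "of_nat l * of_int N ^ 2 / 2 + (of_nat s - of_nat l / 2) * of_int N =
         (of_real (real l * real_of_int N ^ 2 / 2 + d * real_of_int N) :: complex)" by (simp add: d_def)
      moreover have "Im (of_real r * \<tau>) = r * Im \<tau>" for r by simp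
      ultimately show ?thesis by (simp only:)
    qed
    ultimately have 2: "norm (e2pi ((of_nat l * of_int N ^ 2 / 2 + (of_nat s - of_nat l / 2) * of_int N) * \<tau>)) \<le> \<rho> ^ nat \<bar>N\<bar> / \<rho>"
      by (simp only: norm_e2pi)
    have "norm (theta_term l i s \<tau> N) \<le> (real l * (1 + n)) ^ (2 * i) * (\<rho> ^ nat \<bar>N\<bar> / \<rho>)"
      unfolding theta_term_def norm_mult norm_minus_one_powi norm_power mult_1 using 1 2 \<rho>
      by (intro mult_mono) auto
    also have "\<dots> = M (nat \<bar>N\<bar>)" by (simp add: M_def n_def power_mult_distrib)
    finally show ?thesis .
  qed
  thus ?thesis
    by (rule abs_summable_summable[OF Infinite_Sum.abs_summable_on_comparison_test'[OF M]])
qed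

lemma has_sum_finite_sum:
  fixes f :: "'s \<Rightarrow> 'n \<Rightarrow> complex"
  assumes "finite S" "\<And>s. s \<in> S \<Longrightarrow> (f s has_sum g s) A"
  shows "((\<lambda>n. \<Sum>s\<in>S. f s n) has_sum (\<Sum>s\<in>S. g s)) A"
  using assms by (induction S rule: finite_induct) (auto intro: has_sum_add)

lemma appell_gauss_shift:
  assumes "odd l"
  shows "appell_gauss l n (z + \<tau>) \<tau> = - e2pi (of_nat l * z + of_nat l * \<tau> / 2) * appell_gauss l (n + 1) z \<tau>"
proof -
  have "(-1 :: complex) powi (int l * (n + 1)) = - ((-1) powi (int l * n))"
    using assms by (simp add: distrib_left power_int_add)
  moreover have "e2pi (- (of_nat l * of_int n ^ 2 / 2) * \<tau> - of_nat l * of_int n * (z + \<tau>)) =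
     e2pi (of_nat l * z + of_nat l * \<tau> / 2) * e2pi (- (of_nat l * of_int (n + 1) ^ 2 / 2) * \<tau> - of_nat l * of_int (n + 1) * z)"
    unfolding e2pi_add[symmetric] by (rule arg_cong[of _ _ e2pi]) (simp add: field_simps power2_eq_square)
  ultimately show ?thesis unfolding appell_gauss_def by simp
qed

text \<open>
  The shift by \<open>\<tau>\<close> leads to the kernel of the next term, except that its exponent is smaller by \<open>l\<close>. The
  geometric sum that repairs this does not involve a denominator and is the source of the theta
  series.
\<close>

lemma appell_term_add_tau:
  assumes l: "odd l" and v: "e2pi (z + of_int (n + 1) * \<tau>) \<noteq> 1"
  shows "appell_term l i n (z + \<tau>) \<tau> = - e2pi (of_nat l * z + of_nat l * \<tau> / 2) *
     (appell_term l i (n + 1) z \<tau> + (\<Sum>s<l. e2pi ((of_nat s - of_nat l / 2) * z) * theta_term l i s \<tau> (n + 1)))"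
proof -
  define a where "a = of_nat l * (1 / 2 + of_int n :: complex)"
  let ?v = "z + of_int (n + 1) * \<tau>"
  have a1: "of_nat l * (1 / 2 + of_int (n + 1)) = a + of_nat l"
    by (simp add: a_def algebra_simps)
  have K: "appell_kernel a i ?v = appell_kernel (a + of_nat l) i ?v + (\<Sum>s<l. (a + of_nat s) ^ (2 * i) * e2pi ((a + of_nat s) * ?v))"
    using appell_kernel_add_nat[of ?v a l i] v by simp
  have t: "appell_gauss l (n + 1) z \<tau> * ((a + of_nat s) ^ (2 * i) * e2pi ((a + of_nat s) * ?v)) =
     e2pi ((of_nat s - of_nat l / 2) * z) * theta_term l i s \<tau> (n + 1)" for s
  proof -
    have as: "a + of_nat s = of_nat l * of_int (n + 1) - of_nat l / 2 + of_nat s"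
      by (simp add: a_def field_simps)
    have "e2pi (- (of_nat l * of_int (n + 1) ^ 2 / 2) * \<tau> - of_nat l * of_int (n + 1) * z) * e2pi ((a + of_nat s) * ?v) =
       e2pi ((of_nat s - of_nat l / 2) * z) * e2pi ((of_nat l * of_int (n + 1) ^ 2 / 2 + (of_nat s - of_nat l / 2) * of_int (n + 1)) * \<tau>)"
      unfolding e2pi_add[symmetric] as by (rule arg_cong[of _ _ e2pi]) (simp add: field_simps power2_eq_square)
    thus ?thesis unfolding appell_gauss_def theta_term_def as[symmetric] by (simp add: mult_ac)
  qed
  have "z + \<tau> + of_int n * \<tau> = ?v" by (simp add: algebra_simps)
  hence "appell_term l i n (z + \<tau>) \<tau> = appell_gauss l n (z + \<tau>) \<tau> * appell_kernel a i ?v"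
    by (simp only: appell_term_def a_def)
  also have "\<dots> = - e2pi (of_nat l * z + of_nat l * \<tau> / 2) * (appell_gauss l (n + 1) z \<tau> * appell_kernel (a + of_nat l) i ?v
      + (\<Sum>s<l. appell_gauss l (n + 1) z \<tau> * ((a + of_nat s) ^ (2 * i) * e2pi ((a + of_nat s) * ?v))))"
    unfolding appell_gauss_shift[OF l] K by (simp only: distrib_left sum_distrib_left mult.assoc)
  finally show ?thesis unfolding t by (simp only: appell_term_def a1)
qed

lemma appell_sum_add_tau:
  assumes l: "odd l" and reg: "regular UNIV z \<tau>"
  shows "appell_sum UNIV l i (z + \<tau>) \<tau> = - e2pi (of_nat l * z + of_nat l * \<tau> / 2) *
     (appell_sum UNIV l i z \<tau> + (\<Sum>s<l. e2pi ((of_nat s - of_nat l / 2) * z) * infsum (theta_term l i s \<tau>) UNIV))"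
proof -
  have \<tau>: "\<tau> \<in> upper_half_plane" and v: "e2pi (z + of_int n * \<tau>) \<noteq> 1" for n
    using reg by (auto simp: regular_def upper_half_plane_def)
  have l0: "l > 0" using l by (cases l) auto
  have b: "bij_betw (\<lambda>n::int. n + 1) UNIV UNIV"
    by (rule bij_betwI[where g = "\<lambda>n. n - 1"]) auto
  have "((\<lambda>n. appell_term l i n z \<tau> + (\<Sum>s<l. e2pi ((of_nat s - of_nat l / 2) * z) * theta_term l i s \<tau> n)) has_sum
     (appell_sum UNIV l i z \<tau> + (\<Sum>s<l. e2pi ((of_nat s - of_nat l / 2) * z) * infsum (theta_term l i s \<tau>) UNIV))) UNIV"
    unfolding appell_sum_def using summable_on_appell_term[OF reg l0]
    by (intro has_sum_add has_sum_finite_sum has_sum_cmult_right has_sum_infsum summable_on_theta_term \<tau>) auto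
  hence "((\<lambda>n. appell_term l i (n + 1) z \<tau> + (\<Sum>s<l. e2pi ((of_nat s - of_nat l / 2) * z) * theta_term l i s \<tau> (n + 1))) has_sum
     (appell_sum UNIV l i z \<tau> + (\<Sum>s<l. e2pi ((of_nat s - of_nat l / 2) * z) * infsum (theta_term l i s \<tau>) UNIV))) UNIV"
    by (subst has_sum_reindex_bij_betw[OF b])
  from has_sum_cmult_right[OF this, of "- e2pi (of_nat l * z + of_nat l * \<tau> / 2)"]
  show ?thesis unfolding appell_sum_def[of _ _ _ "z + \<tau>"] appell_term_add_tau[OF l v, symmetric] by (rule infsumI)
qed

lemma appell_sum_add_1:
  assumes l: "odd l" and reg: "regular UNIV z \<tau>"
  shows "appell_sum UNIV l i (z + 1) \<tau> = - appell_sum UNIV l i z \<tau>"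
proof -
  have v: "e2pi (z + of_int n * \<tau>) \<noteq> 1" for n using reg by (auto simp: regular_def)
  have "appell_term l i n (z + 1) \<tau> = - appell_term l i n z \<tau>" for n
  proof -
    let ?v = "z + of_int n * \<tau>"
    have "appell_gauss l n (z + 1) \<tau> = appell_gauss l n z \<tau>"
      using e2pi_of_int[of "int l * n"] by (simp add: appell_gauss_def distrib_left diff_add_eq_diff_diff_swap e2pi_diff)
    moreover have "appell_kernel (of_nat l * (1 / 2 + of_int n)) i (?v + 1) =
       e2pi (of_nat l * (1 / 2 + of_int n)) * appell_kernel (of_nat l * (1 / 2 + of_int n)) i ?v"
      using v by (intro appell_kernel_add_1) auto
    moreover have "e2pi (of_nat l * (1 / 2 + of_int n)) = -1"
    proof -
      have "e2pi (of_nat l * (1 / 2 + of_int n)) = e2pi (of_int (int l) / 2) * e2pi (of_int (int l * n))"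
        unfolding e2pi_add[symmetric] by (simp add: distrib_left)
      thus ?thesis using l by (simp only: e2pi_half_of_int e2pi_of_int) simp
    qed
    ultimately show ?thesis by (simp add: appell_term_def add_ac)
  qed
  thus ?thesis by (simp add: appell_sum_def infsum_uminus)
qed

section \<open>Principal parts at the origin\<close>

lemma e2pi_ne_1_near_0:
  assumes "v \<in> ball 0 1 - {0}"
  shows "e2pi v \<noteq> 1"
proof
  assume "e2pi v = 1"
  then obtain n :: int where n: "v = of_int n" by (auto simp: e2pi_eq_1_iff Ints_def)
  hence "\<bar>real_of_int n\<bar> < 1" "n \<noteq> 0" using assms by auto
  thus False by linarith
qed

text \<open>
  The pole of \<open>e2pi (a v) / (1 - e2pi v)\<close> at \<open>0\<close> is simple with a residue that is independent of \<open>a\<close>.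
  Differentiating the polar term twice replaces \<open>(2 i)! / (p v)\<^bsup>2i+1\<^esup>\<close> by
  \<open>(2 i + 2)! p\<^sup>2 / (p v)\<^bsup>2i+3\<^esup>\<close>, where \<open>p = 2 \<pi> \<i>\<close>.
\<close>

lemma appell_kernel_principal_part:
  "\<exists>h. h holomorphic_on ball 0 1 \<and> (\<forall>v\<in>ball 0 1 - {0}.
     appell_kernel a i v = h v - fact (2 * i) / (2 * of_real pi * \<i> * v) ^ (2 * i + 1))"
proof (induction i)
  case 0
  define p where "p = 2 * of_real pi * \<i>"
  have p: "p \<noteq> 0" by (simp add: p_def)
  define f where "f = (\<lambda>v. e2pi (a * v) * (v / (1 - e2pi v)))"
  define F where "F = (\<lambda>v. if v = 0 then - 1 / p else f v)"
  have "((\<lambda>v. 1 - e2pi v) has_field_derivative - p) (at 0)"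
    unfolding p_def by (auto intro!: derivative_eq_intros)
  hence "((\<lambda>v. (1 - e2pi v) / v) \<longlongrightarrow> - p) (at 0)" by (simp add: has_field_derivative_iff)
  hence "((\<lambda>v. inverse ((1 - e2pi v) / v)) \<longlongrightarrow> inverse (- p)) (at 0)"
    using p by (intro tendsto_inverse) auto
  hence "((\<lambda>v. e2pi (a * v) * (v / (1 - e2pi v))) \<longlongrightarrow> e2pi (a * 0) * inverse (- p)) (at 0)"
    by (intro tendsto_mult tendsto_e2pi tendsto_intros) (simp add: inverse_eq_divide)
  hence lim: "(f \<longlongrightarrow> - 1 / p) (at 0)" by (simp add: f_def inverse_eq_divide)
  have F: "F holomorphic_on ball 0 1"
  proof (rule no_isolated_singularity'[where K = "{0}"])
    have "f holomorphic_on ball 0 1 - {0}"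
      unfolding f_def using e2pi_ne_1_near_0 by (intro holomorphic_intros) auto
    thus "F holomorphic_on ball 0 1 - {0}"
      by (rule holomorphic_transform) (auto simp: F_def)
    have "(F \<longlongrightarrow> - 1 / p) (at 0)" using lim
      by (rule Lim_transform_eventually) (auto simp: F_def eventually_at_filter)
    thus "(F \<longlongrightarrow> F z) (at z within ball 0 1)" if "z \<in> {0}" for z
      using that by (auto simp: F_def intro: tendsto_within_subset)
  qed auto
  define h where "h = (\<lambda>v. if v = 0 then deriv F 0 else (F v - F 0) / (v - 0))"
  have "h holomorphic_on ball 0 1" unfolding h_def by (rule pole_lemma[OF F]) simp
  moreover have "appell_kernel a 0 v = h v - 1 / (p * v)" if "v \<in> ball 0 1 - {0}" for v
    using that e2pi_ne_1_near_0[OF that] p by (simp add: h_def F_def f_def field_simps)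
  ultimately show ?case by (intro exI[of _ h]) (simp add: p_def)
next
  case (Suc i)
  define p where "p = 2 * of_real pi * \<i>"
  have p: "p \<noteq> 0" by (simp add: p_def)
  from Suc obtain h where h: "h holomorphic_on ball 0 1"
    "\<And>v. v \<in> ball 0 1 - {0} \<Longrightarrow> appell_kernel a i v = h v - fact (2 * i) / (p * v) ^ (2 * i + 1)"
    unfolding p_def by blast
  let ?U = "ball 0 1 - {0} :: complex set" and ?K = "appell_kernel a i"
  have U: "open ?U" by auto
  define P where "P = (\<lambda>k v. (\<Prod>j<k. of_nat (2 * i + 1 + j)) * (- p) ^ k * fact (2 * i) / (p * v) ^ (2 * i + 1 + k))"
  have dP: "(P k has_field_derivative P (Suc k) v) (at v)" if "v \<noteq> 0" for k v
  proof -
    define N where "N = 2 * i + k"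
    have N: "2 * i + 1 + k = Suc N" "2 * i + 1 + Suc k = Suc (Suc N)" by (simp_all add: N_def)
    have "((\<lambda>v. c / (p * v) ^ Suc N) has_field_derivative (- p * of_nat (Suc N) * c) / (p * v) ^ Suc (Suc N)) (at v)" for c
    proof (rule DERIV_cong[OF DERIV_divide[OF DERIV_const DERIV_power[OF DERIV_cmult_Id]]])
      show "(p * v) ^ Suc N \<noteq> 0" using that p by simp
      have "(0 * X ^ Suc N - c * (of_nat (Suc N) * (p * X ^ (Suc N - Suc 0)))) / (X ^ Suc N * X ^ Suc N) =
          (- p * of_nat (Suc N) * c) / X ^ Suc (Suc N)" if "X \<noteq> 0" for X
        using that by (simp add: divide_simps del: of_nat_Suc)
      thus "(0 * (p * v) ^ Suc N - c * (of_nat (Suc N) * (p * (p * v) ^ (Suc N - Suc 0)))) / ((p * v) ^ Suc N * (p * v) ^ Suc N) =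
          (- p * of_nat (Suc N) * c) / (p * v) ^ Suc (Suc N)" using that p by simp
    qed
    from this[of "(\<Prod>j<k. of_nat (2 * i + 1 + j)) * (- p) ^ k * fact (2 * i)"] show ?thesis
      unfolding P_def N by (simp add: N_def mult_ac del: of_nat_Suc)
  qed
  have hd: "deriv h holomorphic_on ball 0 1" by (rule holomorphic_deriv[OF h(1)]) auto
  have 1: "deriv ?K w = deriv h w - P 1 w" if w: "w \<in> ?U" for w
  proof (rule DERIV_imp_deriv, rule has_field_derivative_transform_within_open[OF _ U w])
    show "((\<lambda>w. h w - P 0 w) has_field_derivative deriv h w - P 1 w) (at w)"
      using dP[of w 0] w by (intro DERIV_diff holomorphic_derivI[OF h(1)]) auto
  qed (simp add: h(2) P_def)
  have 2: "deriv (deriv ?K) w = deriv (deriv h) w - P 2 w" if w: "w \<in> ?U" for w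
  proof (rule DERIV_imp_deriv, rule has_field_derivative_transform_within_open[OF _ U w])
    show "((\<lambda>w. deriv h w - P 1 w) has_field_derivative deriv (deriv h) w - P 2 w) (at w)"
      using dP[of w 1] w by (intro DERIV_diff holomorphic_derivI[OF hd]) (auto simp: numeral_2_eq_2)
  qed (simp add: 1)
  show ?case
  proof (intro exI[of _ "\<lambda>v. deriv (deriv h) v / p\<^sup>2"] conjI ballI)
    show "(\<lambda>v. deriv (deriv h) v / p\<^sup>2) holomorphic_on ball 0 1"
      using p by (intro holomorphic_intros holomorphic_deriv[OF hd]) auto
    fix v assume v: "v \<in> ?U"
    have f: "fact (2 * Suc i) = (of_nat (2 * i + 1) * of_nat (2 * i + 2) * fact (2 * i) :: complex)"
      by (simp add: algebra_simps)
    have "P 2 v / p\<^sup>2 = fact (2 * Suc i) / (p * v) ^ (2 * Suc i + 1)"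
    proof -
      have pr: "(\<Prod>j<2. of_nat (2 * i + 1 + j)) = (of_nat (2 * i + 1) * of_nat (2 * i + 2) :: complex)"
        by (simp add: numeral_2_eq_2)
      have ex: "2 * i + 1 + 2 = 2 * Suc i + 1" by simp
      have "A * p\<^sup>2 * F / X / p\<^sup>2 = A * F / X" for A F X :: complex using p by simp
      thus ?thesis unfolding P_def f pr ex power2_minus by blast
    qed
    thus "appell_kernel a (Suc i) v = deriv (deriv h) v / p\<^sup>2 - fact (2 * Suc i) / (2 * of_real pi * \<i> * v) ^ (2 * Suc i + 1)"
      using 2[OF v] by (simp add: p_def[symmetric] diff_divide_distrib)
  qed
qed

lemma appell_sum_principal_part:
  assumes \<tau>: "\<tau> \<in> upper_half_plane" and l: "l > 0"
  shows "\<exists>L. ((\<lambda>z. appell_sum UNIV l i z \<tau> + fact (2 * i) / (2 * of_real pi * \<i> * z) ^ (2 * i + 1)) \<longlongrightarrow> L) (at 0)"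
proof -
  define a where "a = of_nat l * (1 / 2 + of_int 0 :: complex)"
  obtain h where h: "h holomorphic_on ball 0 1"
    "\<And>v. v \<in> ball 0 1 - {0} \<Longrightarrow> appell_kernel a i v = h v - fact (2 * i) / (2 * of_real pi * \<i> * v) ^ (2 * i + 1)"
    using appell_kernel_principal_part[of a i] by blast
  define B where "B = (\<lambda>z. appell_sum (UNIV - {0}) l i z \<tau>)"
  note reg = regular_0[OF \<tau>]
  have "B analytic_on {0}" unfolding B_def by (rule analytic_appell_sum_z[OF reg l])
  hence "isCont B 0" by (rule analytic_at_imp_isCont)
  moreover have "isCont h 0"
    using holomorphic_on_imp_continuous_on[OF h(1)] by (auto simp: continuous_on_eq_continuous_at)
  ultimately have "((\<lambda>z. h z + B z) \<longlongrightarrow> h 0 + B 0) (at 0)"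
    by (intro tendsto_add) (auto simp: isCont_def)
  hence "((\<lambda>z. appell_sum UNIV l i z \<tau> + fact (2 * i) / (2 * of_real pi * \<i> * z) ^ (2 * i + 1)) \<longlongrightarrow> h 0 + B 0) (at 0)"
  proof (rule Lim_transform_eventually)
    show "\<forall>\<^sub>F z in at 0. h z + B z = appell_sum UNIV l i z \<tau> + fact (2 * i) / (2 * of_real pi * \<i> * z) ^ (2 * i + 1)"
  proof -
    have "\<forall>\<^sub>F z in at 0. regular (UNIV - {0}) z \<tau>"
      unfolding eventually_at_filter by (rule eventually_mono[OF eventually_regular_z[OF reg l]]) simp
    moreover have "\<forall>\<^sub>F z in at (0::complex). z \<in> ball 0 1 - {0}"
      by (rule eventually_at_in_open) auto
    ultimately show ?thesis
    proof eventually_elim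
      case (elim z)
      have "appell_sum UNIV l i z \<tau> = infsum (\<lambda>n. appell_term l i n z \<tau>) (insert 0 (UNIV - {0}))"
        by (simp add: appell_sum_def insert_absorb)
      also have "\<dots> = appell_term l i 0 z \<tau> + B z"
        unfolding B_def appell_sum_def by (rule infsum_insert[OF summable_on_appell_term[OF elim(1) l]]) simp
      also have "appell_term l i 0 z \<tau> = appell_kernel a i z"
        by (simp add: appell_term_def appell_gauss_def a_def)
      finally show ?case using h(2)[OF elim(2)] by simp
    qed
  qed
  qed
  thus ?thesis by blast
qed

lemma has_fps_expansion_remainder:
  fixes f :: "complex \<Rightarrow> complex"
  assumes f: "f has_fps_expansion F"
  shows "((\<lambda>u. (f u - (\<Sum>s<n. fps_nth F s * u ^ s)) / u ^ n) \<longlongrightarrow> fps_nth F n) (at 0)"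
proof -
  define g where "g = eval_fps (fps_shift n F)"
  have g: "g has_fps_expansion fps_shift n F"
    unfolding g_def using f by (intro eval_fps_has_fps_expansion) (auto simp: has_fps_expansion_def)
  have "(\<lambda>u. u ^ n * g u + (\<Sum>s<n. fps_nth F s * u ^ s)) has_fps_expansion fps_X ^ n * fps_shift n F + (\<Sum>s<n. fps_const (fps_nth F s) * fps_X ^ s)"
    by (intro fps_expansion_intros g)
  also have "(\<Sum>s<n. fps_const (fps_nth F s) * fps_X ^ s) = fps_cutoff n F"
    by (rule fps_ext) (simp add: fps_sum_nth fps_X_power_nth if_distrib cong: if_cong)
  finally have e: "(\<lambda>u. u ^ n * g u + (\<Sum>s<n. fps_nth F s * u ^ s)) has_fps_expansion F"
    by (simp only: fps_shift_cutoff')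
  have "\<forall>\<^sub>F u in nhds 0. f u = u ^ n * g u + (\<Sum>s<n. fps_nth F s * u ^ s)"
  proof -
    have "\<forall>\<^sub>F u in nhds 0. eval_fps F u = f u" "\<forall>\<^sub>F u in nhds 0. eval_fps F u = u ^ n * g u + (\<Sum>s<n. fps_nth F s * u ^ s)"
      using f e by (simp_all add: has_fps_expansion_def)
    thus ?thesis by eventually_elim simp
  qed
  hence ev: "\<forall>\<^sub>F u in at 0. g u = (f u - (\<Sum>s<n. fps_nth F s * u ^ s)) / u ^ n"
    by (auto simp: eventually_at_filter elim!: eventually_mono)
  have "isCont g 0" using has_fps_expansion_imp_continuous[OF g, of UNIV] by simp
  hence "(g \<longlongrightarrow> g 0) (at 0)" by (simp add: isCont_def)
  moreover have "g 0 = fps_nth F n" by (simp add: g_def eval_fps_at_0)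
  ultimately show ?thesis using ev by (simp add: Lim_transform_eventually)
qed

text \<open>
  Near \<open>0\<close> the \<open>l\<close>-th power is \<open>- exp (l \<chi>) / u\<^sup>l\<close>. The odd coefficients of \<open>exp (l \<chi>)\<close> vanish, so its
  principal part consists of odd powers of \<open>1 / u\<close> only.
\<close>

lemma crank_principal_part:
  assumes \<tau>: "\<tau> \<in> upper_half_plane"
  shows "\<exists>L. ((\<lambda>z. inverse (crank_theta z \<tau>) ^ (2 * m + 1) +
     (\<Sum>i\<le>m. crank_nth (2 * m + 1) (2 * (m - i)) \<tau> / (2 * of_real pi * \<i> * z) ^ (2 * i + 1))) \<longlongrightarrow> L) (at 0)"
proof -
  let ?l = "2 * m + 1" and ?p = "2 * of_real pi * \<i>"
  define f where "f = (\<lambda>u. exp (of_nat ?l * theta_log u \<tau>))"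
  define R where "R = (\<lambda>u. (f u - (\<Sum>s<?l. crank_nth ?l s \<tau> * u ^ s)) / u ^ ?l)"
  have R: "(R \<longlongrightarrow> crank_nth ?l ?l \<tau>) (at 0)"
    using has_fps_expansion_remainder[OF has_fps_expansion_crank[OF \<tau>, of ?l], of ?l] by (simp add: R_def f_def)
  have lim0: "filterlim (\<lambda>z. ?p * z) (at 0) (at 0)"
    by (rule filterlim_atI) (auto intro!: tendsto_eq_intros eventually_neq_at_within elim!: eventually_mono simp: eventually_at_filter)
  have "((\<lambda>z. - R (?p * z)) \<longlongrightarrow> - crank_nth ?l ?l \<tau>) (at 0)"
    by (intro tendsto_minus filterlim_compose[OF R lim0])
  hence "((\<lambda>z. inverse (crank_theta z \<tau>) ^ ?l +
     (\<Sum>i\<le>m. crank_nth ?l (2 * (m - i)) \<tau> / (?p * z) ^ (2 * i + 1))) \<longlongrightarrow> - crank_nth ?l ?l \<tau>) (at 0)"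
  proof (rule Lim_transform_eventually)
    show "\<forall>\<^sub>F z in at 0. - R (?p * z) = inverse (crank_theta z \<tau>) ^ ?l +
     (\<Sum>i\<le>m. crank_nth ?l (2 * (m - i)) \<tau> / (?p * z) ^ (2 * i + 1))"
  proof -
    have "\<forall>\<^sub>F u in at 0. u \<in> ball 0 (theta_log_radius \<tau>) - {0}"
      using theta_log_radius[OF \<tau>] by (intro eventually_at_in_open) auto
    hence "\<forall>\<^sub>F z in at 0. ?p * z \<in> ball 0 (theta_log_radius \<tau>) - {0}"
      using lim0 unfolding filterlim_iff by blast
    thus ?thesis
    proof eventually_elim
      case (elim z)
      define u where "u = ?p * z"
      have u: "u \<in> ball 0 (theta_log_radius \<tau>)" "u \<noteq> 0" using elim by (auto simp: u_def)
      have "crank_theta z \<tau> = - u * exp (- theta_log u \<tau>)"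
        using crank_theta_eq_exp[OF \<tau> u(1)] by (simp add: u_def)
      hence "inverse (crank_theta z \<tau>) = - (exp (theta_log u \<tau>) / u)"
        by (simp add: exp_minus divide_inverse)
      hence 1: "inverse (crank_theta z \<tau>) ^ ?l = - (f u / u ^ ?l)"
        by (simp add: f_def power_divide exp_of_nat_mult[symmetric] del: of_nat_add of_nat_mult power_Suc)
      have "(\<Sum>s<?l. crank_nth ?l s \<tau> * u ^ s) = (\<Sum>s\<in>(\<lambda>i. 2 * (m - i)) ` {..m}. crank_nth ?l s \<tau> * u ^ s)"
      proof (rule sum.mono_neutral_right)
        show "\<forall>s\<in>{..<?l} - (\<lambda>i. 2 * (m - i)) ` {..m}. crank_nth ?l s \<tau> * u ^ s = 0"
        proof
          fix s assume s: "s \<in> {..<?l} - (\<lambda>i. 2 * (m - i)) ` {..m}"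
          have "odd s"
          proof
            assume "even s"
            then obtain r where r: "s = 2 * r" by auto
            hence "s = 2 * (m - (m - r))" "m - r \<le> m" using s by auto
            thus False using s by blast
          qed
          thus "crank_nth ?l s \<tau> * u ^ s = 0" using crank_nth_eq(2)[OF \<tau>] by simp
        qed
      qed auto
      also have "\<dots> = (\<Sum>i\<le>m. crank_nth ?l (2 * (m - i)) \<tau> * u ^ (2 * (m - i)))"
        by (subst sum.reindex) (auto simp: inj_on_def)
      finally have "(\<Sum>s<?l. crank_nth ?l s \<tau> * u ^ s) / u ^ ?l = (\<Sum>i\<le>m. crank_nth ?l (2 * (m - i)) \<tau> * u ^ (2 * (m - i)) / u ^ ?l)"
        by (simp only: sum_divide_distrib)
      also have "\<dots> = (\<Sum>i\<le>m. crank_nth ?l (2 * (m - i)) \<tau> / u ^ (2 * i + 1))"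
      proof (intro sum.cong refl)
        fix i assume "i \<in> {..m}"
        hence "?l = 2 * (m - i) + (2 * i + 1)" by simp
        hence "u ^ ?l = u ^ (2 * (m - i)) * u ^ (2 * i + 1)" by (simp only: power_add)
        thus "crank_nth ?l (2 * (m - i)) \<tau> * u ^ (2 * (m - i)) / u ^ ?l = crank_nth ?l (2 * (m - i)) \<tau> / u ^ (2 * i + 1)"
          using u(2) by (simp del: power_Suc)
      qed
      finally show ?case unfolding u_def[symmetric] 1 R_def by (simp only: diff_divide_distrib) simp
    qed
  qed
  qed
  thus ?thesis by blast
qed

section \<open>Entire functions with an inhomogeneous elliptic law\<close>

text \<open>
  Going up by \<open>\<tau>\<close>, the factor \<open>e2pi z ^ l\<close> is at most \<open>1 / 2\<close>, and the inhomogeneous term stays bounded;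
  going down, one divides by \<open>e2pi z ^ l\<close>, which is at least \<open>2\<close> and dominates the powers below \<open>l\<close>.
  In both directions a bound on one strip propagates, so \<open>g\<close> is a constant \<open>k\<close>. The equation
  \<open>k (1 + w\<^sup>l) + \<Sum> c\<^sub>s w\<^sup>s = 0\<close> for all \<open>w \<noteq> 0\<close> then forces \<open>k = 0\<close>.
\<close>

lemma inhomogeneous_elliptic_eq_0:
  assumes \<tau>: "\<tau> \<in> upper_half_plane" and l: "l > 0" and g: "g holomorphic_on UNIV"
    and per: "\<And>z. g (z + 1) = g z"
    and quasi: "\<And>z. g (z + \<tau>) = - (e2pi z ^ l * g z) - (\<Sum>s<l. c s * e2pi z ^ s)"
  shows "g z = 0"
proof -
  define y where "y = Im \<tau>"
  have y: "y > 0" using \<tau> by (simp add: y_def upper_half_plane_def)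
  define K1 where "K1 = (\<Sum>s<l. norm (c s))"
  have K1: "K1 \<ge> 0" unfolding K1_def by (intro sum_nonneg) auto
  obtain K where K: "\<And>z. - (1 + y) \<le> Im z \<Longrightarrow> Im z \<le> 1 + y \<Longrightarrow> norm (g z) \<le> K"
    using bounded_on_strip[OF holomorphic_on_imp_continuous_on[OF g] per] by metis
  define M where "M = max K (2 * K1)"
  have M: "K \<le> M" "K1 \<le> M / 2" "0 \<le> M" using K1 by (auto simp: M_def)
  have e2: "exp (2 * pi) \<ge> (2 :: real)"
    using exp_ge_add_one_self[of "2 * pi"] pi_gt3 by linarith
  have small: "norm (e2pi w) \<le> 1 / 2" if "Im w \<ge> 1" for w
  proof -
    have "norm (e2pi w) \<le> exp (- (2 * pi))" using that by (simp add: norm_e2pi)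
    also have "\<dots> \<le> 1 / 2" using e2 by (simp add: exp_minus field_simps)
    finally show ?thesis .
  qed
  have large: "norm (e2pi w) \<ge> 2" if "Im w \<le> -1" for w
  proof -
    have "2 * pi * 1 \<le> 2 * pi * (- Im w)" using that by (intro mult_left_mono) auto
    hence "exp (2 * pi) \<le> norm (e2pi w)" by (simp add: norm_e2pi)
    thus ?thesis using e2 by simp
  qed
  have P1: "norm (\<Sum>s<l. c s * e2pi w ^ s) \<le> K1" if "norm (e2pi w) \<le> 1" for w
  proof -
    have "norm (\<Sum>s<l. c s * e2pi w ^ s) \<le> (\<Sum>s<l. norm (c s * e2pi w ^ s))" by (rule norm_sum)
    also have "\<dots> \<le> K1" unfolding K1_def norm_mult norm_power
      by (intro sum_mono mult_left_le power_le_one that) auto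
    finally show ?thesis .
  qed
  have P2: "norm (\<Sum>s<l. c s * e2pi w ^ s) \<le> K1 * norm (e2pi w) ^ (l - 1)" if "norm (e2pi w) \<ge> 1" for w
  proof -
    have "norm (\<Sum>s<l. c s * e2pi w ^ s) \<le> (\<Sum>s<l. norm (c s * e2pi w ^ s))" by (rule norm_sum)
    also have "\<dots> \<le> (\<Sum>s<l. norm (c s) * norm (e2pi w) ^ (l - 1))" unfolding norm_mult norm_power
      by (intro sum_mono mult_left_mono power_increasing that) auto
    finally show ?thesis by (simp add: K1_def sum_distrib_right)
  qed
  have up: "norm (g z) \<le> M" if "- 1 \<le> Im z" "Im z \<le> 1 + y + of_nat n * y" for n z
    using that
  proof (induction n arbitrary: z)
    case 0
    thus ?case using K[of z] M y by simp
  next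
    case (Suc n)
    show ?case
    proof (cases "Im z \<le> 1 + y")
      case True
      thus ?thesis using K[of z] Suc.prems M y by simp
    next
      case False
      define w where "w = z - \<tau>"
      have w: "Im w \<ge> 1" "Im w \<le> 1 + y + of_nat n * y"
        using False Suc.prems by (auto simp: w_def y_def algebra_simps)
      have e: "norm (e2pi w) \<le> 1 / 2" by (rule small[OF w(1)])
      have "norm (e2pi w) ^ l \<le> norm (e2pi w) ^ 1" using e l by (intro power_decreasing) auto
      hence "norm (e2pi w ^ l * g w) \<le> 1 / 2 * M"
        unfolding norm_mult norm_power using e Suc.IH[of w] w by (intro mult_mono) auto
      moreover have "norm (\<Sum>s<l. c s * e2pi w ^ s) \<le> M / 2" using P1[of w] e M by simp
      moreover have "norm (- a - b) \<le> norm a + norm b" for a b :: complex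
        using norm_triangle_ineq4[of "- a" b] by simp
      ultimately have "norm (g (w + \<tau>)) \<le> 1 / 2 * M + M / 2" unfolding quasi by (metis add_mono order_trans)
      thus ?thesis by (simp add: w_def)
    qed
  qed
  have down: "norm (g z) \<le> M" if "- 1 - of_nat n * y \<le> Im z" "Im z \<le> 1 + y" for n z
    using that
  proof (induction n arbitrary: z)
    case 0
    thus ?case using K[of z] M y by simp
  next
    case (Suc n)
    show ?case
    proof (cases "Im z \<ge> - 1")
      case True
      thus ?thesis using K[of z] Suc.prems M y by simp
    next
      case False
      have e: "norm (e2pi z) \<ge> 2" using False by (intro large) simp
      have IH: "norm (g (z + \<tau>)) \<le> M"
        using Suc.prems False y by (intro Suc.IH) (auto simp: y_def algebra_simps)
      have "norm (e2pi z) ^ l * norm (g z) = norm (- g (z + \<tau>) - (\<Sum>s<l. c s * e2pi z ^ s))"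
        unfolding quasi by (simp add: norm_mult norm_power)
      also have "\<dots> \<le> M + K1 * norm (e2pi z) ^ (l - 1)"
        using norm_triangle_ineq4[of "- g (z + \<tau>)" "\<Sum>s<l. c s * e2pi z ^ s"] IH P2[of z] e by simp
      also have "\<dots> \<le> M * norm (e2pi z) ^ (l - 1) + M * norm (e2pi z) ^ (l - 1)"
        using e M one_le_power[of "norm (e2pi z)" "l - 1"]
        by (intro add_mono mult_right_mono) (auto simp: mult_le_cancel_left1)
      also have "\<dots> = 2 * M * norm (e2pi z) ^ (l - 1)" by simp
      also have "\<dots> \<le> norm (e2pi z) * M * norm (e2pi z) ^ (l - 1)"
        using e M by (intro mult_right_mono) auto
      also have "\<dots> = norm (e2pi z) ^ l * M"
        using l by (cases l) simp_all
      finally show ?thesis using e by (simp add: mult_le_cancel_left)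
    qed
  qed
  have "norm (g z) \<le> M" for z
  proof (cases "Im z \<le> 1 + y")
    case True
    obtain n :: nat where "(- 1 - Im z) / y \<le> of_nat n" using real_arch_simple by blast
    hence "- 1 - of_nat n * y \<le> Im z" using y by (simp add: field_simps)
    thus ?thesis using True by (rule down)
  next
    case False
    obtain n :: nat where "Im z / y \<le> of_nat n" using real_arch_simple by blast
    hence "Im z \<le> 1 + y + of_nat n * y" using y by (simp add: field_simps)
    thus ?thesis using False y by (intro up) auto
  qed
  hence "bounded (range g)" by (auto simp: bounded_iff)
  with g have "g constant_on UNIV" by (rule Liouville_theorem)
  then obtain k where k: "\<And>z. g z = k" by (auto simp: constant_on_def)
  have "k = 0"
  proof (rule ccontr)
    assume "k \<noteq> 0"
    hence nk: "norm k > 0" by simp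
    \<comment> \<open>For \<open>\<bar>w\<bar> = X\<close> the equation would give \<open>X \<bar>k\<bar> \<le> \<bar>k\<bar> + K1\<close>, which this choice violates.\<close>
    define X where "X = (norm k + K1) / norm k + 1"
    have X: "X \<ge> 1" using nk K1 by (simp add: X_def)
    define w where "w = Complex 0 (- (ln X / (2 * pi)))"
    have e: "norm (e2pi w) = X" using X by (simp add: norm_e2pi w_def)
    have "A = - B - C" if "B = - A - C" for A B C :: complex unfolding that by simp
    hence "e2pi w ^ l * k = - k - (\<Sum>s<l. c s * e2pi w ^ s)"
      using quasi[of w] unfolding k by blast
    hence "X ^ l * norm k = norm (- k - (\<Sum>s<l. c s * e2pi w ^ s))"
      by (metis e norm_mult norm_power)
    also have "\<dots> \<le> norm k + K1 * X ^ (l - 1)"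
      using norm_triangle_ineq4[of "- k" "\<Sum>s<l. c s * e2pi w ^ s"] P2[of w] X e by simp
    also have "\<dots> \<le> norm k * X ^ (l - 1) + K1 * X ^ (l - 1)"
      using X one_le_power[OF X, of "l - 1"] by (simp add: mult_le_cancel_left1)
    finally have "X * norm k * X ^ (l - 1) \<le> (norm k + K1) * X ^ (l - 1)"
      using l by (cases l) (simp_all add: algebra_simps)
    hence "X * norm k \<le> norm k + K1" using X by simp
    moreover have "X * norm k = norm k + K1 + norm k" using nk by (simp add: X_def field_simps)
    ultimately show False using nk by simp
  qed
  thus ?thesis using k by simp
qed

text \<open>
  The functional equations carry the limit at \<open>0\<close> to all other lattice points, so \<open>G\<close> extends to an
  entire function, and the equations extend to it by continuity.
\<close>

lemma inhomogeneous_elliptic_vanish: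
  assumes \<tau>: "\<tau> \<in> upper_half_plane" and l: "l > 0" and hol: "G holomorphic_on (- period_lattice \<tau>)"
    and lim: "G \<midarrow>0\<rightarrow> L"
    and per: "\<And>z. z \<notin> period_lattice \<tau> \<Longrightarrow> G (z + 1) = G z"
    and quasi: "\<And>z. z \<notin> period_lattice \<tau> \<Longrightarrow> G (z + \<tau>) = - (e2pi z ^ l * G z) - (\<Sum>s<l. c s * e2pi z ^ s)"
    and z: "z \<notin> period_lattice \<tau>"
  shows "G z = 0"
proof -
  define has_lim where "has_lim = (\<lambda>w. \<exists>L. G \<midarrow>w\<rightarrow> L)"
  have ev: "\<forall>\<^sub>F z in at w. z \<notin> period_lattice \<tau>" for w
    by (rule eventually_not_period_lattice[OF \<tau>])
  have shift: "has_lim (w + \<omega>)" if "(\<lambda>z. G (z + \<omega>)) \<midarrow>w\<rightarrow> L" for w \<omega> L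
    using LIM_offset[OF that, of "- \<omega>"] by (auto simp: has_lim_def)
  have p1: "has_lim (w + 1)" if hl: "has_lim w" for w
  proof -
    obtain L where "G \<midarrow>w\<rightarrow> L" using hl unfolding has_lim_def by blast
    hence "(\<lambda>z. G (z + 1)) \<midarrow>w\<rightarrow> L"
      by (rule Lim_transform_eventually) (rule eventually_mono[OF ev], simp add: per)
    thus ?thesis by (rule shift)
  qed
  have m1: "has_lim (w - 1)" if hl: "has_lim w" for w
  proof -
    obtain L where L: "G \<midarrow>w\<rightarrow> L" using hl unfolding has_lim_def by blast
    have "G z = G (z + (- 1))" if "z \<notin> period_lattice \<tau>" for z
    proof -
      have "z - 1 \<notin> period_lattice \<tau>" using that period_lattice_shift_1[of "z - 1" \<tau>] by simp
      thus ?thesis using per[of "z - 1"] by simp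
    qed
    hence "\<forall>\<^sub>F z in at w. G z = G (z + (- 1))" by (rule eventually_mono[OF ev])
    with L have "(\<lambda>z. G (z + (- 1))) \<midarrow>w\<rightarrow> L" by (rule Lim_transform_eventually)
    thus ?thesis using shift by fastforce
  qed
  have pt: "has_lim (w + \<tau>)" if hl: "has_lim w" for w
  proof -
    obtain L where "G \<midarrow>w\<rightarrow> L" using hl unfolding has_lim_def by blast
    hence "((\<lambda>z. - (e2pi z ^ l * G z) - (\<Sum>s<l. c s * e2pi z ^ s)) \<longlongrightarrow> - (e2pi w ^ l * L) - (\<Sum>s<l. c s * e2pi w ^ s)) (at w)"
      by (intro tendsto_intros)
    hence "(\<lambda>z. G (z + \<tau>)) \<midarrow>w\<rightarrow> - (e2pi w ^ l * L) - (\<Sum>s<l. c s * e2pi w ^ s)"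
      by (rule Lim_transform_eventually) (rule eventually_mono[OF ev], simp add: quasi)
    thus ?thesis by (rule shift)
  qed
  have mt: "has_lim (w - \<tau>)" if hl: "has_lim w" for w
  proof -
    obtain L where "G \<midarrow>w\<rightarrow> L" using hl unfolding has_lim_def by blast
    hence lim': "((\<lambda>z. - (G z + (\<Sum>s<l. c s * e2pi (z - \<tau>) ^ s)) / e2pi (z - \<tau>) ^ l) \<longlongrightarrow>
        - (L + (\<Sum>s<l. c s * e2pi (w - \<tau>) ^ s)) / e2pi (w - \<tau>) ^ l) (at w)"
      by (intro tendsto_intros) auto
    have "- (G z + (\<Sum>s<l. c s * e2pi (z - \<tau>) ^ s)) / e2pi (z - \<tau>) ^ l = G (z + (- \<tau>))"
      if "z \<notin> period_lattice \<tau>" for z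
    proof -
      have "z - \<tau> \<notin> period_lattice \<tau>" using that period_lattice_shift_tau[of "z - \<tau>" \<tau>] by simp
      thus ?thesis using quasi[of "z - \<tau>"] by simp
    qed
    hence "\<forall>\<^sub>F z in at w. - (G z + (\<Sum>s<l. c s * e2pi (z - \<tau>) ^ s)) / e2pi (z - \<tau>) ^ l = G (z + (- \<tau>))"
      by (rule eventually_mono[OF ev])
    with lim' have "(\<lambda>z. G (z + (- \<tau>))) \<midarrow>w\<rightarrow> - (L + (\<Sum>s<l. c s * e2pi (w - \<tau>) ^ s)) / e2pi (w - \<tau>) ^ l"
      by (rule Lim_transform_eventually)
    thus ?thesis using shift by fastforce
  qed
  have "has_lim 0" using lim by (auto simp: has_lim_def)
  hence a: "has_lim (of_int a * \<tau>)" for a :: int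
  proof (induction a rule: int_induct[where k = 0])
    case (step1 i)
    thus ?case using pt[of "of_int i * \<tau>"] by (simp add: distrib_right)
  next
    case (step2 i)
    thus ?case using mt[of "of_int i * \<tau>"] by (simp add: left_diff_distrib)
  qed simp
  have "has_lim (of_int a * \<tau> + of_int b)" for a b :: int
  proof (induction b rule: int_induct[where k = 0])
    case base
    show ?case using a by simp
  next
    case (step1 i)
    thus ?case using p1[of "of_int a * \<tau> + of_int i"] by (simp add: add_ac)
  next
    case (step2 i)
    thus ?case using m1[of "of_int a * \<tau> + of_int i"] by (simp add: algebra_simps)
  qed
  hence lims: "\<exists>L. G \<midarrow>w\<rightarrow> L" if "w \<in> period_lattice \<tau>" for w
    using that unfolding has_lim_def period_lattice_def by blast
  obtain g where g: "g holomorphic_on UNIV" "\<And>z. z \<notin> period_lattice \<tau> \<Longrightarrow> g z = G z"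
    using entire_extension[OF \<tau> hol lims] by blast
  have gc: "continuous_on UNIV g" using g(1) by (rule holomorphic_on_imp_continuous_on)
  have gs: "continuous_on UNIV (\<lambda>w. g (w + s))" for s
    by (intro continuous_on_compose2[OF gc] continuous_intros) auto
  have "g (w + 1) = g w" for w
    by (rule eq_off_period_lattice_imp_eq[OF \<tau> gs gc]) (simp add: g(2) per)
  moreover have "g (w + \<tau>) = - (e2pi w ^ l * g w) - (\<Sum>s<l. c s * e2pi w ^ s)" for w
    by (rule eq_off_period_lattice_imp_eq[OF \<tau> gs])
       (auto intro!: continuous_intros gc simp: g(2) quasi)
  ultimately have "g z = 0" by (rule inhomogeneous_elliptic_eq_0[OF \<tau> l g(1)])
  thus ?thesis using g(2)[OF z] by simp
qed

section \<open>The differential equation\<close>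

text \<open>
  The difference \<open>\<Delta>\<close> of both sides has no principal part at \<open>0\<close> by the choice of the coefficients.
  Multiplied by \<open>w\<^bsup>-l/2\<^esup>\<close> it has period \<open>1\<close> and satisfies the inhomogeneous law with exponents
  \<open>0, \<dots>, l - 1\<close>, so it vanishes.
\<close>

lemma appell_pde:
  fixes m :: nat
  assumes \<tau>: "\<tau> \<in> upper_half_plane" and z: "z \<notin> period_lattice \<tau>"
  defines "l \<equiv> 2 * m + 1"
  shows "(\<Sum>k=0..m. pde_coeff m (m - k) \<tau> * heat_op_iter l k (appell l) z \<tau>) =
           fact (2 * m) * inverse (crank_theta z \<tau>) ^ l"
proof -
  have l: "l > 0" "odd l" by (auto simp: l_def)
  define C where "C = (\<lambda>i. \<Sum>k=0..m. pde_coeff m (m - k) \<tau> * heat_coeff l k i \<tau>)"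
  define B where "B = (\<lambda>i z. appell_sum UNIV l i z \<tau>)"
  define E where "E = (\<lambda>z. inverse (crank_theta z \<tau>) ^ l)"
  define \<Delta> where "\<Delta> = (\<lambda>z. (\<Sum>i\<le>m. C i * B i z) - fact (2 * m) * E z)"
  have reg: "regular UNIV z \<tau>" if "z \<notin> period_lattice \<tau>" for z
    using that \<tau> by (simp add: regular_UNIV_iff)
  have lhs: "(\<Sum>k=0..m. pde_coeff m (m - k) \<tau> * heat_op_iter l k (appell l) z \<tau>) = (\<Sum>i\<le>m. C i * B i z)"
  proof -
    have "heat_op_iter l k (appell l) z \<tau> = (\<Sum>i\<le>m. heat_coeff l k i \<tau> * B i z)" if "k \<le> m" for k
      unfolding heat_op_iter_appell[OF l(1) reg[OF z]] B_def
      by (rule sum.mono_neutral_left) (use that in \<open>auto simp: heat_coeff_eq_0\<close>)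
    hence "(\<Sum>k=0..m. pde_coeff m (m - k) \<tau> * heat_op_iter l k (appell l) z \<tau>) =
        (\<Sum>k=0..m. \<Sum>i\<le>m. pde_coeff m (m - k) \<tau> * (heat_coeff l k i \<tau> * B i z))"
      by (intro sum.cong refl) (simp add: sum_distrib_left)
    also have "\<dots> = (\<Sum>i\<le>m. C i * B i z)"
      unfolding C_def sum_distrib_right by (subst sum.swap) (simp add: mult.assoc)
    finally show ?thesis .
  qed
  define h where "h = (\<lambda>s. \<Sum>i\<le>m. C i * infsum (theta_term l i s \<tau>) UNIV)"
  have \<Delta>1: "\<Delta> (z + 1) = - \<Delta> z" if "z \<notin> period_lattice \<tau>" for z
    using l(2) by (simp add: \<Delta>_def B_def E_def appell_sum_add_1[OF l(2) reg[OF that]] crank_theta_add_1 sum_negf)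
  have \<Delta>t: "\<Delta> (z + \<tau>) = - e2pi (of_nat l * z + of_nat l * \<tau> / 2) * (\<Delta> z + (\<Sum>s<l. e2pi ((of_nat s - of_nat l / 2) * z) * h s))"
    if "z \<notin> period_lattice \<tau>" for z
  proof -
    define X where "X = e2pi (of_nat l * z + of_nat l * \<tau> / 2)"
    have "E (z + \<tau>) = - X * E z"
    proof -
      have "inverse (e2pi (- z - \<tau> / 2)) ^ l = X"
        unfolding e2pi_minus[symmetric] e2pi_of_nat_mult[symmetric] X_def
        by (rule arg_cong[of _ _ e2pi]) (simp add: field_simps)
      thus ?thesis unfolding E_def crank_theta_add_tau[OF \<tau>] using l(2)
        by (simp add: power_mult_distrib)
    qed
    moreover have "(\<Sum>i\<le>m. C i * B i (z + \<tau>)) = - X * ((\<Sum>i\<le>m. C i * B i z) + (\<Sum>s<l. e2pi ((of_nat s - of_nat l / 2) * z) * h s))"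
    proof -
      have "(\<Sum>i\<le>m. C i * B i (z + \<tau>)) = (\<Sum>i\<le>m. - X * (C i * B i z) +
          - X * (\<Sum>s<l. e2pi ((of_nat s - of_nat l / 2) * z) * (C i * infsum (theta_term l i s \<tau>) UNIV)))"
        unfolding B_def appell_sum_add_tau[OF l(2) reg[OF that]] X_def[symmetric]
      proof (intro sum.cong refl)
        fix i
        have "(\<Sum>s<l. e2pi ((of_nat s - of_nat l / 2) * z) * (C i * infsum (theta_term l i s \<tau>) UNIV)) =
            C i * (\<Sum>s<l. e2pi ((of_nat s - of_nat l / 2) * z) * infsum (theta_term l i s \<tau>) UNIV)"
          unfolding sum_distrib_left by (intro sum.cong refl) (simp only: mult_ac)
        moreover have "c * (- X * (b + S)) = - X * (c * b) + - X * (c * S)" for b c S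
          by (simp add: algebra_simps)
        ultimately show "C i * (- X * (appell_sum UNIV l i z \<tau> + (\<Sum>s<l. e2pi ((of_nat s - of_nat l / 2) * z) * infsum (theta_term l i s \<tau>) UNIV))) =
           - X * (C i * appell_sum UNIV l i z \<tau>) + - X * (\<Sum>s<l. e2pi ((of_nat s - of_nat l / 2) * z) * (C i * infsum (theta_term l i s \<tau>) UNIV))"
          by (simp only:)
      qed
      also have "\<dots> = - X * ((\<Sum>i\<le>m. C i * B i z) + (\<Sum>i\<le>m. \<Sum>s<l. e2pi ((of_nat s - of_nat l / 2) * z) * (C i * infsum (theta_term l i s \<tau>) UNIV)))"
        by (simp only: sum.distrib sum_distrib_left[symmetric] distrib_left)
      also have "(\<Sum>i\<le>m. \<Sum>s<l. e2pi ((of_nat s - of_nat l / 2) * z) * (C i * infsum (theta_term l i s \<tau>) UNIV)) =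
         (\<Sum>s<l. e2pi ((of_nat s - of_nat l / 2) * z) * h s)"
        unfolding h_def sum_distrib_left by (rule sum.swap)
      finally show ?thesis .
    qed
    ultimately show ?thesis unfolding \<Delta>_def X_def[symmetric] by (simp add: algebra_simps)
  qed
  obtain L where L: "(\<Delta> \<longlongrightarrow> L) (at 0)"
  proof -
    let ?p = "2 * of_real pi * \<i> :: complex"
    have "\<forall>i. \<exists>L. ((\<lambda>z. B i z + fact (2 * i) / (?p * z) ^ (2 * i + 1)) \<longlongrightarrow> L) (at 0)"
      unfolding B_def using appell_sum_principal_part[OF \<tau> l(1)] by blast
    then obtain \<beta> where \<beta>: "\<And>i. ((\<lambda>z. B i z + fact (2 * i) / (?p * z) ^ (2 * i + 1)) \<longlongrightarrow> \<beta> i) (at 0)" by metis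
    obtain \<epsilon> where \<epsilon>: "((\<lambda>z. E z + (\<Sum>i\<le>m. crank_nth l (2 * (m - i)) \<tau> / (?p * z) ^ (2 * i + 1))) \<longlongrightarrow> \<epsilon>) (at 0)"
      unfolding E_def l_def using crank_principal_part[OF \<tau>, of m] by blast
    have "((\<lambda>z. (\<Sum>i\<le>m. C i * (B i z + fact (2 * i) / (?p * z) ^ (2 * i + 1))) -
        fact (2 * m) * (E z + (\<Sum>i\<le>m. crank_nth l (2 * (m - i)) \<tau> / (?p * z) ^ (2 * i + 1)))) \<longlongrightarrow>
        (\<Sum>i\<le>m. C i * \<beta> i) - fact (2 * m) * \<epsilon>) (at 0)"
      by (intro tendsto_intros \<beta> \<epsilon>)
    also have "(\<lambda>z. (\<Sum>i\<le>m. C i * (B i z + fact (2 * i) / (?p * z) ^ (2 * i + 1))) -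
        fact (2 * m) * (E z + (\<Sum>i\<le>m. crank_nth l (2 * (m - i)) \<tau> / (?p * z) ^ (2 * i + 1)))) = \<Delta>"
    proof
      fix z
      have "(\<Sum>i\<le>m. C i * (fact (2 * i) / (?p * z) ^ (2 * i + 1))) =
          (\<Sum>i\<le>m. fact (2 * m) * (crank_nth l (2 * (m - i)) \<tau> / (?p * z) ^ (2 * i + 1)))"
      proof (intro sum.cong refl)
        fix i assume "i \<in> {..m}"
        hence "fact (2 * i) * C i = fact (2 * m) * crank_nth l (2 * (m - i)) \<tau>"
          using pde_coeff_heat_coeff[OF _ \<tau>, of i m] by (simp add: C_def l_def)
        thus "C i * (fact (2 * i) / (?p * z) ^ (2 * i + 1)) = fact (2 * m) * (crank_nth l (2 * (m - i)) \<tau> / (?p * z) ^ (2 * i + 1))"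
          by (simp only: times_divide_eq_right mult.commute[of "C i"])
      qed
      thus "(\<Sum>i\<le>m. C i * (B i z + fact (2 * i) / (?p * z) ^ (2 * i + 1))) -
        fact (2 * m) * (E z + (\<Sum>i\<le>m. crank_nth l (2 * (m - i)) \<tau> / (?p * z) ^ (2 * i + 1))) = \<Delta> z"
        unfolding \<Delta>_def distrib_left sum.distrib sum_distrib_left by simp
    qed
    finally show thesis by (rule that)
  qed
  define G where "G = (\<lambda>z. e2pi (- (of_nat l / 2) * z) * \<Delta> z)"
  have "(G \<longlongrightarrow> e2pi (- (of_nat l / 2) * 0) * L) (at 0)"
    unfolding G_def by (intro tendsto_intros L)
  hence "G z = 0"
  proof (rule inhomogeneous_elliptic_vanish[OF \<tau> l(1), rotated, where c = h])
    have "(\<lambda>z. B i z) analytic_on (- period_lattice \<tau>)" for i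
      unfolding B_def by (subst analytic_on_analytic_at) (auto intro!: analytic_appell_sum_z reg l)
    hence "(\<lambda>z. B i z) holomorphic_on (- period_lattice \<tau>)" for i by (rule analytic_imp_holomorphic)
    thus "G holomorphic_on (- period_lattice \<tau>)"
      unfolding G_def \<Delta>_def E_def using crank_theta_nonzero[OF \<tau>]
      by (intro holomorphic_intros holomorphic_crank_theta \<tau>) auto
    show "G (z + 1) = G z" if "z \<notin> period_lattice \<tau>" for z
    proof -
      have "e2pi (- (of_nat l / 2) * (z + 1)) = e2pi (- (of_nat l / 2) * z) * e2pi (of_int (- int l) / 2)"
        unfolding e2pi_add[symmetric] by (rule arg_cong[of _ _ e2pi]) (simp add: field_simps)
      also have "e2pi (of_int (- int l) / 2) = -1"
        unfolding e2pi_half_of_int using l(2) by (simp add: power_int_minus)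
      finally show ?thesis using \<Delta>1[OF that] by (simp add: G_def)
    qed
    show "G (z + \<tau>) = - (e2pi z ^ l * G z) - (\<Sum>s<l. h s * e2pi z ^ s)" if "z \<notin> period_lattice \<tau>" for z
    proof -
      have e1: "e2pi (- (of_nat l / 2) * (z + \<tau>)) * e2pi (of_nat l * z + of_nat l * \<tau> / 2) = e2pi (of_nat l / 2 * z)"
        unfolding e2pi_add[symmetric] by (rule arg_cong[of _ _ e2pi]) (simp add: field_simps)
      have e2: "e2pi (of_nat l / 2 * z) * e2pi ((of_nat s - of_nat l / 2) * z) = e2pi z ^ s" for s
        unfolding e2pi_add[symmetric] e2pi_of_nat_mult[symmetric] by (rule arg_cong[of _ _ e2pi]) (simp add: field_simps)
      have e3: "e2pi (of_nat l / 2 * z) = e2pi z ^ l * e2pi (- (of_nat l / 2) * z)"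
        unfolding e2pi_add[symmetric] e2pi_of_nat_mult[symmetric] by (rule arg_cong[of _ _ e2pi]) (simp add: field_simps)
      have "G (z + \<tau>) = - (e2pi (of_nat l / 2 * z) * (\<Delta> z + (\<Sum>s<l. e2pi ((of_nat s - of_nat l / 2) * z) * h s)))"
        unfolding G_def \<Delta>t[OF that] e1[symmetric] by (simp only: mult_minus_left mult_minus_right mult.assoc)
      also have "e2pi (of_nat l / 2 * z) * (\<Delta> z + (\<Sum>s<l. e2pi ((of_nat s - of_nat l / 2) * z) * h s)) =
         e2pi (of_nat l / 2 * z) * \<Delta> z + (\<Sum>s<l. (e2pi (of_nat l / 2 * z) * e2pi ((of_nat s - of_nat l / 2) * z)) * h s)"
        by (simp only: distrib_left sum_distrib_left mult.assoc)
      also have "\<dots> = e2pi z ^ l * G z + (\<Sum>s<l. h s * e2pi z ^ s)"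
        unfolding e2 unfolding G_def e3 by (simp only: mult_ac)
      finally show ?thesis by simp
    qed
  qed (rule z)
  hence "\<Delta> z = 0" by (simp add: G_def)
  thus ?thesis unfolding lhs by (simp add: \<Delta>_def E_def)
qed

theorem theorem1p4:
  fixes l :: nat
  assumes "odd l"
  shows "\<exists>f :: nat \<Rightarrow> complex \<Rightarrow> complex.
    (\<forall>j\<in>{0..l - 1}. even j \<longrightarrow> modular_form (int j) (f j)) \<and>
    (\<exists>\<tau>\<in>upper_half_plane. f 0 \<tau> \<noteq> 0) \<and>
    (\<forall>\<tau>\<in>upper_half_plane. \<forall>z. z \<notin> period_lattice \<tau> \<longrightarrow>
      (\<Sum>k = 0..(l - 1) div 2. f (l - 2 * k - 1) \<tau> * heat_op_iter l k (appell l) z \<tau>) =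
      fact (l - 1) * f 0 \<tau> * dedekind_eta \<tau> ^ l * modified_crank z \<tau> ^ l)"
proof -
  from assms obtain m where l: "l = 2 * m + 1" by (rule oddE)
  define f where "f = (\<lambda>j. pde_coeff m (j div 2))"
  show ?thesis
  proof (intro exI[of _ f] conjI ballI allI impI)
    fix j assume "j \<in> {0..l - 1}" "even j"
    then obtain r where "j = 2 * r" "r \<le> m" by (auto simp: l)
    thus "modular_form (int j) (f j)" using modular_form_pde_coeff[of r m] by (simp add: f_def)
  next
    show "\<exists>\<tau>\<in>upper_half_plane. f 0 \<tau> \<noteq> 0"
      by (rule bexI[of _ \<i>]) (simp_all add: f_def pde_coeff_0 upper_half_plane_def)
  next
    fix \<tau> z assume \<tau>: "\<tau> \<in> upper_half_plane" and z: "z \<notin> period_lattice \<tau>"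
    have "(\<Sum>k = 0..(l - 1) div 2. f (l - 2 * k - 1) \<tau> * heat_op_iter l k (appell l) z \<tau>) =
        (\<Sum>k = 0..m. pde_coeff m (m - k) \<tau> * heat_op_iter l k (appell l) z \<tau>)"
      by (intro sum.cong) (auto simp: l f_def diff_mult_distrib2[symmetric])
    also have "\<dots> = fact (2 * m) * inverse (crank_theta z \<tau>) ^ l"
      unfolding l by (rule appell_pde[OF \<tau> z])
    also have "\<dots> = fact (l - 1) * f 0 \<tau> * dedekind_eta \<tau> ^ l * modified_crank z \<tau> ^ l"
      unfolding eta_times_crank[OF \<tau>, of z, symmetric] by (simp add: l f_def pde_coeff_0 power_mult_distrib)
    finally show "(\<Sum>k = 0..(l - 1) div 2. f (l - 2 * k - 1) \<tau> * heat_op_iter l k (appell l) z \<tau>) =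
      fact (l - 1) * f 0 \<tau> * dedekind_eta \<tau> ^ l * modified_crank z \<tau> ^ l" .
  qed
qed

end
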